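(* Let $k$ be a field of characteristic $p \geq 3$ and $A := k \langle y \mid y^p = 0 \rangle$ the $p$-dimensional Hopf algebra generated by a primitive element $y$. Then: (1) Up to an isomorphism of Hopf algebras there exist exactly two crossed products of Hopf algebras $A\#H_4$: $A \otimes H_4$ and $A_{4p}$, where $A_{4p}$ is the $4p$-dimensional Hopf algebra generated by $g$ and $x$ subject to the relations $$x^{2p} = 0, \quad g^2 = 1, \quad x g = - g x$$ and with the coalgebra structure given such that $g$ is a group-like element and $x$ is $(1, g)$-primitive. Furthermore, there are isomorphisms of groups $$\mathrm{Aut}_{\rm Hopf} \big( A \otimes H_{4} \big) \simeq k^* \times k^* \qquad \text{and} \qquad \mathrm{Aut}_{\rm Hopf} \big( A_{4p} \big) \simeq k^*.$$ (2) There exists a bijection $\mathcal{H}^{2}(H_4, A) \cong k$.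
   Context: Primitive means $\Delta(y)=y\otimes1+1\otimes y$; group-like means $\Delta(g)=g\otimes g$; $x$ is $(1,g)$-primitive means $\Delta(x)=x\otimes 1+g\otimes x$. $\mathrm{Aut}_{\rm Hopf}$ denotes the group of Hopf algebra automorphisms. $H_4$ is Sweedler's 4-dimensional Hopf algebra over $k$, with basis $\{1,g,x,gx\}$, relations $g^2=1$, $x^2=0$, $xg=-gx$, $g$ group-like and $x$ $(1,g)$-primitive. Sweedler notation is used. For Hopf algebras $A$, $H$, a weak action of $H$ on $A$ is a $k$-linear map $\triangleright: H\otimes A\to A$ with $h\triangleright 1_A=\varepsilon_H(h)1_A$, $1_H\triangleright a=a$, and $h\triangleright(ab)=(h_{(1)}\triangleright a)(h_{(2)}\triangleright b)$. Given a weak action $\triangleright$ and a $k$-linear map $f:H\otimes H\to A$ (write $f(g,h)=f(g\otimes h)$), $A\#_f^{\triangleright}H$ denotes the vector space $A\otimes H$ (write $a\#h$ for $a\otimes h$) with multiplication $(a\#h)\cdot(c\#g):=a(h_{(1)}\triangleright c)f(h_{(2)},g_{(1)})\#h_{(3)}g_{(2)}$. $(A,H,\triangleright,f)$ is a crossed system of Hopf algebras, and $A\#_f^{\triangleright}H$ (also written $A\#H$) a crossed product of Hopf algebras, if $A\#_f^{\triangleright}H$ is a Hopf algebra with this multiplication, unit $1_A\#1_H$ and the tensor product coalgebra structure. Let $\mathcal{CS}(A,H)$ be the set of pairs $(\triangleright,f)$ such that $(A,H,\triangleright,f)$ is a crossed system of Hopf algebras. Put $(\triangleright,f)\approx(\triangleright',f')$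 if there is a unitary cocentral map $r:H\to A$ (a coalgebra map with $r(1)=1$ and $r(h_{(1)})\otimes h_{(2)}=r(h_{(2)})\otimes h_{(1)}$ for all $h$) such that $h\triangleright' a=r(h_{(1)})(h_{(2)}\triangleright a)(S_A\circ r)(h_{(3)})$ and $f'(h,g)=r(h_{(1)})\bigl(h_{(2)}\triangleright r(g_{(1)})\bigr)f(h_{(3)},g_{(2)})(S_A\circ r)(h_{(4)}g_{(3)})$ for all $a\in A$, $h,g\in H$. This is an equivalence relation, and $\mathcal{H}^2(H,A):=\mathcal{CS}(A,H)/\approx$. *)

theory Defs
  imports "HOL-Analysis.Cartesian_Space" "HOL-Algebra.Ideal" "HOL-Library.Poly_Mapping"
begin

text \<open>
  All Hopf algebras below are finite dimensional. A finite-dimensional vector space over the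
  field \<open>'k\<close> is taken with a basis indexed by a finite type \<open>'i\<close>, i.e. it is \<open>'k ^ 'i\<close>; the tensor
  product of \<open>'k ^ 'i\<close> and \<open>'k ^ 'j\<close> is then \<open>'k ^ ('i \<times> 'j)\<close>. Linear maps out of a tensor product
  \<open>V \<otimes> W\<close> such as multiplications, actions and cocycles are given as curried bilinear maps.
\<close>

subsection \<open>Tensor products\<close>

abbreviation klinear :: "('k::field ^ 'i \<Rightarrow> 'k ^ 'j) \<Rightarrow> bool" where
  "klinear \<equiv> Vector_Spaces.linear (*s) (*s)"

abbreviation kfunctional :: "('k::field ^ 'i \<Rightarrow> 'k) \<Rightarrow> bool" where
  "kfunctional \<equiv> Vector_Spaces.linear (*s) (*)"

definition kbilinear :: "('k::field ^ 'i \<Rightarrow> 'k ^ 'j \<Rightarrow> 'k ^ 'm) \<Rightarrow> bool" where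
  "kbilinear \<phi> \<longleftrightarrow> (\<forall>v. klinear (\<phi> v)) \<and> (\<forall>w. klinear (\<lambda>v. \<phi> v w))"

definition tens :: "'k::field ^ 'i \<Rightarrow> 'k ^ 'j \<Rightarrow> 'k ^ ('i \<times> 'j)" (infixl "\<otimes>\<^sub>k" 75) where
  "v \<otimes>\<^sub>k w = (\<chi> p. v $ fst p * w $ snd p)"

text \<open>The linear map on \<open>V \<otimes> W\<close> that sends \<open>v \<otimes> w\<close> to \<open>\<phi> v w\<close>, for bilinear \<open>\<phi>\<close>.\<close>

definition tlift ::
    "('k::field ^ 'i \<Rightarrow> 'k ^ 'j \<Rightarrow> 'k ^ 'm) \<Rightarrow> 'k ^ ('i \<times> 'j) \<Rightarrow> 'k ^ 'm" where
  "tlift \<phi> T = (\<Sum>(i, j)\<in>UNIV. T $ (i, j) *s \<phi> (axis i 1) (axis j 1))"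

definition treassoc ::
    "'k::field ^ (('i::finite \<times> 'j::finite) \<times> 'm::finite) \<Rightarrow> 'k ^ ('i \<times> ('j \<times> 'm))" where
  "treassoc T = (\<chi> p. T $ ((fst p, fst (snd p)), snd (snd p)))"

subsection \<open>Hopf algebras\<close>

text \<open>The antipode of a Hopf algebra is unique, so it is not part of the data.\<close>

record ('k, 'i) bialg =
  mul :: "'k ^ 'i::finite \<Rightarrow> 'k ^ 'i \<Rightarrow> 'k ^ 'i"
  unt :: "'k ^ 'i::finite"
  cmul :: "'k ^ 'i::finite \<Rightarrow> 'k ^ ('i \<times> 'i)"
  cunt :: "'k ^ 'i::finite \<Rightarrow> 'k"

abbreviation mul_syntax ::
    "'k ^ 'i::finite \<Rightarrow> ('k, 'i) bialg \<Rightarrow> 'k ^ 'i \<Rightarrow> 'k ^ 'i" ("_ \<cdot>\<^bsub>_\<^esub> _" [80, 0, 81] 80) where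
  "a \<cdot>\<^bsub>B\<^esub> b \<equiv> mul B a b"

text \<open>
  Sweedler sums: \<open>sw2 B \<phi> b\<close> is the sum of \<open>\<phi> b\<^sub>1 b\<^sub>2\<close>, and so on, for multilinear \<open>\<phi>\<close>.
\<close>

definition sw2 ::
    "('k::field, 'i::finite) bialg \<Rightarrow> ('k ^ 'i \<Rightarrow> 'k ^ 'i \<Rightarrow> 'k ^ 'm) \<Rightarrow> 'k ^ 'i \<Rightarrow> 'k ^ 'm" where
  "sw2 B \<phi> b = tlift \<phi> (cmul B b)"

definition sw3 ::
    "('k::field, 'i::finite) bialg \<Rightarrow> ('k ^ 'i \<Rightarrow> 'k ^ 'i \<Rightarrow> 'k ^ 'i \<Rightarrow> 'k ^ 'm)
      \<Rightarrow> 'k ^ 'i \<Rightarrow> 'k ^ 'm" where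
  "sw3 B \<phi> b = sw2 B (\<lambda>b1 r. sw2 B (\<lambda>b2 b3. \<phi> b1 b2 b3) r) b"

definition sw4 ::
    "('k::field, 'i::finite) bialg \<Rightarrow> ('k ^ 'i \<Rightarrow> 'k ^ 'i \<Rightarrow> 'k ^ 'i \<Rightarrow> 'k ^ 'i \<Rightarrow> 'k ^ 'm)
      \<Rightarrow> 'k ^ 'i \<Rightarrow> 'k ^ 'm" where
  "sw4 B \<phi> b = sw2 B (\<lambda>b1 r. sw3 B (\<lambda>b2 b3 b4. \<phi> b1 b2 b3 b4) r) b"

definition tensor_mul ::
    "('k::field, 'i::finite) bialg \<Rightarrow> ('k, 'j::finite) bialg
      \<Rightarrow> 'k ^ ('i \<times> 'j) \<Rightarrow> 'k ^ ('i \<times> 'j) \<Rightarrow> 'k ^ ('i \<times> 'j)" where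
  "tensor_mul B C S T =
     tlift (\<lambda>b c. tlift (\<lambda>b' c'. (b \<cdot>\<^bsub>B\<^esub> b') \<otimes>\<^sub>k (c \<cdot>\<^bsub>C\<^esub> c')) T) S"

definition algebra_axioms :: "('k::field, 'i::finite) bialg \<Rightarrow> bool" where
  "algebra_axioms B \<longleftrightarrow>
     kbilinear (mul B) \<and>
     (\<forall>a b c. (a \<cdot>\<^bsub>B\<^esub> b) \<cdot>\<^bsub>B\<^esub> c = a \<cdot>\<^bsub>B\<^esub> (b \<cdot>\<^bsub>B\<^esub> c)) \<and>
     (\<forall>a. unt B \<cdot>\<^bsub>B\<^esub> a = a \<and> a \<cdot>\<^bsub>B\<^esub> unt B = a)"

definition coalgebra_axioms :: "('k::field, 'i::finite) bialg \<Rightarrow> bool" where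
  "coalgebra_axioms B \<longleftrightarrow>
     klinear (cmul B) \<and> kfunctional (cunt B) \<and>
     (\<forall>b. treassoc (sw2 B (\<lambda>b1 b2. cmul B b1 \<otimes>\<^sub>k b2) b) = sw2 B (\<lambda>b1 b2. b1 \<otimes>\<^sub>k cmul B b2) b) \<and>
     (\<forall>b. sw2 B (\<lambda>b1 b2. cunt B b1 *s b2) b = b \<and> sw2 B (\<lambda>b1 b2. cunt B b2 *s b1) b = b)"

definition bialgebra :: "('k::field, 'i::finite) bialg \<Rightarrow> bool" where
  "bialgebra B \<longleftrightarrow>
     algebra_axioms B \<and> coalgebra_axioms B \<and>
     (\<forall>a b. cmul B (a \<cdot>\<^bsub>B\<^esub> b) = tensor_mul B B (cmul B a) (cmul B b)) \<and>
     cmul B (unt B) = unt B \<otimes>\<^sub>k unt B \<and>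
     (\<forall>a b. cunt B (a \<cdot>\<^bsub>B\<^esub> b) = cunt B a * cunt B b) \<and>
     cunt B (unt B) = 1"

definition is_antipode ::
    "('k::field, 'i::finite) bialg \<Rightarrow> ('k ^ 'i \<Rightarrow> 'k ^ 'i) \<Rightarrow> bool" where
  "is_antipode B S \<longleftrightarrow> klinear S \<and>
     (\<forall>b. sw2 B (\<lambda>b1 b2. S b1 \<cdot>\<^bsub>B\<^esub> b2) b = cunt B b *s unt B \<and>
          sw2 B (\<lambda>b1 b2. b1 \<cdot>\<^bsub>B\<^esub> S b2) b = cunt B b *s unt B)"

definition hopf_algebra :: "('k::field, 'i::finite) bialg \<Rightarrow> bool" where
  "hopf_algebra B \<longleftrightarrow> bialgebra B \<and> (\<exists>S. is_antipode B S)"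

definition antipode :: "('k::field, 'i::finite) bialg \<Rightarrow> 'k ^ 'i \<Rightarrow> 'k ^ 'i" where
  "antipode B = (THE S. is_antipode B S)"

definition grouplike :: "('k::field, 'i::finite) bialg \<Rightarrow> 'k ^ 'i \<Rightarrow> bool" where
  "grouplike B g \<longleftrightarrow> cmul B g = g \<otimes>\<^sub>k g"

text \<open>\<open>x\<close> is \<open>(1, g)\<close>-primitive.\<close>

definition skew_primitive :: "('k::field, 'i::finite) bialg \<Rightarrow> 'k ^ 'i \<Rightarrow> 'k ^ 'i \<Rightarrow> bool" where
  "skew_primitive B g x \<longleftrightarrow> cmul B x = x \<otimes>\<^sub>k unt B + g \<otimes>\<^sub>k x"

definition primitive :: "('k::field, 'i::finite) bialg \<Rightarrow> 'k ^ 'i \<Rightarrow> bool" where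
  "primitive B y \<longleftrightarrow> cmul B y = y \<otimes>\<^sub>k unt B + unt B \<otimes>\<^sub>k y"

subsection \<open>Homomorphisms\<close>

definition coalgebra_map ::
    "('k::field, 'i::finite) bialg \<Rightarrow> ('k, 'j::finite) bialg \<Rightarrow> ('k ^ 'i \<Rightarrow> 'k ^ 'j) \<Rightarrow> bool" where
  "coalgebra_map B C F \<longleftrightarrow> klinear F \<and>
     (\<forall>b. cmul C (F b) = sw2 B (\<lambda>b1 b2. F b1 \<otimes>\<^sub>k F b2) b) \<and>
     (\<forall>b. cunt C (F b) = cunt B b)"

text \<open>A bialgebra map between Hopf algebras automatically commutes with the antipodes.\<close>

definition hopf_hom ::
    "('k::field, 'i::finite) bialg \<Rightarrow> ('k, 'j::finite) bialg \<Rightarrow> ('k ^ 'i \<Rightarrow> 'k ^ 'j) \<Rightarrow> bool" where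
  "hopf_hom B C F \<longleftrightarrow> coalgebra_map B C F \<and>
     (\<forall>a b. F (a \<cdot>\<^bsub>B\<^esub> b) = F a \<cdot>\<^bsub>C\<^esub> F b) \<and> F (unt B) = unt C"

definition hopf_iso ::
    "('k::field, 'i::finite) bialg \<Rightarrow> ('k, 'j::finite) bialg \<Rightarrow> ('k ^ 'i \<Rightarrow> 'k ^ 'j) \<Rightarrow> bool" where
  "hopf_iso B C F \<longleftrightarrow> hopf_hom B C F \<and> bij F"

definition hopf_isomorphic ::
    "('k::field, 'i::finite) bialg \<Rightarrow> ('k, 'j::finite) bialg \<Rightarrow> bool" (infix "\<cong>\<^sub>H" 50) where
  "B \<cong>\<^sub>H C \<longleftrightarrow> (\<exists>F. hopf_iso B C F)"

definition Aut_Hopf :: "('k::field, 'i::finite) bialg \<Rightarrow> ('k ^ 'i \<Rightarrow> 'k ^ 'i) monoid" where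
  "Aut_Hopf B = \<lparr>carrier = {F. hopf_iso B B F}, monoid.mult = (\<circ>), one = id\<rparr>"

definition units_group :: "'k::field monoid" where
  "units_group = \<lparr>carrier = UNIV - {0}, monoid.mult = (*), one = 1\<rparr>"

subsection \<open>Tensor products and crossed products of Hopf algebras\<close>

definition tensor_cmul ::
    "('k::field, 'a::finite) bialg \<Rightarrow> ('k, 'h::finite) bialg
      \<Rightarrow> 'k ^ ('a \<times> 'h) \<Rightarrow> 'k ^ (('a \<times> 'h) \<times> ('a \<times> 'h))" where
  "tensor_cmul A H =
     tlift (\<lambda>a h. sw2 A (\<lambda>a1 a2. sw2 H (\<lambda>h1 h2. (a1 \<otimes>\<^sub>k h1) \<otimes>\<^sub>k (a2 \<otimes>\<^sub>k h2)) h) a)"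

definition tensor_cunt ::
    "('k::field, 'a::finite) bialg \<Rightarrow> ('k, 'h::finite) bialg \<Rightarrow> 'k ^ ('a \<times> 'h) \<Rightarrow> 'k" where
  "tensor_cunt A H T = (\<Sum>(i, j)\<in>UNIV. T $ (i, j) * (cunt A (axis i 1) * cunt H (axis j 1)))"

definition tensor_bialg ::
    "('k::field, 'a::finite) bialg \<Rightarrow> ('k, 'h::finite) bialg \<Rightarrow> ('k, 'a \<times> 'h) bialg" where
  "tensor_bialg A H =
     \<lparr>mul = tensor_mul A H, unt = unt A \<otimes>\<^sub>k unt H,
      cmul = tensor_cmul A H, cunt = tensor_cunt A H\<rparr>"

definition weak_action ::
    "('k::field, 'a::finite) bialg \<Rightarrow> ('k, 'h::finite) bialg
      \<Rightarrow> ('k ^ 'h \<Rightarrow> 'k ^ 'a \<Rightarrow> 'k ^ 'a) \<Rightarrow> bool" where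
  "weak_action A H t \<longleftrightarrow> kbilinear t \<and>
     (\<forall>h. t h (unt A) = cunt H h *s unt A) \<and>
     (\<forall>a. t (unt H) a = a) \<and>
     (\<forall>h a b. t h (a \<cdot>\<^bsub>A\<^esub> b) = sw2 H (\<lambda>h1 h2. t h1 a \<cdot>\<^bsub>A\<^esub> t h2 b) h)"

definition crossed_mul ::
    "('k::field, 'a::finite) bialg \<Rightarrow> ('k, 'h::finite) bialg
      \<Rightarrow> ('k ^ 'h \<Rightarrow> 'k ^ 'a \<Rightarrow> 'k ^ 'a) \<Rightarrow> ('k ^ 'h \<Rightarrow> 'k ^ 'h \<Rightarrow> 'k ^ 'a)
      \<Rightarrow> 'k ^ ('a \<times> 'h) \<Rightarrow> 'k ^ ('a \<times> 'h) \<Rightarrow> 'k ^ ('a \<times> 'h)" where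
  "crossed_mul A H t f S T =
     tlift (\<lambda>a h. tlift (\<lambda>c g.
       sw3 H (\<lambda>h1 h2 h3. sw2 H (\<lambda>g1 g2.
         (a \<cdot>\<^bsub>A\<^esub> t h1 c \<cdot>\<^bsub>A\<^esub> f h2 g1) \<otimes>\<^sub>k (h3 \<cdot>\<^bsub>H\<^esub> g2)) g) h) T) S"

definition crossed_product ::
    "('k::field, 'a::finite) bialg \<Rightarrow> ('k, 'h::finite) bialg
      \<Rightarrow> ('k ^ 'h \<Rightarrow> 'k ^ 'a \<Rightarrow> 'k ^ 'a) \<Rightarrow> ('k ^ 'h \<Rightarrow> 'k ^ 'h \<Rightarrow> 'k ^ 'a)
      \<Rightarrow> ('k, 'a \<times> 'h) bialg" where
  "crossed_product A H t f =
     \<lparr>mul = crossed_mul A H t f, unt = unt A \<otimes>\<^sub>k unt H,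
      cmul = tensor_cmul A H, cunt = tensor_cunt A H\<rparr>"

definition CS ::
    "('k::field, 'a::finite) bialg \<Rightarrow> ('k, 'h::finite) bialg
      \<Rightarrow> (('k ^ 'h \<Rightarrow> 'k ^ 'a \<Rightarrow> 'k ^ 'a) \<times> ('k ^ 'h \<Rightarrow> 'k ^ 'h \<Rightarrow> 'k ^ 'a)) set" where
  "CS A H = {(t, f). weak_action A H t \<and> kbilinear f \<and> hopf_algebra (crossed_product A H t f)}"

definition unitary_cocentral ::
    "('k::field, 'h::finite) bialg \<Rightarrow> ('k, 'a::finite) bialg \<Rightarrow> ('k ^ 'h \<Rightarrow> 'k ^ 'a) \<Rightarrow> bool" where
  "unitary_cocentral H A r \<longleftrightarrow> coalgebra_map H A r \<and> r (unt H) = unt A \<and>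
     (\<forall>h. sw2 H (\<lambda>h1 h2. r h1 \<otimes>\<^sub>k h2) h = sw2 H (\<lambda>h1 h2. r h2 \<otimes>\<^sub>k h1) h)"

definition CS_rel ::
    "('k::field, 'a::finite) bialg \<Rightarrow> ('k, 'h::finite) bialg
      \<Rightarrow> (('k ^ 'h \<Rightarrow> 'k ^ 'a \<Rightarrow> 'k ^ 'a) \<times> ('k ^ 'h \<Rightarrow> 'k ^ 'h \<Rightarrow> 'k ^ 'a)) rel" where
  "CS_rel A H = {((t, f), (t', f')). (t, f) \<in> CS A H \<and> (t', f') \<in> CS A H \<and>
     (\<exists>r. unitary_cocentral H A r \<and>
       (\<forall>h a. t' h a =
          sw3 H (\<lambda>h1 h2 h3. r h1 \<cdot>\<^bsub>A\<^esub> t h2 a \<cdot>\<^bsub>A\<^esub> antipode A (r h3)) h) \<and>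
       (\<forall>h g. f' h g =
          sw4 H (\<lambda>h1 h2 h3 h4. sw3 H (\<lambda>g1 g2 g3.
            r h1 \<cdot>\<^bsub>A\<^esub> t h2 (r g1) \<cdot>\<^bsub>A\<^esub> f h3 g2 \<cdot>\<^bsub>A\<^esub> antipode A (r (h4 \<cdot>\<^bsub>H\<^esub> g3))) g) h))}"

definition H2 ::
    "('k::field, 'h::finite) bialg \<Rightarrow> ('k, 'a::finite) bialg
      \<Rightarrow> (('k ^ 'h \<Rightarrow> 'k ^ 'a \<Rightarrow> 'k ^ 'a) \<times> ('k ^ 'h \<Rightarrow> 'k ^ 'h \<Rightarrow> 'k ^ 'a)) set set" where
  "H2 H A = CS A H // CS_rel A H"

subsection \<open>Presentations of algebras by generators and relations\<close>

text \<open>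
  The free algebra on the elements of \<open>'x\<close>: finitely supported linear combinations of words.
\<close>

definition word :: "'x list \<Rightarrow> 'x list \<Rightarrow>\<^sub>0 'k::field" where
  "word w = Poly_Mapping.single w 1"

definition free_algebra :: "('x list \<Rightarrow>\<^sub>0 'k::field) ring" where
  "free_algebra = \<lparr>carrier = UNIV,
     monoid.mult = (\<lambda>P Q. \<Sum>u\<in>Poly_Mapping.keys P. \<Sum>v\<in>Poly_Mapping.keys Q.
       Poly_Mapping.single (u @ v) (Poly_Mapping.lookup P u * Poly_Mapping.lookup Q v)),
     one = word [], zero = 0, add = (+)\<rparr>"

definition eval_free ::
    "('k::field, 'i::finite) bialg \<Rightarrow> ('x \<Rightarrow> 'k ^ 'i) \<Rightarrow> ('x list \<Rightarrow>\<^sub>0 'k) \<Rightarrow> 'k ^ 'i" where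
  "eval_free B \<rho> P = (\<Sum>w\<in>Poly_Mapping.keys P.
     Poly_Mapping.lookup P w *s foldr (\<lambda>x b. \<rho> x \<cdot>\<^bsub>B\<^esub> b) w (unt B))"

text \<open>
  \<open>B\<close> is presented, as an algebra, by the generators \<open>\<rho> x\<close> and the relations \<open>P = 0\<close> for \<open>P \<in> R\<close>:
  evaluation induces an isomorphism from the free algebra modulo the two-sided ideal generated
  by \<open>R\<close> onto \<open>B\<close>.
\<close>

definition presented_by ::
    "('k::field, 'i::finite) bialg \<Rightarrow> ('x \<Rightarrow> 'k ^ 'i) \<Rightarrow> ('x list \<Rightarrow>\<^sub>0 'k) set \<Rightarrow> bool" where
  "presented_by B \<rho> R \<longleftrightarrow>
     surj (eval_free B \<rho>) \<and> {P. eval_free B \<rho> P = 0} = genideal free_algebra R"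

subsection \<open>The Hopf algebras in question\<close>

definition is_truncated_poly :: "nat \<Rightarrow> ('k::field, 'a::finite) bialg \<Rightarrow> bool" where
  "is_truncated_poly p A \<longleftrightarrow> hopf_algebra A \<and>
     vec.dim (UNIV :: ('k ^ 'a) set) = p \<and>
     (\<exists>y. presented_by A (\<lambda>_::unit. y) {word (replicate p ())} \<and> primitive A y)"

definition is_Sweedler :: "('k::field, 'h::finite) bialg \<Rightarrow> bool" where
  "is_Sweedler H \<longleftrightarrow> hopf_algebra H \<and>
     (\<exists>g x. distinct [unt H, g, x, g \<cdot>\<^bsub>H\<^esub> x] \<and>
        vec.independent {unt H, g, x, g \<cdot>\<^bsub>H\<^esub> x} \<and>
        vec.span {unt H, g, x, g \<cdot>\<^bsub>H\<^esub> x} = UNIV \<and>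
        g \<cdot>\<^bsub>H\<^esub> g = unt H \<and> x \<cdot>\<^bsub>H\<^esub> x = 0 \<and> x \<cdot>\<^bsub>H\<^esub> g = - (g \<cdot>\<^bsub>H\<^esub> x) \<and>
        grouplike H g \<and> skew_primitive H g x)"

datatype gen = Gg | Gx

definition is_A4p :: "nat \<Rightarrow> ('k::field, 'b::finite) bialg \<Rightarrow> bool" where
  "is_A4p p B \<longleftrightarrow> hopf_algebra B \<and>
     vec.dim (UNIV :: ('k ^ 'b) set) = 4 * p \<and>
     (\<exists>g x. presented_by B (case_gen g x)
          {word (replicate (2 * p) Gx), word [Gg, Gg] - word [], word [Gx, Gg] + word [Gg, Gx]} \<and>
        grouplike B g \<and> skew_primitive B g x)"

end

theory Submission
  imports Defs
begin

text \<open>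
  Let \<open>G = 1 # g\<close>, \<open>X = 1 # x\<close> and \<open>Y = y # 1\<close> in a crossed product \<open>A # H\<^sub>4\<close>. The coalgebra
  structure is the tensor product one, so contracting \<open>\<Delta>(uv) = \<Delta>(u)\<Delta>(v)\<close> with the counits of the two
  outer factors yields \<open>h\<^sub>1 \<otimes> (h\<^sub>2 \<triangleright> a) = h\<^sub>2 \<otimes> (h\<^sub>1 \<triangleright> a)\<close> and
  \<open>h\<^sub>1k\<^sub>1 \<otimes> f(h\<^sub>2, k\<^sub>2) = h\<^sub>2k\<^sub>2 \<otimes> f(h\<^sub>1, k\<^sub>1)\<close>. Since \<open>H\<^sub>4\<close> is not cocommutative, these conditions are
  strong: they force the action to be trivial and, \<open>f\<close> being normalized, determine \<open>f\<close> on all pairs of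
  basis elements that involve \<open>1\<close> or \<open>g\<close>. What remains is \<open>X\<^sup>2 = f(x, x) # 1\<close>. The element
  \<open>f(x, x)\<close> is primitive, hence equal to \<open>ay\<close> with \<open>a \<in> k\<close>, because a primitive element of \<open>A\<close> has constant derivative and the degrees in
  \<open>A\<close> stay below the characteristic. Associativity then determines \<open>f\<close> (\<open>crossed_system_classification\<close>).
  Conversely, every \<open>a \<in> k\<close> does occur: the resulting algebra \<open>B a\<close>, with \<open>X\<^sup>2 = aY\<close>, is a Hopf
  algebra (\<open>B_hopf\<close>). So the crossed systems correspond to the points of \<open>k\<close>.

  An isomorphism from \<open>B a\<close> to \<open>B a'\<close> fixes \<open>G\<close>, the only group-like element besides \<open>1\<close>, and multiplies
  \<open>Y\<close>, which spans the primitive elements, by some \<open>\<beta>\<close>. It multiplies \<open>X\<close> by some \<open>\<alpha>\<close>, since the relation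
  \<open>XG = -GX\<close> excludes all other skew primitive elements. Then \<open>X\<^sup>2 = aY\<close> becomes
  \<open>\<beta>a = a'\<alpha>\<^sup>2\<close>, and every pair of nonzero scalars with this property does define an isomorphism
  (\<open>rescale_hopf_iso\<close>, \<open>hopf_iso_classification\<close>). Hence \<open>B a\<close> is isomorphic to \<open>B 1\<close> for all \<open>a \<noteq> 0\<close>, but
  \<open>B 0\<close> is not. The automorphisms of \<open>B 0 = A \<otimes> H\<^sub>4\<close> are given by all pairs \<open>(\<beta>, \<alpha>)\<close> of nonzero scalars,
  those of \<open>B 1\<close> by the pairs \<open>(\<alpha>\<^sup>2, \<alpha>)\<close>.

  In \<open>B 1\<close> one has \<open>Y = X\<^sup>2\<close>, so the words \<open>g\<^sup>ix\<^sup>j\<close> with \<open>i < 2\<close> and \<open>j < 2p\<close>, to which every word reduces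
  modulo the relations of \<open>A\<^sub>4\<^sub>p\<close>, form a basis of \<open>B 1\<close>. Thus \<open>B 1\<close> has the presentation of \<open>A\<^sub>4\<^sub>p\<close>
  (\<open>B_1_A4p\<close>), and any two Hopf algebras with that presentation are isomorphic (\<open>A4p_isomorphic\<close>).

  Finally, the only unitary cocentral map from \<open>H\<^sub>4\<close> to \<open>A\<close> is the trivial one
  (\<open>unitary_cocentral_trivial\<close>). Equivalent crossed systems are therefore equal, and the cohomology
  set is in bijection with the set of parameters \<open>a\<close>.
\<close>

section \<open>Linear maps and tensor products\<close>

lemma klinear_iff:
  "klinear F \<longleftrightarrow> (\<forall>u v. F (u + v) = F u + F v) \<and> (\<forall>c v. F (c *s v) = c *s F v)"
  by (simp add: Vector_Spaces.linear_iff vec.vector_space_axioms)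

lemma kfunctional_iff:
  "kfunctional F \<longleftrightarrow> (\<forall>u v. F (u + v) = F u + F v) \<and> (\<forall>c v. F (c *s v) = c * F v)"
  by (simp add: Vector_Spaces.linear_iff vec.vector_space_axioms
      vector_space_over_itself.vector_space_axioms)

text \<open>
  A Sweedler sum \<open>sw2 B \<phi> b\<close> can be evaluated on a sum of pure tensors only if \<open>\<phi>\<close> is bilinear, and an
  identity may be checked on pure tensors or on a basis only if both sides are linear. The rules in
  \<open>lin\<close> discharge these side conditions by recursion over the term.
\<close>

named_theorems lin

lemma klinear_id [lin]: "klinear (\<lambda>x. x)"
  and klinear_zero [lin]: "klinear (\<lambda>x. 0)"
  and klinear_add [lin]: "klinear F \<Longrightarrow> klinear G \<Longrightarrow> klinear (\<lambda>x. F x + G x)"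
  and klinear_diff [lin]: "klinear F \<Longrightarrow> klinear G \<Longrightarrow> klinear (\<lambda>x. F x - G x)"
  and klinear_minus [lin]: "klinear F \<Longrightarrow> klinear (\<lambda>x. - F x)"
  and klinear_scale [lin]: "klinear F \<Longrightarrow> klinear (\<lambda>x. c *s F x)"
  and klinear_functional_scale [lin]: "kfunctional s \<Longrightarrow> klinear (\<lambda>x. s x *s v)"
  and kfunctional_zero [lin]: "kfunctional (\<lambda>x. 0)"
  and kfunctional_add [lin]: "kfunctional s \<Longrightarrow> kfunctional t \<Longrightarrow> kfunctional (\<lambda>x. s x + t x)"
  and kfunctional_diff [lin]: "kfunctional s \<Longrightarrow> kfunctional t \<Longrightarrow> kfunctional (\<lambda>x. s x - t x)"
  and kfunctional_scale_left [lin]: "kfunctional s \<Longrightarrow> kfunctional (\<lambda>x. c * s x)"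
  and kfunctional_scale_right [lin]: "kfunctional s \<Longrightarrow> kfunctional (\<lambda>x. s x * c)"
  by (auto simp: klinear_iff kfunctional_iff algebra_simps vec.scale_right_distrib vec.scale_left_distrib
      vec.scale_right_diff_distrib mult.commute)

lemma klinear_sum [lin]: "(\<And>i. i \<in> I \<Longrightarrow> klinear (F i)) \<Longrightarrow> klinear (\<lambda>x. \<Sum>i\<in>I. F i x)"
  by (auto simp: klinear_iff sum.distrib vec.scale_sum_right)

lemma kfunctional_minus [lin]: "kfunctional s \<Longrightarrow> kfunctional (\<lambda>x. - s x)"
  by (auto simp: kfunctional_iff algebra_simps)

lemma kfunctional_sum [lin]:
  "(\<And>i. i \<in> I \<Longrightarrow> kfunctional (s i)) \<Longrightarrow> kfunctional (\<lambda>x. \<Sum>i\<in>I. s i x)"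
  by (auto simp: kfunctional_iff sum.distrib sum_distrib_left)

lemma kfunctional_component [lin]: "klinear F \<Longrightarrow> kfunctional (\<lambda>x. F x $ i)"
  by (simp add: klinear_iff kfunctional_iff)

lemma klinear_compose: "klinear F \<Longrightarrow> klinear G \<Longrightarrow> klinear (\<lambda>x. F (G x))"
  by (auto simp: klinear_iff)

lemma kfunctional_compose: "kfunctional s \<Longrightarrow> klinear G \<Longrightarrow> kfunctional (\<lambda>x. s (G x))"
  by (auto simp: klinear_iff kfunctional_iff)

lemma klinear_0: "klinear F \<Longrightarrow> F 0 = 0"
  and klinear_plus: "klinear F \<Longrightarrow> F (u + v) = F u + F v"
  and klinear_smult: "klinear F \<Longrightarrow> F (c *s u) = c *s F u"
  and klinear_uminus: "klinear F \<Longrightarrow> F (- u) = - F u"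
  and klinear_minus2: "klinear F \<Longrightarrow> F (u - v) = F u - F v"
proof -
  show *: "F (u + v) = F u + F v" "F (c *s u) = c *s F u" if "klinear F" for u v c
    using that by (auto simp: klinear_iff)
  show "F 0 = 0" if "klinear F" using *(2)[OF that, of 0 0] by simp
  show **: "F (- u) = - F u" if "klinear F" for u
    using *(2)[OF that, of "-1" u] by simp
  show "F (u - v) = F u - F v" if "klinear F"
    using *(1)[OF that, of u "- v"] **[OF that, of v] by simp
qed

lemma klinear_sum_apply: "klinear F \<Longrightarrow> F (\<Sum>i\<in>I. v i) = (\<Sum>i\<in>I. F (v i))"
  by (induction I rule: infinite_finite_induct) (auto simp: klinear_0 klinear_plus)

lemma kfunctional_0: "kfunctional s \<Longrightarrow> s 0 = 0"
  and kfunctional_plus: "kfunctional s \<Longrightarrow> s (u + v) = s u + s v"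
  and kfunctional_smult: "kfunctional s \<Longrightarrow> s (c *s u) = c * s u"
  and kfunctional_uminus: "kfunctional s \<Longrightarrow> s (- u) = - s u"
  and kfunctional_minus2: "kfunctional s \<Longrightarrow> s (u - v) = s u - s v"
proof -
  show *: "s (u + v) = s u + s v" "s (c *s u) = c * s u" if "kfunctional s" for u v c
    using that by (auto simp: kfunctional_iff)
  show "s 0 = 0" if "kfunctional s" using *(2)[OF that, of 0 0] by simp
  show **: "s (- u) = - s u" if "kfunctional s" for u
    using *(2)[OF that, of "-1" u] by simp
  show "s (u - v) = s u - s v" if "kfunctional s"
    using *(1)[OF that, of u "- v"] **[OF that, of v] by simp
qed

lemma kfunctional_sum_apply: "kfunctional s \<Longrightarrow> s (\<Sum>i\<in>I. v i) = (\<Sum>i\<in>I. s (v i))"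
  by (induction I rule: infinite_finite_induct) (auto simp: kfunctional_0 kfunctional_plus)

lemma kbilinearI [lin]:
  "(\<And>v. klinear (\<phi> v)) \<Longrightarrow> (\<And>w. klinear (\<lambda>v. \<phi> v w)) \<Longrightarrow> kbilinear \<phi>"
  by (simp add: kbilinear_def)

lemma kbilinear_left: "kbilinear \<phi> \<Longrightarrow> klinear F \<Longrightarrow> klinear (\<lambda>x. \<phi> (F x) w)"
  by (auto simp: kbilinear_def klinear_iff)

lemma kbilinear_right: "kbilinear \<phi> \<Longrightarrow> klinear F \<Longrightarrow> klinear (\<lambda>x. \<phi> v (F x))"
  by (auto simp: kbilinear_def klinear_iff)

lemma tens_add_left: "(u + v) \<otimes>\<^sub>k w = u \<otimes>\<^sub>k w + v \<otimes>\<^sub>k w"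
  and tens_add_right: "w \<otimes>\<^sub>k (u + v) = w \<otimes>\<^sub>k u + w \<otimes>\<^sub>k v"
  and tens_diff_left: "(u - v) \<otimes>\<^sub>k w = u \<otimes>\<^sub>k w - v \<otimes>\<^sub>k w"
  and tens_diff_right: "w \<otimes>\<^sub>k (u - v) = w \<otimes>\<^sub>k u - w \<otimes>\<^sub>k v"
  and tens_uminus_left: "(- u) \<otimes>\<^sub>k w = - (u \<otimes>\<^sub>k w)"
  and tens_uminus_right: "w \<otimes>\<^sub>k (- u) = - (w \<otimes>\<^sub>k u)"
  and tens_scale_left: "(c *s u) \<otimes>\<^sub>k w = c *s (u \<otimes>\<^sub>k w)"
  and tens_scale_right: "w \<otimes>\<^sub>k (c *s u) = c *s (w \<otimes>\<^sub>k u)"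
  and tens_0_left: "0 \<otimes>\<^sub>k w = 0"
  and tens_0_right: "w \<otimes>\<^sub>k 0 = 0"
  by (auto simp: tens_def vec_eq_iff algebra_simps)

lemmas tens_simps = tens_add_left tens_add_right tens_diff_left tens_diff_right tens_uminus_left
  tens_uminus_right tens_scale_left tens_scale_right tens_0_left tens_0_right

lemma klinear_tens_left [lin]: "klinear F \<Longrightarrow> klinear (\<lambda>x. F x \<otimes>\<^sub>k w)"
  and klinear_tens_right [lin]: "klinear F \<Longrightarrow> klinear (\<lambda>x. v \<otimes>\<^sub>k F x)"
  by (auto simp: klinear_iff tens_simps)

lemma tens_sum_left: "(\<Sum>i\<in>I. v i) \<otimes>\<^sub>k w = (\<Sum>i\<in>I. v i \<otimes>\<^sub>k w)"
  by (rule klinear_sum_apply) (intro lin)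

lemma tlift_linear [lin]: "klinear F \<Longrightarrow> klinear (\<lambda>x. tlift \<phi> (F x))"
  by (simp add: klinear_iff tlift_def case_prod_unfold sum.distrib vec.scale_left_distrib
      vec.scale_sum_right)

lemma tlift_linear_param [lin]:
  "(\<And>v w. klinear (\<lambda>x. \<phi> x v w)) \<Longrightarrow> klinear (\<lambda>x. tlift (\<phi> x) T)"
  unfolding tlift_def case_prod_unfold by (intro lin) auto

lemma vec_axis_sum: "(v :: 'k::field ^ 'i::finite) = (\<Sum>i\<in>UNIV. v $ i *s axis i 1)"
  by (simp add: basis_expansion)

text \<open>
  The defining property of the map out of a tensor product: \<open>tlift\<close> is defined on the standard basis,
  and bilinearity transports the formula to all pure tensors.
\<close>

lemma tlift_tens:
  fixes v :: "'k::field ^ 'i::finite" and w :: "'k ^ 'j::finite"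
  assumes "kbilinear \<phi>"
  shows "tlift \<phi> (v \<otimes>\<^sub>k w) = \<phi> v w"
proof -
  have l: "klinear (\<lambda>v. \<phi> v w)" for w using assms by (simp add: kbilinear_def)
  have r: "klinear (\<phi> v)" for v using assms by (simp add: kbilinear_def)
  have "\<phi> v w = \<phi> (\<Sum>i\<in>UNIV. v $ i *s axis i 1) (\<Sum>j\<in>UNIV. w $ j *s axis j 1)"
    by (simp add: basis_expansion)
  also have "\<dots> = (\<Sum>i\<in>UNIV. \<Sum>j\<in>UNIV. (v $ i * w $ j) *s \<phi> (axis i 1) (axis j 1))"
    by (simp add: klinear_sum_apply[OF l] klinear_sum_apply[OF r] klinear_smult[OF l]
        klinear_smult[OF r] vec.scale_sum_right mult.commute) (rule sum.swap)
  also have "\<dots> = tlift \<phi> (v \<otimes>\<^sub>k w)"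
    by (simp add: tlift_def tens_def sum.cartesian_product)
  finally show ?thesis by simp
qed

lemma tensor_expansion:
  fixes T :: "'k::field ^ ('i::finite \<times> 'j::finite)"
  shows "T = tlift (\<otimes>\<^sub>k) T"
proof -
  have "(axis i 1 :: 'k ^ 'i) \<otimes>\<^sub>k (axis j 1 :: 'k ^ 'j) = axis (i, j) 1" for i j
    by (auto simp: tens_def axis_def vec_eq_iff)
  then show ?thesis
    using vec_axis_sum[of T] by (simp add: tlift_def case_prod_unfold)
qed

lemma klinear_tlift_commute:
  assumes "klinear F" shows "F (tlift \<phi> T) = tlift (\<lambda>v w. F (\<phi> v w)) T"
  using assms by (simp add: tlift_def klinear_sum_apply klinear_smult case_prod_unfold)

text \<open>The standard basis of a tensor product consists of pure tensors.\<close>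

lemma tensor_ext:
  fixes T :: "'k::field ^ ('i::finite \<times> 'j::finite)"
  assumes "klinear F" "klinear G" "\<And>v w. F (v \<otimes>\<^sub>k w) = G (v \<otimes>\<^sub>k w)"
  shows "F T = G T"
proof -
  have "F T = F (tlift (\<otimes>\<^sub>k) T)" using tensor_expansion[of T] by simp
  also have "\<dots> = G (tlift (\<otimes>\<^sub>k) T)"
    by (simp add: klinear_tlift_commute[OF assms(1)] klinear_tlift_commute[OF assms(2)] assms(3))
  finally show ?thesis using tensor_expansion[of T] by simp
qed

lemma tlift_eqI:
  assumes "kbilinear \<phi>" "klinear F" "\<And>v w. F (v \<otimes>\<^sub>k w) = \<phi> v w"
  shows "tlift \<phi> T = F T"
  by (rule tensor_ext) (use assms in \<open>auto intro!: lin simp: tlift_tens\<close>)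

lemma tlift_swap: "tlift (\<lambda>a b. tlift (\<lambda>c d. \<phi> a b c d) T) S = tlift (\<lambda>c d. tlift (\<lambda>a b. \<phi> a b c d) S) T"
  unfolding tlift_def case_prod_unfold
  by (simp add: vec.scale_sum_right mult.commute, subst sum.swap, rule refl)

lemma tlift_sum_fun: "tlift (\<lambda>a b. \<phi> a b + \<psi> a b) T = tlift \<phi> T + tlift \<psi> T"
  and tlift_scale_fun: "tlift (\<lambda>a b. c *s \<phi> a b) T = c *s tlift \<phi> T"
  by (auto simp: tlift_def case_prod_unfold sum.distrib vec.scale_right_distrib vec.scale_sum_right
      mult.commute)

lemma treassoc_tens: "treassoc ((u \<otimes>\<^sub>k v) \<otimes>\<^sub>k w) = u \<otimes>\<^sub>k (v \<otimes>\<^sub>k w)"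
  by (auto simp: treassoc_def tens_def vec_eq_iff)

lemma klinear_treassoc [lin]: "klinear F \<Longrightarrow> klinear (\<lambda>x. treassoc (F x))"
  by (auto simp: klinear_iff treassoc_def vec_eq_iff)

section \<open>Sweedler sums\<close>

lemma sw2_linear_param [lin]:
  "(\<And>v w. klinear (\<lambda>x. \<phi> x v w)) \<Longrightarrow> klinear (\<lambda>x. sw2 B (\<phi> x) b)"
  unfolding sw2_def by (intro lin)

lemma klinear_sw2_commute: "klinear F \<Longrightarrow> F (sw2 B \<phi> b) = sw2 B (\<lambda>v w. F (\<phi> v w)) b"
  by (simp add: sw2_def klinear_tlift_commute)

lemma sw2_swap:
  "sw2 B (\<lambda>a b. sw2 C (\<lambda>c d. \<phi> a b c d) y) x = sw2 C (\<lambda>c d. sw2 B (\<lambda>a b. \<phi> a b c d) x) y"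
  unfolding sw2_def by (rule tlift_swap)

lemma sw2_add_fun: "sw2 B (\<lambda>v w. \<phi> v w + \<psi> v w) b = sw2 B \<phi> b + sw2 B \<psi> b"
  and sw2_scale_fun: "sw2 B (\<lambda>v w. c *s \<phi> v w) b = c *s sw2 B \<phi> b"
  by (simp_all add: sw2_def tlift_sum_fun tlift_scale_fun)

lemma tlift_sw2: "tlift \<phi> (sw2 B \<psi> b) = sw2 B (\<lambda>v w. tlift \<phi> (\<psi> v w)) b"
  by (rule klinear_sw2_commute) (intro lin)

lemma coalgebra_lin:
  assumes "coalgebra_axioms B"
  shows coalg_cmul: "klinear F \<Longrightarrow> klinear (\<lambda>x. cmul B (F x))"
    and coalg_cunt: "klinear F \<Longrightarrow> kfunctional (\<lambda>x. cunt B (F x))"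
    and coalg_sw2: "klinear F \<Longrightarrow> klinear (\<lambda>x. sw2 B \<phi> (F x))"
  using assms klinear_compose[of "cmul B" F] kfunctional_compose[of "cunt B" F]
  by (auto simp: coalgebra_axioms_def sw2_def intro!: lin)

lemma algebra_lin:
  assumes "algebra_axioms B"
  shows alg_mul_left: "klinear F \<Longrightarrow> klinear (\<lambda>x. F x \<cdot>\<^bsub>B\<^esub> b)"
    and alg_mul_right: "klinear F \<Longrightarrow> klinear (\<lambda>x. b \<cdot>\<^bsub>B\<^esub> F x)"
  using assms kbilinear_left[of "mul B" F] kbilinear_right[of "mul B" F]
  by (auto simp: algebra_axioms_def)

lemma coalgebra_counit:
  assumes "coalgebra_axioms B" 
  shows counit_left: "klinear \<phi> \<Longrightarrow> sw2 B (\<lambda>b1 b2. cunt B b1 *s \<phi> b2) b = \<phi> b"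
    and counit_right: "klinear \<phi> \<Longrightarrow> sw2 B (\<lambda>b1 b2. cunt B b2 *s \<phi> b1) b = \<phi> b"
  using assms klinear_sw2_commute[of \<phi> B "\<lambda>b1 b2. cunt B b1 *s b2" b]
    klinear_sw2_commute[of \<phi> B "\<lambda>b1 b2. cunt B b2 *s b1" b]
  by (auto simp: coalgebra_axioms_def klinear_smult)

text \<open>
  Coassociativity in the form in which Sweedler notation uses it: a trilinear map may be applied to
  either bracketing of the iterated comultiplication.
\<close>

lemma coalgebra_coassoc:
  fixes B :: "('k::field, 'i::finite) bialg" and \<phi> :: "'k ^ 'i \<Rightarrow> 'k ^ 'i \<Rightarrow> 'k ^ 'i \<Rightarrow> 'k ^ 'm::finite"
  assumes B: "coalgebra_axioms B"
    and \<phi>: "\<And>v w. klinear (\<lambda>u. \<phi> u v w)" "\<And>u w. klinear (\<lambda>v. \<phi> u v w)" "\<And>u v. klinear (\<lambda>w. \<phi> u v w)"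
  shows "sw2 B (\<lambda>b1 b2. sw2 B (\<lambda>b11 b12. \<phi> b11 b12 b2) b1) b
       = sw2 B (\<lambda>b1 b2. sw2 B (\<lambda>b21 b22. \<phi> b1 b21 b22) b2) b"
proof -
  define \<Phi> where "\<Phi> T = tlift (\<lambda>u P. tlift (\<lambda>v w. \<phi> u v w) P) T" for T
  have lin\<Phi>: "klinear \<Phi>" unfolding \<Phi>_def[abs_def] by (intro lin)
  have bi: "kbilinear (\<lambda>u P. tlift (\<lambda>v w. \<phi> u v w) P)" by (intro lin \<phi>)
  have \<Phi>t: "\<Phi> (u \<otimes>\<^sub>k P) = tlift (\<lambda>v w. \<phi> u v w) P" for u P
    unfolding \<Phi>_def using bi by (simp add: tlift_tens)
  have \<Phi>r: "\<Phi> (treassoc (P \<otimes>\<^sub>k w)) = tlift (\<lambda>u v. \<phi> u v w) P" for P w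
    by (rule sym, rule tlift_eqI) (auto intro!: lin \<phi> klinear_compose[OF lin\<Phi>]
        simp: treassoc_tens \<Phi>t tlift_tens kbilinearI \<phi>)
  have "treassoc (sw2 B (\<lambda>b1 b2. cmul B b1 \<otimes>\<^sub>k b2) b) = sw2 B (\<lambda>b1 b2. b1 \<otimes>\<^sub>k cmul B b2) b"
    using B by (auto simp: coalgebra_axioms_def)
  then have "\<Phi> (treassoc (sw2 B (\<lambda>b1 b2. cmul B b1 \<otimes>\<^sub>k b2) b)) = \<Phi> (sw2 B (\<lambda>b1 b2. b1 \<otimes>\<^sub>k cmul B b2) b)"
    by simp
  then show ?thesis
    by (simp add: klinear_sw2_commute[OF lin\<Phi>] klinear_sw2_commute[OF klinear_treassoc[OF klinear_id]]
        \<Phi>t \<Phi>r sw2_def[symmetric])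
qed

section \<open>Tensor products of algebras and of coalgebras\<close>

lemma functional_tlift_commute:
  assumes "kfunctional s"
  shows "s (tlift \<phi> T) = (\<Sum>(i, j)\<in>UNIV. T $ (i, j) * s (\<phi> (axis i 1) (axis j 1)))"
  using assms by (simp add: tlift_def kfunctional_sum_apply kfunctional_smult case_prod_unfold)

lemma tensor_ext_functional:
  fixes T :: "'k::field ^ ('i::finite \<times> 'j::finite)"
  assumes "kfunctional s" "kfunctional t" "\<And>v w. s (v \<otimes>\<^sub>k w) = t (v \<otimes>\<^sub>k w)"
  shows "s T = t T"
proof -
  have "s T = s (tlift (\<otimes>\<^sub>k) T)" using tensor_expansion[of T] by simp
  also have "\<dots> = t (tlift (\<otimes>\<^sub>k) T)"
    by (simp add: functional_tlift_commute[OF assms(1)] functional_tlift_commute[OF assms(2)] assms(3))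
  finally show ?thesis using tensor_expansion[of T] by simp
qed

lemma tensor_ext2:
  fixes S :: "'k::field ^ ('i::finite \<times> 'j::finite)" and T :: "'k ^ ('l::finite \<times> 'm::finite)"
  assumes "\<And>S. klinear (F S)" "\<And>T. klinear (\<lambda>S. F S T)" "\<And>S. klinear (G S)" "\<And>T. klinear (\<lambda>S. G S T)"
    and "\<And>a h c k. F (a \<otimes>\<^sub>k h) (c \<otimes>\<^sub>k k) = G (a \<otimes>\<^sub>k h) (c \<otimes>\<^sub>k k)"
  shows "F S T = G S T"
proof -
  have "F (a \<otimes>\<^sub>k h) T = G (a \<otimes>\<^sub>k h) T" for a h
    by (rule tensor_ext[OF assms(1,3)]) (rule assms(5))
  then show ?thesis by (rule tensor_ext[OF assms(2,4)])
qed

lemma tensor_mul_linear [lin]: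
  "klinear F \<Longrightarrow> klinear (\<lambda>x. tensor_mul B C (F x) T)"
  "klinear F \<Longrightarrow> klinear (\<lambda>x. tensor_mul B C S (F x))"
  unfolding tensor_mul_def by (intro lin; assumption)+

lemma tensor_mul_tens:
  assumes "algebra_axioms B" "algebra_axioms C"
  shows "tensor_mul B C (b \<otimes>\<^sub>k c) (b' \<otimes>\<^sub>k c') = (b \<cdot>\<^bsub>B\<^esub> b') \<otimes>\<^sub>k (c \<cdot>\<^bsub>C\<^esub> c')"
proof -
  note [lin] = alg_mul_left[OF assms(1)] alg_mul_left[OF assms(2)]
    alg_mul_right[OF assms(1)] alg_mul_right[OF assms(2)]
  show ?thesis unfolding tensor_mul_def by (simp add: tlift_tens lin)
qed

lemma tensor_cunt_functional [lin]: "klinear F \<Longrightarrow> kfunctional (\<lambda>x. tensor_cunt A H (F x))"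
  unfolding tensor_cunt_def case_prod_unfold by (intro lin)

lemma tensor_cunt_tens:
  assumes "coalgebra_axioms A" "coalgebra_axioms H"
  shows "tensor_cunt A H (a \<otimes>\<^sub>k h) = cunt A a * cunt H h"
proof -
  have f: "kfunctional (cunt A)" "kfunctional (cunt H)"
    using assms by (auto simp: coalgebra_axioms_def)
  have "cunt A a = (\<Sum>i\<in>UNIV. a $ i * cunt A (axis i 1))"
    by (subst vec_axis_sum) (simp add: kfunctional_sum_apply[OF f(1)] kfunctional_smult[OF f(1)])
  moreover have "cunt H h = (\<Sum>i\<in>UNIV. h $ i * cunt H (axis i 1))"
    by (subst vec_axis_sum) (simp add: kfunctional_sum_apply[OF f(2)] kfunctional_smult[OF f(2)])
  ultimately show ?thesis
    by (simp add: tensor_cunt_def tens_def sum_product sum.cartesian_product case_prod_unfold mult_ac)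
qed

lemma tensor_cmul_linear [lin]: "klinear F \<Longrightarrow> klinear (\<lambda>x. tensor_cmul A H (F x))"
  unfolding tensor_cmul_def by (intro lin)

lemma tensor_cmul_tens:
  assumes "coalgebra_axioms A" "coalgebra_axioms H"
  shows "tensor_cmul A H (a \<otimes>\<^sub>k h)
       = sw2 A (\<lambda>a1 a2. sw2 H (\<lambda>h1 h2. (a1 \<otimes>\<^sub>k h1) \<otimes>\<^sub>k (a2 \<otimes>\<^sub>k h2)) h) a"
  unfolding tensor_cmul_def
  by (rule tlift_tens) (intro lin coalg_sw2[OF assms(1)] coalg_sw2[OF assms(2)])

lemma sw2_tensor:
  assumes "coalgebra_axioms A" "coalgebra_axioms H" "cmul B = tensor_cmul A H"
    and \<phi>: "\<And>w. klinear (\<lambda>v. \<phi> v w)" "\<And>v. klinear (\<phi> v)"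
  shows "sw2 B \<phi> (a \<otimes>\<^sub>k h) = sw2 A (\<lambda>a1 a2. sw2 H (\<lambda>h1 h2. \<phi> (a1 \<otimes>\<^sub>k h1) (a2 \<otimes>\<^sub>k h2)) h) a"
proof -
  have "kbilinear \<phi>" by (intro lin \<phi>)
  then show ?thesis
    by (simp add: sw2_def[of B] assms(3) tensor_cmul_tens[OF assms(1,2)] tlift_sw2 tlift_tens)
qed

text \<open>
  Coassociativity and counit laws hold factor by factor, once the Sweedler sums over \<open>A\<close> and those
  over \<open>H\<close> have been interchanged.
\<close>

lemma tensor_coalgebra:
  fixes A :: "('k::field, 'a::finite) bialg" and H :: "('k, 'h::finite) bialg"
    and B :: "('k, 'a \<times> 'h) bialg"
  assumes A: "coalgebra_axioms A" and H: "coalgebra_axioms H"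
    and B: "cmul B = tensor_cmul A H" "cunt B = tensor_cunt A H"
  shows "coalgebra_axioms B"
proof -
  note [lin] = coalg_sw2[OF A] coalg_sw2[OF H] coalg_cunt[OF A] coalg_cunt[OF H]
    coalg_cmul[OF A] coalg_cmul[OF H]
  have sB: "sw2 B \<phi> (a \<otimes>\<^sub>k h) = sw2 A (\<lambda>a1 a2. sw2 H (\<lambda>h1 h2. \<phi> (a1 \<otimes>\<^sub>k h1) (a2 \<otimes>\<^sub>k h2)) h) a"
    if "\<And>w. klinear (\<lambda>v. \<phi> v w)" "\<And>v. klinear (\<phi> v)"
    for \<phi> :: "'k ^ ('a \<times> 'h) \<Rightarrow> 'k ^ ('a \<times> 'h) \<Rightarrow> 'k ^ 'm::finite" and a h
    by (rule sw2_tensor[OF A H B(1)]) (rule that)+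
  have [lin]: "klinear F \<Longrightarrow> klinear (\<lambda>x. sw2 B \<phi> (F x))" for \<phi> and F :: "'k ^ 'n::finite \<Rightarrow> _"
    unfolding sw2_def B by (intro lin)
  have lc: "klinear (cmul B)" "kfunctional (cunt B)" unfolding B by (intro lin)+
  have coassoc: "treassoc (sw2 B (\<lambda>b1 b2. cmul B b1 \<otimes>\<^sub>k b2) b) = sw2 B (\<lambda>b1 b2. b1 \<otimes>\<^sub>k cmul B b2) b" for b
  proof (rule tensor_ext[of "\<lambda>b. treassoc (sw2 B (\<lambda>b1 b2. cmul B b1 \<otimes>\<^sub>k b2) b)"])
    fix a h
    let ?\<phi> = "\<lambda>a1 a2 a3 h1 h2 h3. (a1 \<otimes>\<^sub>k h1) \<otimes>\<^sub>k ((a2 \<otimes>\<^sub>k h2) \<otimes>\<^sub>k (a3 \<otimes>\<^sub>k h3))"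
    have "treassoc (sw2 B (\<lambda>b1 b2. cmul B b1 \<otimes>\<^sub>k b2) (a \<otimes>\<^sub>k h))
      = sw2 A (\<lambda>a1 a2. sw2 H (\<lambda>h1 h2. sw2 A (\<lambda>a11 a12. sw2 H (\<lambda>h11 h12. ?\<phi> a11 a12 a2 h11 h12 h2) h1) a1) h) a"
      by (simp add: sB lin B tensor_cmul_tens[OF A H] klinear_sw2_commute[of treassoc]
          klinear_sw2_commute[of "\<lambda>u. u \<otimes>\<^sub>k v" for v] treassoc_tens)
    also have "\<dots> = sw2 A (\<lambda>a1 a2. sw2 A (\<lambda>a11 a12. sw2 H (\<lambda>h1 h2. sw2 H (\<lambda>h11 h12. ?\<phi> a11 a12 a2 h11 h12 h2) h1) h) a1) a"
      by (subst sw2_swap) simp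
    also have "\<dots> = sw2 A (\<lambda>a1 a2. sw2 A (\<lambda>a11 a12. sw2 H (\<lambda>h1 h2. sw2 H (\<lambda>h21 h22. ?\<phi> a11 a12 a2 h1 h21 h22) h2) h) a1) a"
      by (subst coalgebra_coassoc[OF H]) (simp_all add: lin)
    also have "\<dots> = sw2 A (\<lambda>a1 a2. sw2 A (\<lambda>a21 a22. sw2 H (\<lambda>h1 h2. sw2 H (\<lambda>h21 h22. ?\<phi> a1 a21 a22 h1 h21 h22) h2) h) a2) a"
      by (subst coalgebra_coassoc[OF A]) (simp_all add: lin)
    also have "\<dots> = sw2 A (\<lambda>a1 a2. sw2 H (\<lambda>h1 h2. sw2 A (\<lambda>a21 a22. sw2 H (\<lambda>h21 h22. ?\<phi> a1 a21 a22 h1 h21 h22) h2) a2) h) a"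
      by (subst sw2_swap) simp
    also have "\<dots> = sw2 B (\<lambda>b1 b2. b1 \<otimes>\<^sub>k cmul B b2) (a \<otimes>\<^sub>k h)"
      by (simp add: sB lin B tensor_cmul_tens[OF A H]
          klinear_sw2_commute[of "\<lambda>u. v \<otimes>\<^sub>k u" for v])
    finally show "treassoc (sw2 B (\<lambda>b1 b2. cmul B b1 \<otimes>\<^sub>k b2) (a \<otimes>\<^sub>k h)) = \<dots>" .
  qed (unfold B, (intro lin)+)
  have counit: "sw2 B (\<lambda>b1 b2. cunt B b1 *s b2) b = b" "sw2 B (\<lambda>b1 b2. cunt B b2 *s b1) b = b" for b
  proof -
    show "sw2 B (\<lambda>b1 b2. cunt B b1 *s b2) b = b"
    proof (rule tensor_ext[of "sw2 B (\<lambda>b1 b2. cunt B b1 *s b2)" "\<lambda>b. b"])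
      fix a h
      show "sw2 B (\<lambda>b1 b2. cunt B b1 *s b2) (a \<otimes>\<^sub>k h) = a \<otimes>\<^sub>k h"
        by (simp add: sB lin B tensor_cunt_tens[OF A H] vec.scale_scale[symmetric]
            sw2_scale_fun counit_left[OF H] counit_left[OF A] del: vec.scale_scale)
    qed (intro lin)+
    show "sw2 B (\<lambda>b1 b2. cunt B b2 *s b1) b = b"
    proof (rule tensor_ext[of "sw2 B (\<lambda>b1 b2. cunt B b2 *s b1)" "\<lambda>b. b"])
      fix a h
      show "sw2 B (\<lambda>b1 b2. cunt B b2 *s b1) (a \<otimes>\<^sub>k h) = a \<otimes>\<^sub>k h"
        by (simp add: sB lin B tensor_cunt_tens[OF A H] vec.scale_scale[symmetric]
            sw2_scale_fun counit_right[OF H] counit_right[OF A] del: vec.scale_scale)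
    qed (intro lin)+
  qed
  show ?thesis
    unfolding coalgebra_axioms_def using lc coassoc counit by blast
qed

text \<open>The convolution inverse of the identity is unique: \<open>S = S * id * S' = S'\<close>.\<close>

lemma antipode_unique:
  fixes B :: "('k::field, 'i::finite) bialg"
  assumes B: "algebra_axioms B" "coalgebra_axioms B" and S: "is_antipode B S" "is_antipode B S'"
  shows "S = S'"
proof
  fix b
  note [lin] = coalg_sw2[OF B(2)] coalg_cunt[OF B(2)] alg_mul_left[OF B(1)] alg_mul_right[OF B(1)]
  have l: "klinear S" "klinear S'" using S by (auto simp: is_antipode_def)
  note [lin] = klinear_compose[OF l(1)] klinear_compose[OF l(2)]
  have a: "sw2 B (\<lambda>b1 b2. S b1 \<cdot>\<^bsub>B\<^esub> b2) b = cunt B b *s unt B"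
    "sw2 B (\<lambda>b1 b2. b1 \<cdot>\<^bsub>B\<^esub> S' b2) b = cunt B b *s unt B" for b
    using S by (auto simp: is_antipode_def)
  have u: "unt B \<cdot>\<^bsub>B\<^esub> c = c" "c \<cdot>\<^bsub>B\<^esub> unt B = c" "(c \<cdot>\<^bsub>B\<^esub> d) \<cdot>\<^bsub>B\<^esub> e = c \<cdot>\<^bsub>B\<^esub> (d \<cdot>\<^bsub>B\<^esub> e)" for c d e
    using B(1) by (auto simp: algebra_axioms_def)
  have m: "(r *s c) \<cdot>\<^bsub>B\<^esub> d = r *s (c \<cdot>\<^bsub>B\<^esub> d)" "d \<cdot>\<^bsub>B\<^esub> (r *s c) = r *s (d \<cdot>\<^bsub>B\<^esub> c)" for r c d
    using klinear_smult[of "\<lambda>c. c \<cdot>\<^bsub>B\<^esub> d"] klinear_smult[of "mul B d"] by (auto simp: lin)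
  have "S b = sw2 B (\<lambda>b1 b2. cunt B b2 *s S b1) b"
    by (simp add: counit_right[OF B(2)] l)
  also have "\<dots> = sw2 B (\<lambda>b1 b2. S b1 \<cdot>\<^bsub>B\<^esub> sw2 B (\<lambda>c d. c \<cdot>\<^bsub>B\<^esub> S' d) b2) b"
    by (simp add: a m u)
  also have "\<dots> = sw2 B (\<lambda>b1 b2. sw2 B (\<lambda>c d. S b1 \<cdot>\<^bsub>B\<^esub> (c \<cdot>\<^bsub>B\<^esub> S' d)) b2) b"
    by (simp add: klinear_sw2_commute[of "mul B v" for v] lin)
  also have "\<dots> = sw2 B (\<lambda>b1 b2. sw2 B (\<lambda>c d. S c \<cdot>\<^bsub>B\<^esub> (d \<cdot>\<^bsub>B\<^esub> S' b2)) b1) b"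
    by (rule coalgebra_coassoc[OF B(2), symmetric]) (intro lin)+
  also have "\<dots> = sw2 B (\<lambda>b1 b2. sw2 B (\<lambda>c d. S c \<cdot>\<^bsub>B\<^esub> d) b1 \<cdot>\<^bsub>B\<^esub> S' b2) b"
    by (simp add: klinear_sw2_commute[of "\<lambda>w. w \<cdot>\<^bsub>B\<^esub> v" for v] lin u)
  also have "\<dots> = S' b"
    by (simp add: a m u counit_left[OF B(2)] l)
  finally show "S b = S' b" .
qed

lemma algebra_mul_simps:
  assumes "algebra_axioms B"
  shows "(b + c) \<cdot>\<^bsub>B\<^esub> d = b \<cdot>\<^bsub>B\<^esub> d + c \<cdot>\<^bsub>B\<^esub> d" "d \<cdot>\<^bsub>B\<^esub> (b + c) = d \<cdot>\<^bsub>B\<^esub> b + d \<cdot>\<^bsub>B\<^esub> c"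
    "(b - c) \<cdot>\<^bsub>B\<^esub> d = b \<cdot>\<^bsub>B\<^esub> d - c \<cdot>\<^bsub>B\<^esub> d" "d \<cdot>\<^bsub>B\<^esub> (b - c) = d \<cdot>\<^bsub>B\<^esub> b - d \<cdot>\<^bsub>B\<^esub> c"
    "(- b) \<cdot>\<^bsub>B\<^esub> d = - (b \<cdot>\<^bsub>B\<^esub> d)" "d \<cdot>\<^bsub>B\<^esub> (- b) = - (d \<cdot>\<^bsub>B\<^esub> b)"
    "(r *s b) \<cdot>\<^bsub>B\<^esub> d = r *s (b \<cdot>\<^bsub>B\<^esub> d)" "d \<cdot>\<^bsub>B\<^esub> (r *s b) = r *s (d \<cdot>\<^bsub>B\<^esub> b)"
    "0 \<cdot>\<^bsub>B\<^esub> d = 0" "d \<cdot>\<^bsub>B\<^esub> 0 = 0"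
    "unt B \<cdot>\<^bsub>B\<^esub> b = b" "b \<cdot>\<^bsub>B\<^esub> unt B = b"
proof -
  have l: "klinear (\<lambda>b. b \<cdot>\<^bsub>B\<^esub> d)" "klinear (mul B d)" for d
    using assms by (auto simp: algebra_axioms_def kbilinear_def)
  note r = klinear_plus klinear_minus2 klinear_uminus klinear_smult klinear_0
  show "(b + c) \<cdot>\<^bsub>B\<^esub> d = b \<cdot>\<^bsub>B\<^esub> d + c \<cdot>\<^bsub>B\<^esub> d" "d \<cdot>\<^bsub>B\<^esub> (b + c) = d \<cdot>\<^bsub>B\<^esub> b + d \<cdot>\<^bsub>B\<^esub> c"
    "(b - c) \<cdot>\<^bsub>B\<^esub> d = b \<cdot>\<^bsub>B\<^esub> d - c \<cdot>\<^bsub>B\<^esub> d" "d \<cdot>\<^bsub>B\<^esub> (b - c) = d \<cdot>\<^bsub>B\<^esub> b - d \<cdot>\<^bsub>B\<^esub> c"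
    "(- b) \<cdot>\<^bsub>B\<^esub> d = - (b \<cdot>\<^bsub>B\<^esub> d)" "d \<cdot>\<^bsub>B\<^esub> (- b) = - (d \<cdot>\<^bsub>B\<^esub> b)"
    "(r *s b) \<cdot>\<^bsub>B\<^esub> d = r *s (b \<cdot>\<^bsub>B\<^esub> d)" "d \<cdot>\<^bsub>B\<^esub> (r *s b) = r *s (d \<cdot>\<^bsub>B\<^esub> b)"
    "0 \<cdot>\<^bsub>B\<^esub> d = 0" "d \<cdot>\<^bsub>B\<^esub> 0 = 0"
    using r[OF l(1)] r[OF l(2)] by auto
  show "unt B \<cdot>\<^bsub>B\<^esub> b = b" "b \<cdot>\<^bsub>B\<^esub> unt B = b"
    using assms by (auto simp: algebra_axioms_def)
qed

lemma cmul_simps: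
  assumes "coalgebra_axioms B"
  shows "cmul B (b + c) = cmul B b + cmul B c" "cmul B (b - c) = cmul B b - cmul B c"
    "cmul B (- b) = - cmul B b" "cmul B (r *s b) = r *s cmul B b" "cmul B 0 = 0"
    "cunt B (b + c) = cunt B b + cunt B c" "cunt B (b - c) = cunt B b - cunt B c"
    "cunt B (- b) = - cunt B b" "cunt B (r *s b) = r * cunt B b" "cunt B 0 = 0"
proof -
  have l: "klinear (cmul B)" "kfunctional (cunt B)"
    using assms by (auto simp: coalgebra_axioms_def)
  show "cmul B (b + c) = cmul B b + cmul B c" "cmul B (b - c) = cmul B b - cmul B c"
    "cmul B (- b) = - cmul B b" "cmul B (r *s b) = r *s cmul B b" "cmul B 0 = 0"
    "cunt B (b + c) = cunt B b + cunt B c" "cunt B (b - c) = cunt B b - cunt B c"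
    "cunt B (- b) = - cunt B b" "cunt B (r *s b) = r * cunt B b" "cunt B 0 = 0"
    by (rule klinear_plus klinear_minus2 klinear_uminus klinear_smult klinear_0 
        kfunctional_plus kfunctional_minus2 kfunctional_uminus kfunctional_smult kfunctional_0; rule l)+
qed

lemma tensor_mul_simps:
  "tensor_mul B C (S + S') T = tensor_mul B C S T + tensor_mul B C S' T"
  "tensor_mul B C S (T + T') = tensor_mul B C S T + tensor_mul B C S T'"
  "tensor_mul B C (- S) T = - tensor_mul B C S T"
  "tensor_mul B C S (- T) = - tensor_mul B C S T"
  "tensor_mul B C (c *s S) T = c *s tensor_mul B C S T"
  "tensor_mul B C S (c *s T) = c *s tensor_mul B C S T"
  "tensor_mul B C 0 T = 0" "tensor_mul B C S 0 = 0"
  using tensor_mul_linear(1)[OF klinear_id, of B C T] tensor_mul_linear(2)[OF klinear_id, of B C S]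
  by (simp_all add: klinear_plus klinear_uminus klinear_smult klinear_0
      klinear_plus[of "\<lambda>S. tensor_mul B C S T"] klinear_uminus[of "\<lambda>S. tensor_mul B C S T"]
      klinear_smult[of "\<lambda>S. tensor_mul B C S T"] klinear_0[of "\<lambda>S. tensor_mul B C S T"])

lemma skew_primitive_mul_grouplike:
  assumes "bialgebra B" "grouplike B g" "skew_primitive B g x" "g \<cdot>\<^bsub>B\<^esub> g = unt B"
  shows "cmul B (g \<cdot>\<^bsub>B\<^esub> x) = (g \<cdot>\<^bsub>B\<^esub> x) \<otimes>\<^sub>k g + unt B \<otimes>\<^sub>k (g \<cdot>\<^bsub>B\<^esub> x)"
proof -
  have "algebra_axioms B" using assms by (auto simp: bialgebra_def)
  then show ?thesis using assms
    by (auto simp: bialgebra_def grouplike_def skew_primitive_def tensor_mul_simps tensor_mul_tens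
        algebra_mul_simps)
qed

section \<open>Truncated polynomials and the Sweedler algebra\<close>

text \<open>
  The algebra \<open>A = k[y]/(y\<^sup>p)\<close> and Sweedler's algebra \<open>H\<close> enter through their coordinate functionals:
  \<open>cy n b\<close> is the coefficient of \<open>ypow n = y\<^sup>n\<close> in \<open>b\<close>, and \<open>c1\<close>, \<open>cg\<close>, \<open>cx\<close>, \<open>cw\<close> belong to the basis
  \<open>1\<close>, \<open>g\<close>, \<open>x\<close>, \<open>w = gx\<close>. Dual bases turn most statements about \<open>H\<close> into polynomial identities in
  coordinates or into a check on four basis elements.
\<close>

locale truncated_sweedler =
  fixes A :: "('k::field, 'a::finite) bialg" and H :: "('k, 'h::finite) bialg"
    and p :: nat and y :: "'k ^ 'a" and g x w :: "'k ^ 'h"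
    and ypow :: "nat \<Rightarrow> 'k ^ 'a" and cy :: "nat \<Rightarrow> 'k ^ 'a \<Rightarrow> 'k"
    and c1 cg cx cw :: "'k ^ 'h \<Rightarrow> 'k"
  assumes A: "hopf_algebra A" and H: "hopf_algebra H"
    and char_p: "CHAR('k) = p" and p3: "p \<ge> 3"
    and primitive_y: "primitive A y"
    and ypow_0: "ypow 0 = unt A" and ypow_Suc: "\<And>n. ypow (Suc n) = y \<cdot>\<^bsub>A\<^esub> ypow n"
    and ypow_p: "ypow p = 0"
    and cy_functional: "\<And>n. kfunctional (cy n)"
    and cy_ypow: "\<And>m n. n < p \<Longrightarrow> cy m (ypow n) = (if m = n then 1 else 0)"
    and y_expansion: "\<And>b. b = (\<Sum>n<p. cy n b *s ypow n)"
    and g_sq: "g \<cdot>\<^bsub>H\<^esub> g = unt H" and x_sq: "x \<cdot>\<^bsub>H\<^esub> x = 0" and gx: "g \<cdot>\<^bsub>H\<^esub> x = w" and xg: "x \<cdot>\<^bsub>H\<^esub> g = - w"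
    and grouplike_g: "grouplike H g" and skew_primitive_x: "skew_primitive H g x"
    and coord_functional: "kfunctional c1" "kfunctional cg" "kfunctional cx" "kfunctional cw"
    and coord_val [simp]: "c1 (unt H) = 1" "cg (unt H) = 0" "cx (unt H) = 0" "cw (unt H) = 0"
      "c1 g = 0" "cg g = 1" "cx g = 0" "cw g = 0"
      "c1 x = 0" "cg x = 0" "cx x = 1" "cw x = 0"
      "c1 w = 0" "cg w = 0" "cx w = 0" "cw w = 1"
    and h_expansion: "\<And>h. h = c1 h *s unt H + cg h *s g + cx h *s x + cw h *s w"
begin

abbreviation "\<epsilon> \<equiv> cunt H"
abbreviation unit_A ("\<one>\<^sub>A") where "\<one>\<^sub>A \<equiv> unt A"
abbreviation unit_H ("\<one>\<^sub>H") where "\<one>\<^sub>H \<equiv> unt H"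
abbreviation mul_A (infixl "\<cdot>\<^sub>A" 80) where "b \<cdot>\<^sub>A c \<equiv> mul A b c"
abbreviation mul_H (infixl "\<cdot>\<^sub>H" 80) where "h \<cdot>\<^sub>H k \<equiv> mul H h k"

lemma algA: "algebra_axioms A" and algH: "algebra_axioms H"
  and coalgA: "coalgebra_axioms A" and coalgH: "coalgebra_axioms H"
  and bialgA: "bialgebra A" and bialgH: "bialgebra H"
  using A H by (auto simp: hopf_algebra_def bialgebra_def)

lemmas [lin] = alg_mul_left[OF algA] alg_mul_left[OF algH] alg_mul_right[OF algA] alg_mul_right[OF algH]
  coalg_cmul[OF coalgA] coalg_cmul[OF coalgH] coalg_cunt[OF coalgA] coalg_cunt[OF coalgH]
  coalg_sw2[OF coalgA] coalg_sw2[OF coalgH]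
  coord_functional[THEN kfunctional_compose] cy_functional[THEN kfunctional_compose]

lemmas [simp] = algebra_mul_simps[OF algA]
lemmas [simp] = algebra_mul_simps[OF algH]
lemmas [simp] = cmul_simps[OF coalgA]
lemmas [simp] = cmul_simps[OF coalgH]
lemmas [simp] = tens_simps

lemma coord_simps [simp]:
  "c1 (h + k) = c1 h + c1 k" "c1 (h - k) = c1 h - c1 k" "c1 (- h) = - c1 h" "c1 (r *s h) = r * c1 h" "c1 0 = 0"
  "cg (h + k) = cg h + cg k" "cg (h - k) = cg h - cg k" "cg (- h) = - cg h" "cg (r *s h) = r * cg h" "cg 0 = 0"
  "cx (h + k) = cx h + cx k" "cx (h - k) = cx h - cx k" "cx (- h) = - cx h" "cx (r *s h) = r * cx h" "cx 0 = 0"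
  "cw (h + k) = cw h + cw k" "cw (h - k) = cw h - cw k" "cw (- h) = - cw h" "cw (r *s h) = r * cw h" "cw 0 = 0"
  by (simp_all add: coord_functional kfunctional_plus kfunctional_minus2 kfunctional_uminus
      kfunctional_smult kfunctional_0)

lemma assocA: "b \<cdot>\<^sub>A c \<cdot>\<^sub>A d = b \<cdot>\<^sub>A (c \<cdot>\<^sub>A d)" and assocH: "h \<cdot>\<^sub>H k \<cdot>\<^sub>H l = h \<cdot>\<^sub>H (k \<cdot>\<^sub>H l)"
  using algA algH by (auto simp: algebra_axioms_def)

lemma mulH_table [simp]:
  "g \<cdot>\<^sub>H g = \<one>\<^sub>H" "g \<cdot>\<^sub>H x = w" "g \<cdot>\<^sub>H w = x" "x \<cdot>\<^sub>H g = - w" "x \<cdot>\<^sub>H x = 0" "x \<cdot>\<^sub>H w = 0"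
  "w \<cdot>\<^sub>H g = - x" "w \<cdot>\<^sub>H x = 0" "w \<cdot>\<^sub>H w = 0"
proof -
  show gg: "g \<cdot>\<^sub>H g = \<one>\<^sub>H" "g \<cdot>\<^sub>H x = w" "x \<cdot>\<^sub>H g = - w" "x \<cdot>\<^sub>H x = 0"
    using g_sq gx xg x_sq by auto
  show gw: "g \<cdot>\<^sub>H w = x" using assocH[of g g x] gg by simp
  show wx: "w \<cdot>\<^sub>H x = 0" using assocH[of g x x] gg by simp
  show wg: "w \<cdot>\<^sub>H g = - x" using assocH[of g x g] gg gw by simp
  show xw: "x \<cdot>\<^sub>H w = 0" using assocH[of x g x] gg wx by simp
  show "w \<cdot>\<^sub>H w = 0" using assocH[of g x w] gg xw by simp
qed

lemma cmulH_table:
  "cmul H \<one>\<^sub>H = \<one>\<^sub>H \<otimes>\<^sub>k \<one>\<^sub>H" "cmul H g = g \<otimes>\<^sub>k g" "cmul H x = x \<otimes>\<^sub>k \<one>\<^sub>H + g \<otimes>\<^sub>k x"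
  "cmul H w = w \<otimes>\<^sub>k g + \<one>\<^sub>H \<otimes>\<^sub>k w"
  using bialgH grouplike_g skew_primitive_x
    skew_primitive_mul_grouplike[OF bialgH grouplike_g skew_primitive_x g_sq]
  by (auto simp: bialgebra_def grouplike_def skew_primitive_def)

lemma sw2H:
  assumes "\<And>w. klinear (\<lambda>v. \<phi> v w)" "\<And>v. klinear (\<phi> v)"
  shows "sw2 H \<phi> \<one>\<^sub>H = \<phi> \<one>\<^sub>H \<one>\<^sub>H" "sw2 H \<phi> g = \<phi> g g" "sw2 H \<phi> x = \<phi> x \<one>\<^sub>H + \<phi> g x"
    "sw2 H \<phi> w = \<phi> w g + \<phi> \<one>\<^sub>H w"
  using assms by (auto simp: sw2_def cmulH_table tlift_tens kbilinearI
      klinear_plus[OF tlift_linear[OF klinear_id]])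

lemma counitH [simp]: "\<epsilon> \<one>\<^sub>H = 1" "\<epsilon> g = 1" "\<epsilon> x = 0" "\<epsilon> w = 0"
proof -
  show 1: "\<epsilon> \<one>\<^sub>H = 1" using bialgH by (simp add: bialgebra_def)
  have c: "sw2 H (\<lambda>h1 h2. \<epsilon> h1 *s h2) h = h" for h
    by (rule counit_left[OF coalgH]) (intro lin)
  have "\<epsilon> g *s g = g" using c[of g] by (simp add: sw2H lin)
  then have "cg (\<epsilon> g *s g) = cg g" by simp
  then show g: "\<epsilon> g = 1" by simp
  have "\<epsilon> x *s \<one>\<^sub>H + \<epsilon> g *s x = x" using c[of x] by (simp add: sw2H lin)
  then have "c1 (\<epsilon> x *s \<one>\<^sub>H + \<epsilon> g *s x) = c1 x" by simp
  then show x: "\<epsilon> x = 0" by simp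
  have "\<epsilon> (g \<cdot>\<^sub>H x) = \<epsilon> g * \<epsilon> x" using bialgH unfolding bialgebra_def by blast
  then show "\<epsilon> w = 0" using x by simp
qed

lemma H_ext:
  assumes "klinear F" "klinear G" "F \<one>\<^sub>H = G \<one>\<^sub>H" "F g = G g" "F x = G x" "F w = G w"
  shows "F h = G h"
  by (subst (1 2) h_expansion) (simp add: klinear_plus assms klinear_smult)

lemma H_ext_functional:
  assumes "kfunctional F" "kfunctional G" "F \<one>\<^sub>H = G \<one>\<^sub>H" "F g = G g" "F x = G x" "F w = G w"
  shows "F h = G h"
  by (subst (1 2) h_expansion) (simp add: kfunctional_plus assms kfunctional_smult)

lemma H_ext2:
  assumes "\<And>h. klinear (F h)" "\<And>k. klinear (\<lambda>h. F h k)" "\<And>h. klinear (G h)" "\<And>k. klinear (\<lambda>h. G h k)"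
    and "\<And>h k. h \<in> {\<one>\<^sub>H, g, x, w} \<Longrightarrow> k \<in> {\<one>\<^sub>H, g, x, w} \<Longrightarrow> F h k = G h k"
  shows "F h k = G h k"
proof -
  have *: "F h k = G h k" if "h \<in> {\<one>\<^sub>H, g, x, w}" for h
    by (rule H_ext[OF assms(1,3)]) (rule assms(5)[OF that], simp)+
  show ?thesis by (rule H_ext[of "\<lambda>h. F h k" "\<lambda>h. G h k", OF assms(2,4)]) (rule *, simp)+
qed

lemma A_ext:
  assumes "klinear F" "klinear G" "\<And>n. F (ypow n) = G (ypow n)"
  shows "F b = G b"
  by (subst (1 2) y_expansion) (simp add: klinear_sum_apply assms klinear_smult)

lemma ypow_add: "ypow m \<cdot>\<^sub>A ypow n = ypow (m + n)"
  by (induction m) (simp_all add: ypow_0 ypow_Suc assocA)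

lemma ypow_1: "ypow 1 = y" using ypow_Suc[of 0] by (simp add: ypow_0)

lemma ypow_ge: "n \<ge> p \<Longrightarrow> ypow n = 0"
  using ypow_add[of "n - p" p] by (simp add: ypow_p)

lemma commA: "b \<cdot>\<^sub>A c = c \<cdot>\<^sub>A b"
proof -
  have *: "ypow m \<cdot>\<^sub>A c = c \<cdot>\<^sub>A ypow m" for m c
    by (rule A_ext[of "\<lambda>c. ypow m \<cdot>\<^sub>A c" "\<lambda>c. c \<cdot>\<^sub>A ypow m"])
      (intro lin, intro lin, simp add: ypow_add add.commute)
  show ?thesis
    by (rule A_ext[of "\<lambda>b. b \<cdot>\<^sub>A c" "\<lambda>b. c \<cdot>\<^sub>A b"]) (intro lin, intro lin, rule *)
qed

lemma left_commA: "b \<cdot>\<^sub>A (c \<cdot>\<^sub>A d) = c \<cdot>\<^sub>A (b \<cdot>\<^sub>A d)"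
  using assocA commA by metis

lemma cmul_y: "cmul A y = y \<otimes>\<^sub>k \<one>\<^sub>A + \<one>\<^sub>A \<otimes>\<^sub>k y"
  using primitive_y by (simp add: primitive_def)

lemma cmulA_unit [simp]: "cmul A \<one>\<^sub>A = \<one>\<^sub>A \<otimes>\<^sub>k \<one>\<^sub>A"
  and cuntA_unit [simp]: "cunt A \<one>\<^sub>A = 1"
  and cuntA_mul [simp]: "cunt A (b \<cdot>\<^sub>A c) = cunt A b * cunt A c"
  and cmulA_mul: "cmul A (b \<cdot>\<^sub>A c) = tensor_mul A A (cmul A b) (cmul A c)"
  and cuntH_mul [simp]: "\<epsilon> (h \<cdot>\<^sub>H k) = \<epsilon> h * \<epsilon> k"
  and cmulH_mul: "cmul H (h \<cdot>\<^sub>H k) = tensor_mul H H (cmul H h) (cmul H k)"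
  using bialgA bialgH by (auto simp: bialgebra_def)

lemma unitA_nonzero: "\<one>\<^sub>A \<noteq> 0"
  using cy_ypow[of 0 0] p3 kfunctional_0[OF cy_functional] by (auto simp: ypow_0)

lemma counit_y [simp]: "cunt A y = 0"
proof -
  have "sw2 A (\<lambda>b1 b2. cunt A b1 *s b2) y = y"
    by (rule counit_left[OF coalgA]) (intro lin)
  then have "cunt A y *s \<one>\<^sub>A = 0"
    by (simp add: sw2_def cmul_y klinear_plus[OF tlift_linear[OF klinear_id]] tlift_tens lin)
  then show ?thesis using unitA_nonzero by simp
qed

section \<open>The crossed products\<close>

text \<open>
  Up to the scalar \<open>a\<close>, this is the coefficient of \<open>y\<close> in the cocycle: it is \<open>1\<close> at \<open>(x, x)\<close> and
  \<open>(gx, x)\<close>, \<open>-1\<close> at \<open>(x, gx)\<close> and \<open>(gx, gx)\<close>, and \<open>0\<close> at the other pairs of basis elements.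
\<close>

definition sig :: "'k ^ 'h \<Rightarrow> 'k ^ 'h \<Rightarrow> 'k" where
  "sig h k = (cx h + cw h) * (cx k - cw k)"

text \<open>
  Write a product in \<open>k\<langle>g, x | g\<^sup>2 = 1, xg = -gx\<rangle>\<close>, which is free over \<open>k[x\<^sup>2]\<close> with basis
  \<open>1, g, x, gx\<close>, as \<open>hk + x\<^sup>2 (h \<diamondop> k)\<close>, where \<open>hk\<close> is the product in \<open>H\<close>.
\<close>

definition circ :: "'k ^ 'h \<Rightarrow> 'k ^ 'h \<Rightarrow> 'k ^ 'h" (infixl "\<diamondop>" 80) where
  "h \<diamondop> k = (cx h * cx k - cw h * cw k) *s \<one>\<^sub>H + (cw h * cx k - cx h * cw k) *s g"

definition act :: "'k ^ 'h \<Rightarrow> 'k ^ 'a \<Rightarrow> 'k ^ 'a" where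
  "act h b = \<epsilon> h *s b"

definition cocycle :: "'k \<Rightarrow> 'k ^ 'h \<Rightarrow> 'k ^ 'h \<Rightarrow> 'k ^ 'a" where
  "cocycle a h k = (\<epsilon> h * \<epsilon> k) *s \<one>\<^sub>A + (a * sig h k) *s y"

text \<open>
  The crossed product in which \<open>X\<^sup>2 = aY\<close>.
\<close>

definition B :: "'k \<Rightarrow> ('k, 'a \<times> 'h) bialg" where
  "B a = crossed_product A H act (cocycle a)"

lemma B_sel: "mul (B a) = crossed_mul A H act (cocycle a)" "unt (B a) = \<one>\<^sub>A \<otimes>\<^sub>k \<one>\<^sub>H"
  "cmul (B a) = tensor_cmul A H" "cunt (B a) = tensor_cunt A H"
  by (simp_all add: B_def crossed_product_def)

lemma circ_linear [lin]: "klinear F \<Longrightarrow> klinear (\<lambda>v. F v \<diamondop> k)" "klinear F \<Longrightarrow> klinear (\<lambda>v. h \<diamondop> F v)"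
  unfolding circ_def by (intro lin; assumption)+

lemma sig_linear [lin]: "klinear F \<Longrightarrow> kfunctional (\<lambda>v. sig (F v) k)" "klinear F \<Longrightarrow> kfunctional (\<lambda>v. sig h (F v))"
  unfolding sig_def by (intro lin; assumption)+

lemma act_linear [lin]: "klinear F \<Longrightarrow> klinear (\<lambda>v. act (F v) b)" "klinear G \<Longrightarrow> klinear (\<lambda>v. act h (G v))"
  unfolding act_def by (intro lin; assumption)+

lemma cocycle_linear [lin]: "klinear F \<Longrightarrow> klinear (\<lambda>v. cocycle a (F v) k)"
  "klinear F \<Longrightarrow> klinear (\<lambda>v. cocycle a h (F v))"
  unfolding cocycle_def by (intro lin; assumption)+

lemma crossed_mul_linear [lin]:
  "klinear F \<Longrightarrow> klinear (\<lambda>v. crossed_mul A H t f (F v) T)"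
  "klinear F \<Longrightarrow> klinear (\<lambda>v. crossed_mul A H t f S (F v))"
  unfolding crossed_mul_def by (intro lin; assumption)+

lemma crossed_mul_tens:
  assumes "kbilinear t" "kbilinear f"
  shows "crossed_mul A H t f (b \<otimes>\<^sub>k h) (c \<otimes>\<^sub>k k) =
    sw2 H (\<lambda>h1 r. sw2 H (\<lambda>h2 h3. sw2 H (\<lambda>k1 k2.
         (b \<cdot>\<^sub>A t h1 c \<cdot>\<^sub>A f h2 k1) \<otimes>\<^sub>k (h3 \<cdot>\<^sub>H k2)) k) r) h"
proof -
  note [lin] = kbilinear_left[OF assms(1)] kbilinear_right[OF assms(1)]
    kbilinear_left[OF assms(2)] kbilinear_right[OF assms(2)]
  show ?thesis
    unfolding crossed_mul_def sw3_def by (simp add: tlift_tens lin)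
qed

lemma bilinear_act: "kbilinear act" and bilinear_cocycle: "kbilinear (cocycle a)"
  by (intro lin)+

text \<open>
  The product of \<open>B a\<close> is the tensor product one plus a correction of first order in \<open>a\<close>. Associativity
  and comultiplicativity follow by comparing the coefficients of the powers of \<open>a\<close>.
\<close>

lemma mulB: "(b \<otimes>\<^sub>k h) \<cdot>\<^bsub>B a\<^esub> (c \<otimes>\<^sub>k k) = (b \<cdot>\<^sub>A c) \<otimes>\<^sub>k (h \<cdot>\<^sub>H k) + a *s ((b \<cdot>\<^sub>A c \<cdot>\<^sub>A y) \<otimes>\<^sub>k (h \<diamondop> k))"
  unfolding B_sel crossed_mul_tens[OF bilinear_act bilinear_cocycle]
  by (rule H_ext2[of "\<lambda>h k. sw2 H (\<lambda>h1 r. sw2 H (\<lambda>h2 h3. sw2 H (\<lambda>k1 k2.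
         (b \<cdot>\<^sub>A act h1 c \<cdot>\<^sub>A cocycle a h2 k1) \<otimes>\<^sub>k (h3 \<cdot>\<^sub>H k2)) k) r) h"
      "\<lambda>h k. (b \<cdot>\<^sub>A c) \<otimes>\<^sub>k (h \<cdot>\<^sub>H k) + a *s ((b \<cdot>\<^sub>A c \<cdot>\<^sub>A y) \<otimes>\<^sub>k (h \<diamondop> k))" h k])
    (auto intro!: lin simp: lin sw2H act_def cocycle_def sig_def circ_def)

lemma coord_eqI: "c1 h = c1 k \<Longrightarrow> cg h = cg k \<Longrightarrow> cx h = cx k \<Longrightarrow> cw h = cw k \<Longrightarrow> h = k"
  by (metis h_expansion)

lemma mulH_expansion: "h \<cdot>\<^sub>H k =
    (c1 h * c1 k + cg h * cg k) *s \<one>\<^sub>H + (c1 h * cg k + cg h * c1 k) *s g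
  + (c1 h * cx k + cx h * c1 k + cg h * cw k - cw h * cg k) *s x
  + (c1 h * cw k + cw h * c1 k + cg h * cx k - cx h * cg k) *s w"
  by (rule H_ext2[of "\<lambda>h k. h \<cdot>\<^sub>H k" "\<lambda>h k. (c1 h * c1 k + cg h * cg k) *s \<one>\<^sub>H + (c1 h * cg k + cg h * c1 k) *s g
  + (c1 h * cx k + cx h * c1 k + cg h * cw k - cw h * cg k) *s x
  + (c1 h * cw k + cw h * c1 k + cg h * cx k - cx h * cg k) *s w"])
   (intro lin | auto)+

text \<open>
  These are the coefficients of \<open>x\<^sup>2\<close> and of \<open>x\<^sup>4\<close> in the associative law of \<open>k\<langle>g, x | g\<^sup>2 = 1, xg = -gx\<rangle>\<close>;
  in \<open>B a\<close> they become the coefficients of \<open>a\<close> and of \<open>a\<^sup>2\<close>.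
\<close>

lemma circ_assoc1: "(h \<cdot>\<^sub>H k) \<diamondop> l + (h \<diamondop> k) \<cdot>\<^sub>H l = h \<diamondop> (k \<cdot>\<^sub>H l) + h \<cdot>\<^sub>H (k \<diamondop> l)"
  by (rule coord_eqI) (simp_all add: circ_def mulH_expansion algebra_simps)

lemma circ_assoc2: "(h \<diamondop> k) \<diamondop> l = h \<diamondop> (k \<diamondop> l)"
  by (rule coord_eqI) (simp_all add: circ_def algebra_simps)

lemma circ_unit: "\<one>\<^sub>H \<diamondop> h = 0" "h \<diamondop> \<one>\<^sub>H = 0" by (simp_all add: circ_def)

lemma mulB_linear [lin]: "klinear F \<Longrightarrow> klinear (\<lambda>v. F v \<cdot>\<^bsub>B a\<^esub> T)" "klinear F \<Longrightarrow> klinear (\<lambda>v. S \<cdot>\<^bsub>B a\<^esub> F v)"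
  unfolding B_sel by (intro lin; assumption)+

lemma mulB_add_scale:
  "(S + S') \<cdot>\<^bsub>B a\<^esub> T = S \<cdot>\<^bsub>B a\<^esub> T + S' \<cdot>\<^bsub>B a\<^esub> T" "T \<cdot>\<^bsub>B a\<^esub> (S + S') = T \<cdot>\<^bsub>B a\<^esub> S + T \<cdot>\<^bsub>B a\<^esub> S'"
  "(c *s S) \<cdot>\<^bsub>B a\<^esub> T = c *s (S \<cdot>\<^bsub>B a\<^esub> T)" "T \<cdot>\<^bsub>B a\<^esub> (c *s S) = c *s (T \<cdot>\<^bsub>B a\<^esub> S)"
  by (rule klinear_plus[of "\<lambda>S. S \<cdot>\<^bsub>B a\<^esub> T"] klinear_plus[of "\<lambda>S. T \<cdot>\<^bsub>B a\<^esub> S"]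
        klinear_smult[of "\<lambda>S. S \<cdot>\<^bsub>B a\<^esub> T"] klinear_smult[of "\<lambda>S. T \<cdot>\<^bsub>B a\<^esub> S"]; intro lin)+

lemma B_assoc: "S \<cdot>\<^bsub>B a\<^esub> T \<cdot>\<^bsub>B a\<^esub> U = S \<cdot>\<^bsub>B a\<^esub> (T \<cdot>\<^bsub>B a\<^esub> U)"
proof (rule tensor_ext2[of "\<lambda>S T. S \<cdot>\<^bsub>B a\<^esub> T \<cdot>\<^bsub>B a\<^esub> U" "\<lambda>S T. S \<cdot>\<^bsub>B a\<^esub> (T \<cdot>\<^bsub>B a\<^esub> U)"])
  fix b h c k
  show "(b \<otimes>\<^sub>k h) \<cdot>\<^bsub>B a\<^esub> (c \<otimes>\<^sub>k k) \<cdot>\<^bsub>B a\<^esub> U = (b \<otimes>\<^sub>k h) \<cdot>\<^bsub>B a\<^esub> ((c \<otimes>\<^sub>k k) \<cdot>\<^bsub>B a\<^esub> U)"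
  proof (rule tensor_ext[of "\<lambda>U. (b \<otimes>\<^sub>k h) \<cdot>\<^bsub>B a\<^esub> (c \<otimes>\<^sub>k k) \<cdot>\<^bsub>B a\<^esub> U"])
    fix d l
    define e where "e = b \<cdot>\<^sub>A (c \<cdot>\<^sub>A d)"
    have e: "b \<cdot>\<^sub>A c \<cdot>\<^sub>A d = e" "b \<cdot>\<^sub>A c \<cdot>\<^sub>A y \<cdot>\<^sub>A d = e \<cdot>\<^sub>A y" "b \<cdot>\<^sub>A c \<cdot>\<^sub>A d \<cdot>\<^sub>A y = e \<cdot>\<^sub>A y"
      "b \<cdot>\<^sub>A (c \<cdot>\<^sub>A d) = e" "b \<cdot>\<^sub>A (c \<cdot>\<^sub>A d \<cdot>\<^sub>A y) = e \<cdot>\<^sub>A y"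
      "b \<cdot>\<^sub>A (c \<cdot>\<^sub>A d) \<cdot>\<^sub>A y = e \<cdot>\<^sub>A y"
      by (simp_all add: e_def assocA commA left_commA)
    have "(b \<otimes>\<^sub>k h) \<cdot>\<^bsub>B a\<^esub> (c \<otimes>\<^sub>k k) \<cdot>\<^bsub>B a\<^esub> (d \<otimes>\<^sub>k l) = e \<otimes>\<^sub>k (h \<cdot>\<^sub>H k \<cdot>\<^sub>H l)
        + a *s ((e \<cdot>\<^sub>A y) \<otimes>\<^sub>k ((h \<cdot>\<^sub>H k) \<diamondop> l + (h \<diamondop> k) \<cdot>\<^sub>H l))
        + (a * a) *s ((e \<cdot>\<^sub>A y \<cdot>\<^sub>A y) \<otimes>\<^sub>k ((h \<diamondop> k) \<diamondop> l))"
      by (simp add: mulB mulB_add_scale e vec.scale_right_distrib)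
    also have "\<dots> = e \<otimes>\<^sub>k (h \<cdot>\<^sub>H (k \<cdot>\<^sub>H l))
        + a *s ((e \<cdot>\<^sub>A y) \<otimes>\<^sub>k (h \<diamondop> (k \<cdot>\<^sub>H l) + h \<cdot>\<^sub>H (k \<diamondop> l)))
        + (a * a) *s ((e \<cdot>\<^sub>A y \<cdot>\<^sub>A y) \<otimes>\<^sub>k (h \<diamondop> (k \<diamondop> l)))"
      by (simp only: circ_assoc1 circ_assoc2 assocH)
    also have "\<dots> = (b \<otimes>\<^sub>k h) \<cdot>\<^bsub>B a\<^esub> ((c \<otimes>\<^sub>k k) \<cdot>\<^bsub>B a\<^esub> (d \<otimes>\<^sub>k l))"
      by (simp add: mulB mulB_add_scale e vec.scale_right_distrib)
    finally show "(b \<otimes>\<^sub>k h) \<cdot>\<^bsub>B a\<^esub> (c \<otimes>\<^sub>k k) \<cdot>\<^bsub>B a\<^esub> (d \<otimes>\<^sub>k l) = \<dots>" .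
  qed (intro lin)+
qed (intro lin)+

lemma B_algebra: "algebra_axioms (B a)"
proof -
  have "unt (B a) \<cdot>\<^bsub>B a\<^esub> S = S" for S
    by (rule tensor_ext[of "\<lambda>S. unt (B a) \<cdot>\<^bsub>B a\<^esub> S" "\<lambda>S. S"], (intro lin)+)
      (simp add: B_sel(2) mulB circ_unit)
  moreover have "S \<cdot>\<^bsub>B a\<^esub> unt (B a) = S" for S
    by (rule tensor_ext[of "\<lambda>S. S \<cdot>\<^bsub>B a\<^esub> unt (B a)" "\<lambda>S. S"], (intro lin)+)
      (simp add: B_sel(2) mulB circ_unit)
  moreover have "kbilinear (mul (B a))" by (intro lin)
  ultimately show ?thesis by (simp add: algebra_axioms_def B_assoc)
qed

lemma B_coalgebra: "coalgebra_axioms (B a)"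
  by (rule tensor_coalgebra[OF coalgA coalgH B_sel(3,4)])

lemma sw2B:
  assumes "\<And>w. klinear (\<lambda>v. \<phi> v w)" "\<And>v. klinear (\<phi> v)"
  shows "sw2 (B a) \<phi> (b \<otimes>\<^sub>k h) = sw2 A (\<lambda>a1 a2. sw2 H (\<lambda>h1 h2. \<phi> (a1 \<otimes>\<^sub>k h1) (a2 \<otimes>\<^sub>k h2)) h) b"
  by (rule sw2_tensor[OF coalgA coalgH B_sel(3) assms])

text \<open>
  The exchange of the two middle factors, from \<open>A \<otimes> A \<otimes> H \<otimes> H\<close> to \<open>A \<otimes> H \<otimes> A \<otimes> H\<close>. It expresses the
  comultiplication of \<open>A \<otimes> H\<close> through those of \<open>A\<close> and \<open>H\<close> without Sweedler sums.
\<close>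

definition shuffle :: "'k ^ ('a \<times> 'a) \<Rightarrow> 'k ^ ('h \<times> 'h) \<Rightarrow> 'k ^ (('a \<times> 'h) \<times> ('a \<times> 'h))" where
  "shuffle S P = tlift (\<lambda>b b'. tlift (\<lambda>h h'. (b \<otimes>\<^sub>k h) \<otimes>\<^sub>k (b' \<otimes>\<^sub>k h')) P) S"

lemma shuffle_linear [lin]: "klinear F \<Longrightarrow> klinear (\<lambda>v. shuffle (F v) P)" "klinear G \<Longrightarrow> klinear (\<lambda>v. shuffle S (G v))"
  unfolding shuffle_def by (intro lin; assumption)+

lemma shuffle_simps:
  "shuffle (S + S') P = shuffle S P + shuffle S' P" "shuffle S (P + P') = shuffle S P + shuffle S P'"
  "shuffle S 0 = 0" "shuffle (b \<otimes>\<^sub>k b') (h \<otimes>\<^sub>k h') = (b \<otimes>\<^sub>k h) \<otimes>\<^sub>k (b' \<otimes>\<^sub>k h')"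
  using klinear_plus[OF shuffle_linear(1)[OF klinear_id]] klinear_plus[OF shuffle_linear(2)[OF klinear_id]]
    klinear_0[OF shuffle_linear(2)[OF klinear_id]]
  by (simp_all add: shuffle_def tlift_tens lin)

lemma tensor_cmul_shuffle: "tensor_cmul A H (b \<otimes>\<^sub>k h) = shuffle (cmul A b) (cmul H h)"
  by (simp add: tensor_cmul_tens[OF coalgA coalgH] shuffle_def sw2_def)

text \<open>
  With \<open>m\<close> and \<open>n\<close> equal to the product of \<open>H\<close> or to \<open>\<diamondop>\<close>, these are the components in \<open>H \<otimes> H\<close> of a product
  of two elements of \<open>B a \<otimes> B a\<close>.
\<close>

definition pair_mul ::
    "('k ^ 'h \<Rightarrow> 'k ^ 'h \<Rightarrow> 'k ^ 'h) \<Rightarrow> ('k ^ 'h \<Rightarrow> 'k ^ 'h \<Rightarrow> 'k ^ 'h) \<Rightarrow> 'k ^ ('h \<times> 'h) \<Rightarrow> 'k ^ ('h \<times> 'h) \<Rightarrow> 'k ^ ('h \<times> 'h)" where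
  "pair_mul m n P Q = tlift (\<lambda>h h'. tlift (\<lambda>k k'. m h k \<otimes>\<^sub>k n h' k') Q) P"

lemma pair_mul_linear [lin]:
  "klinear F \<Longrightarrow> klinear (\<lambda>v. pair_mul m n (F v) Q)" "klinear F \<Longrightarrow> klinear (\<lambda>v. pair_mul m n P (F v))"
  unfolding pair_mul_def by (intro lin; assumption)+

lemma pair_mul_tens:
  assumes "kbilinear m" "kbilinear n"
  shows "pair_mul m n (h \<otimes>\<^sub>k h') (k \<otimes>\<^sub>k k') = m h k \<otimes>\<^sub>k n h' k'"
proof -
  note [lin] = kbilinear_left[OF assms(1)] kbilinear_right[OF assms(1)]
    kbilinear_left[OF assms(2)] kbilinear_right[OF assms(2)]
  show ?thesis unfolding pair_mul_def by (simp add: tlift_tens lin)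
qed

lemma bilinear_circ: "kbilinear (\<diamondop>)" and bilinear_mulH: "kbilinear (mul H)"
  by (intro lin)+

text \<open>
  The comultiplication of a product in \<open>B a\<close> has terms of order \<open>1\<close> and \<open>a\<close>, while the product of two
  comultiplications also has a term of order \<open>a\<^sup>2\<close>. The first two identities match the terms with
  \<open>y \<otimes> 1\<close> and \<open>1 \<otimes> y\<close>, the two summands of \<open>\<Delta> y\<close>; the third says that the term of order \<open>a\<^sup>2\<close> vanishes.
\<close>

lemma circ_cmul:
  "pair_mul (\<diamondop>) (mul H) (cmul H h) (cmul H k) = cmul H (h \<diamondop> k)"
  "pair_mul (mul H) (\<diamondop>) (cmul H h) (cmul H k) = cmul H (h \<diamondop> k)"
  "pair_mul (\<diamondop>) (\<diamondop>) (cmul H h) (cmul H k) = 0"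
  "pair_mul (mul H) (mul H) (cmul H h) (cmul H k) = cmul H (h \<cdot>\<^sub>H k)"
proof -
  have add: "pair_mul m n (P + P') Q = pair_mul m n P Q + pair_mul m n P' Q"
    "pair_mul m n P (Q + Q') = pair_mul m n P Q + pair_mul m n P Q'" for m n P P' Q Q'
    using klinear_plus[OF pair_mul_linear(1)[OF klinear_id]] klinear_plus[OF pair_mul_linear(2)[OF klinear_id]]
    by auto
  have b: "kbilinear (\<diamondop>)" "kbilinear (mul H)" by (rule bilinear_circ bilinear_mulH)+
  note s = cmulH_table add pair_mul_tens[OF b(1) b(2)] pair_mul_tens[OF b(2) b(1)]
    pair_mul_tens[OF b(1) b(1)] circ_def
  show "pair_mul (\<diamondop>) (mul H) (cmul H h) (cmul H k) = cmul H (h \<diamondop> k)"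
    by (rule H_ext2[of "\<lambda>h k. pair_mul (\<diamondop>) (mul H) (cmul H h) (cmul H k)" "\<lambda>h k. cmul H (h \<diamondop> k)"])
      ((intro lin)+, auto simp: s)
  show "pair_mul (mul H) (\<diamondop>) (cmul H h) (cmul H k) = cmul H (h \<diamondop> k)"
    by (rule H_ext2[of "\<lambda>h k. pair_mul (mul H) (\<diamondop>) (cmul H h) (cmul H k)" "\<lambda>h k. cmul H (h \<diamondop> k)"])
      ((intro lin)+, auto simp: s)
  show "pair_mul (\<diamondop>) (\<diamondop>) (cmul H h) (cmul H k) = 0"
    by (rule H_ext2[of "\<lambda>h k. pair_mul (\<diamondop>) (\<diamondop>) (cmul H h) (cmul H k)" "\<lambda>h k. 0"])
      ((intro lin)+, auto simp: s)
  show "pair_mul (mul H) (mul H) (cmul H h) (cmul H k) = cmul H (h \<cdot>\<^sub>H k)"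
    by (simp add: cmulH_mul tensor_mul_def pair_mul_def)
qed

lemma shuffle_mul:
  "tensor_mul (B a) (B a) (shuffle S P) (shuffle T Q) =
     shuffle (tensor_mul A A S T) (pair_mul (mul H) (mul H) P Q)
   + a *s shuffle (tensor_mul A A (tensor_mul A A S T) (y \<otimes>\<^sub>k \<one>\<^sub>A)) (pair_mul (\<diamondop>) (mul H) P Q)
   + a *s shuffle (tensor_mul A A (tensor_mul A A S T) (\<one>\<^sub>A \<otimes>\<^sub>k y)) (pair_mul (mul H) (\<diamondop>) P Q)
   + (a * a) *s shuffle (tensor_mul A A (tensor_mul A A S T) (y \<otimes>\<^sub>k y)) (pair_mul (\<diamondop>) (\<diamondop>) P Q)"
  (is "?L S P T Q = ?R S P T Q")
proof (rule tensor_ext2[of "\<lambda>S T. ?L S P T Q" "\<lambda>S T. ?R S P T Q"])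
  fix b b' c c'
  show "?L (b \<otimes>\<^sub>k b') P (c \<otimes>\<^sub>k c') Q = ?R (b \<otimes>\<^sub>k b') P (c \<otimes>\<^sub>k c') Q"
  proof (rule tensor_ext2[of "\<lambda>P Q. ?L (b \<otimes>\<^sub>k b') P (c \<otimes>\<^sub>k c') Q" "\<lambda>P Q. ?R (b \<otimes>\<^sub>k b') P (c \<otimes>\<^sub>k c') Q"])
    fix h h' k k'
    show "?L (b \<otimes>\<^sub>k b') (h \<otimes>\<^sub>k h') (c \<otimes>\<^sub>k c') (k \<otimes>\<^sub>k k') = ?R (b \<otimes>\<^sub>k b') (h \<otimes>\<^sub>k h') (c \<otimes>\<^sub>k c') (k \<otimes>\<^sub>k k')"
      by (simp add: shuffle_simps tensor_mul_tens[OF algA algA] tensor_mul_tens[OF B_algebra B_algebra]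
          pair_mul_tens bilinear_circ bilinear_mulH mulB vec.scale_right_distrib)
  qed (intro lin)+
qed (intro lin)+

lemma cmulB_mul: "cmul (B a) (S \<cdot>\<^bsub>B a\<^esub> T) = tensor_mul (B a) (B a) (cmul (B a) S) (cmul (B a) T)"
proof (rule tensor_ext2[of "\<lambda>S T. cmul (B a) (S \<cdot>\<^bsub>B a\<^esub> T)"])
  fix b h c k
  show "cmul (B a) ((b \<otimes>\<^sub>k h) \<cdot>\<^bsub>B a\<^esub> (c \<otimes>\<^sub>k k))
    = tensor_mul (B a) (B a) (cmul (B a) (b \<otimes>\<^sub>k h)) (cmul (B a) (c \<otimes>\<^sub>k k))"
    by (simp add: B_sel(3) mulB tensor_cmul_shuffle shuffle_mul circ_cmul cmulA_mul cmul_y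
        tensor_mul_simps shuffle_simps vec.scale_right_distrib add.assoc
        klinear_plus[OF tensor_cmul_linear[OF klinear_id]] klinear_smult[OF tensor_cmul_linear[OF klinear_id]])
qed (unfold B_sel(3), (intro lin)+)

lemma cuntB_mul: "cunt (B a) (S \<cdot>\<^bsub>B a\<^esub> T) = cunt (B a) S * cunt (B a) T"
proof (rule tensor_ext_functional[of "\<lambda>S. cunt (B a) (S \<cdot>\<^bsub>B a\<^esub> T)" "\<lambda>S. cunt (B a) S * cunt (B a) T"])
  fix b h
  show "cunt (B a) ((b \<otimes>\<^sub>k h) \<cdot>\<^bsub>B a\<^esub> T) = cunt (B a) (b \<otimes>\<^sub>k h) * cunt (B a) T"
  proof (rule tensor_ext_functional[of "\<lambda>T. cunt (B a) ((b \<otimes>\<^sub>k h) \<cdot>\<^bsub>B a\<^esub> T)"])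
    fix c k
    show "cunt (B a) ((b \<otimes>\<^sub>k h) \<cdot>\<^bsub>B a\<^esub> (c \<otimes>\<^sub>k k)) = cunt (B a) (b \<otimes>\<^sub>k h) * cunt (B a) (c \<otimes>\<^sub>k k)"
      by (simp add: B_sel(4) mulB tensor_cunt_tens[OF coalgA coalgH] 
        kfunctional_plus[OF tensor_cunt_functional[OF klinear_id]]
        kfunctional_smult[OF tensor_cunt_functional[OF klinear_id]])
  qed (unfold B_sel(4), (intro lin)+)
qed (unfold B_sel(4), (intro lin)+)

lemma B_bialgebra: "bialgebra (B a)"
  unfolding bialgebra_def
  by (auto simp: B_algebra B_coalgebra cmulB_mul cuntB_mul)
    (auto simp: B_sel tensor_cunt_tens[OF coalgA coalgH] tensor_cmul_shuffle cmulH_table shuffle_simps)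

text \<open>
  The antipode is \<open>S\<^sub>A \<otimes> S\<^sub>H\<close>. The correction terms of the product do not disturb it, because
  the Sweedler sums \<open>S(h\<^sub>1) \<diamondop> h\<^sub>2\<close> and \<open>h\<^sub>1 \<diamondop> S(h\<^sub>2)\<close> vanish on the basis.
\<close>

lemma B_hopf: "hopf_algebra (B a)"
proof -
  obtain SA SH where SA: "is_antipode A SA" and SH: "is_antipode H SH"
    using A H by (auto simp: hopf_algebra_def)
  have l: "klinear SA" "klinear SH" using SA SH by (auto simp: is_antipode_def)
  note [lin] = klinear_compose[OF l(1)] klinear_compose[OF l(2)]
  have a: "sw2 A (\<lambda>b1 b2. SA b1 \<cdot>\<^sub>A b2) b = cunt A b *s \<one>\<^sub>A" "sw2 A (\<lambda>b1 b2. b1 \<cdot>\<^sub>A SA b2) b = cunt A b *s \<one>\<^sub>A"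
    "sw2 H (\<lambda>b1 b2. SH b1 \<cdot>\<^sub>H b2) h = \<epsilon> h *s \<one>\<^sub>H" "sw2 H (\<lambda>b1 b2. b1 \<cdot>\<^sub>H SH b2) h = \<epsilon> h *s \<one>\<^sub>H" for b h
    using SA SH by (auto simp: is_antipode_def)
  have S1: "SH \<one>\<^sub>H = \<one>\<^sub>H" using a(3)[of "\<one>\<^sub>H"] by (simp add: sw2H lin)
  have "SH g \<cdot>\<^sub>H g = \<one>\<^sub>H" using a(3)[of g] by (simp add: sw2H lin)
  then have Sg: "SH g = g" using assocH[of "SH g" g g] by simp
  have Sx: "SH x = - w" using a(3)[of x] by (simp add: sw2H lin Sg eq_neg_iff_add_eq_0)
  have "SH w \<cdot>\<^sub>H g = - w" using a(3)[of w] by (simp add: sw2H lin S1 eq_neg_iff_add_eq_0)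
  then have Sw: "SH w = x" using assocH[of "SH w" g g] by simp
  have z: "sw2 H (\<lambda>h1 h2. SH h1 \<diamondop> h2) h = 0" "sw2 H (\<lambda>h1 h2. h1 \<diamondop> SH h2) h = 0" for h
    by (rule H_ext[of "sw2 H (\<lambda>h1 h2. SH h1 \<diamondop> h2)" "\<lambda>h. 0"]
        H_ext[of "sw2 H (\<lambda>h1 h2. h1 \<diamondop> SH h2)" "\<lambda>h. 0"]; (intro lin)?;
        simp add: sw2H lin S1 Sg Sx Sw circ_def)+
  define S where "S = tlift (\<lambda>b h. SA b \<otimes>\<^sub>k SH h)"
  have lS: "klinear S" unfolding S_def by (intro lin)
  note [lin] = klinear_compose[OF lS]
  have S: "S (b \<otimes>\<^sub>k h) = SA b \<otimes>\<^sub>k SH h" for b h by (simp add: S_def tlift_tens lin)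
  have [lin]: "klinear F \<Longrightarrow> klinear (\<lambda>v. sw2 (B a) \<phi> (F v))"
    for F :: "'k ^ 'n::finite \<Rightarrow> _" and \<phi> :: "_ \<Rightarrow> _ \<Rightarrow> 'k ^ 'm::finite"
    by (rule coalg_sw2[OF B_coalgebra])
  have [lin]: "klinear F \<Longrightarrow> kfunctional (\<lambda>v. cunt (B a) (F v))" for F :: "'k ^ 'n::finite \<Rightarrow> _"
    by (rule coalg_cunt[OF B_coalgebra])
  have H1: "sw2 H (\<lambda>h1 h2. u \<otimes>\<^sub>k m h1 h2 + a *s (v \<otimes>\<^sub>k n h1 h2)) h = u \<otimes>\<^sub>k sw2 H m h + a *s (v \<otimes>\<^sub>k sw2 H n h)"
    for u v :: "'k ^ 'a" and m n h
    by (simp add: sw2_add_fun sw2_scale_fun klinear_sw2_commute[of "\<lambda>m. u \<otimes>\<^sub>k m" for u] lin)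
  have A1: "sw2 A (\<lambda>b1 b2. r *s (m b1 b2 \<otimes>\<^sub>k u)) b = r *s (sw2 A m b \<otimes>\<^sub>k u)"
    for u :: "'k ^ 'h" and m b r
    by (simp add: sw2_scale_fun klinear_sw2_commute[of "\<lambda>m. m \<otimes>\<^sub>k u" for u] lin)
  have "sw2 (B a) (\<lambda>b1 b2. S b1 \<cdot>\<^bsub>B a\<^esub> b2) T = cunt (B a) T *s unt (B a)" for T
    by (rule tensor_ext[of "sw2 (B a) (\<lambda>b1 b2. S b1 \<cdot>\<^bsub>B a\<^esub> b2)" "\<lambda>T. cunt (B a) T *s unt (B a)"], (intro lin)+)
      (simp add: sw2B lin S mulB H1 A1 a z B_sel(2,4) tensor_cunt_tens[OF coalgA coalgH] mult.commute)
  moreover have "sw2 (B a) (\<lambda>b1 b2. b1 \<cdot>\<^bsub>B a\<^esub> S b2) T = cunt (B a) T *s unt (B a)" for T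
    by (rule tensor_ext[of "sw2 (B a) (\<lambda>b1 b2. b1 \<cdot>\<^bsub>B a\<^esub> S b2)" "\<lambda>T. cunt (B a) T *s unt (B a)"], (intro lin)+)
      (simp add: sw2B lin S mulB H1 A1 a z B_sel(2,4) tensor_cunt_tens[OF coalgA coalgH] mult.commute)
  ultimately have "is_antipode (B a) S" using lS by (simp add: is_antipode_def)
  then show ?thesis using B_bialgebra by (auto simp: hopf_algebra_def)
qed

lemma B_in_CS: "(act, cocycle a) \<in> CS A H"
proof -
  have "act h (b \<cdot>\<^sub>A c) = sw2 H (\<lambda>h1 h2. act h1 b \<cdot>\<^sub>A act h2 c) h" for h b c
    by (rule H_ext[of "\<lambda>h. act h (b \<cdot>\<^sub>A c)" "\<lambda>h. sw2 H (\<lambda>h1 h2. act h1 b \<cdot>\<^sub>A act h2 c) h"], (intro lin)+)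
      (simp_all add: sw2H lin act_def)
  then have "weak_action A H act" by (simp add: weak_action_def bilinear_act) (simp add: act_def)
  then show ?thesis using B_hopf[of a] by (simp add: CS_def bilinear_cocycle B_def)
qed

end

section \<open>Primitive and group-like elements of the truncated polynomial algebra\<close>

context truncated_sweedler begin

lemma A_ext_functional:
  assumes "kfunctional s" "kfunctional t" "\<And>n. n < p \<Longrightarrow> s (ypow n) = t (ypow n)"
  shows "s b = t b"
  by (subst (1 2) y_expansion) (simp add: kfunctional_sum_apply assms kfunctional_smult)

lemma cy_simps [simp]:
  "cy n (b + c) = cy n b + cy n c" "cy n (b - c) = cy n b - cy n c" "cy n (- b) = - cy n b"
  "cy n (r *s b) = r * cy n b" "cy n 0 = 0"
  by (simp_all add: cy_functional kfunctional_plus kfunctional_minus2 kfunctional_uminus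
      kfunctional_smult kfunctional_0)

lemma cy_unit: "cy m \<one>\<^sub>A = (if m = 0 then 1 else 0)" and cy_y: "cy m y = (if m = 1 then 1 else 0)"
  using cy_ypow[of 0 m] cy_ypow[of 1 m] p3 by (auto simp: ypow_0 ypow_1 simp del: One_nat_def)

lemma cy_0: "cy 0 b = cunt A b"
proof (rule A_ext_functional[of "cy 0" "cunt A"])
  show "cy 0 (ypow n) = cunt A (ypow n)" if "n < p" for n
    using that cy_ypow[of n 0] by (cases n) (auto simp: ypow_0 ypow_Suc cy_unit)
qed (intro cy_functional coalg_cunt[OF coalgA] lin)+

text \<open>
  Multiplication by \<open>y\<close> shifts coefficients. For \<open>b = y\<^sup>p\<^sup>-\<^sup>1\<close> the product is \<open>0\<close>, and so is the constant
  term of \<open>b\<close>, since \<open>p > 1\<close>.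
\<close>

lemma cy_1_mul_y: "cy 1 (y \<cdot>\<^sub>A b) = cy 0 b"
proof (rule A_ext_functional[of "\<lambda>b. cy 1 (y \<cdot>\<^sub>A b)" "cy 0"])
  show "cy 1 (y \<cdot>\<^sub>A ypow n) = cy 0 (ypow n)" if "n < p" for n
  proof (cases "Suc n < p")
    case True
    then show ?thesis using cy_ypow[of n 0] cy_ypow[of "Suc n" 1] by (simp add: ypow_Suc)
  next
    case False
    then have "ypow (Suc n) = 0" "n \<noteq> 0" using p3 by (auto intro: ypow_ge)
    then show ?thesis using that cy_ypow[of n 0] by (simp add: ypow_Suc)
  qed
qed (intro cy_functional lin)+

text \<open>The derivation \<open>d/dy\<close>, written through the comultiplication: it contracts the first factor
  of \<open>\<Delta>\<close> with the coefficient of \<open>y\<close>.\<close>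

definition dy :: "'k ^ 'a \<Rightarrow> 'k ^ 'a" where
  "dy b = tlift (\<lambda>b1 b2. cy 1 b1 *s b2) (cmul A b)"

lemma dy_linear [lin]: "klinear F \<Longrightarrow> klinear (\<lambda>v. dy (F v))"
  unfolding dy_def by (intro lin)

text \<open>
  The Leibniz rule for the factor \<open>y\<close>, from \<open>\<Delta>(yb) = (y \<otimes> 1 + 1 \<otimes> y) \<Delta> b\<close>. The
  derivatives of the powers of \<open>y\<close> follow by induction.
\<close>

lemma dy_mul_y: "dy (y \<cdot>\<^sub>A b) = b + y \<cdot>\<^sub>A dy b"
proof -
  have "tlift (\<lambda>b1 b2. cy 1 b1 *s b2) (tensor_mul A A (y \<otimes>\<^sub>k \<one>\<^sub>A + \<one>\<^sub>A \<otimes>\<^sub>k y) T)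
      = tlift (\<lambda>b1 b2. cunt A b1 *s b2) T + y \<cdot>\<^sub>A tlift (\<lambda>b1 b2. cy 1 b1 *s b2) T" for T
    by (rule tensor_ext[of "\<lambda>T. tlift (\<lambda>b1 b2. cy 1 b1 *s b2) (tensor_mul A A (y \<otimes>\<^sub>k \<one>\<^sub>A + \<one>\<^sub>A \<otimes>\<^sub>k y) T)"],
          (intro lin)+)
      (simp add: tensor_mul_simps tensor_mul_tens algA tlift_tens lin cy_1_mul_y[unfolded cy_0]
        klinear_plus[OF tlift_linear[OF klinear_id]] del: One_nat_def)
  moreover have "tlift (\<lambda>b1 b2. cunt A b1 *s b2) (cmul A b) = b"
    using counit_left[OF coalgA klinear_id, of b] by (simp add: sw2_def)
  ultimately show ?thesis by (simp add: dy_def cmulA_mul cmul_y)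
qed

lemma dy_ypow: "dy (ypow n) = of_nat n *s ypow (n - 1)"
proof (induction n)
  case 0
  then show ?case by (simp add: ypow_0 dy_def tlift_tens lin cy_unit)
next
  case (Suc n)
  have "y \<cdot>\<^sub>A (of_nat n *s ypow (n - 1)) = of_nat n *s ypow n"
    by (cases n) (simp_all add: ypow_Suc)
  then show ?case by (simp add: ypow_Suc dy_mul_y Suc vec.scale_left_distrib)
qed

lemma cy_dy: "m < p \<Longrightarrow> cy m (dy b) = (if Suc m < p then of_nat (Suc m) * cy (Suc m) b else 0)"
proof (rule A_ext_functional[of "\<lambda>b. cy m (dy b)" "\<lambda>b. if Suc m < p then of_nat (Suc m) * cy (Suc m) b else 0"])
  fix n assume "m < p" "n < p"
  then show "cy m (dy (ypow n)) = (if Suc m < p then of_nat (Suc m) * cy (Suc m) (ypow n) else 0)"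
    using cy_ypow[of "n - 1" m] cy_ypow[of n "Suc m"] by (cases n) (auto simp: dy_ypow)
qed (cases "Suc m < p"; auto intro!: lin)+

lemma of_nat_nonzero: "0 < n \<Longrightarrow> n < p \<Longrightarrow> of_nat n \<noteq> (0 :: 'k)"
  using char_p by (auto simp: of_nat_eq_0_iff_char_dvd dest: dvd_imp_le)

lemma A_eqI: "(\<And>n. n < p \<Longrightarrow> cy n b = cy n c) \<Longrightarrow> b = c"
  by (subst y_expansion[of b], subst y_expansion[of c]) simp

text \<open>
  A primitive element has constant derivative, and no constant term. A constant derivative leaves
  only degrees \<open>0\<close> and \<open>1\<close> because the numbers below \<open>p\<close> are invertible in \<open>k\<close>.
\<close>

lemma primitive_A:
  assumes "cmul A v = v \<otimes>\<^sub>k \<one>\<^sub>A + \<one>\<^sub>A \<otimes>\<^sub>k v"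
  shows "v = cy 1 v *s y"
proof (rule A_eqI)
  have "dy v = cy 1 v *s \<one>\<^sub>A"
    by (simp add: dy_def assms klinear_plus[OF tlift_linear[OF klinear_id]] tlift_tens lin cy_unit)
  then have d: "cy m (dy v) = (if m = 0 then cy 1 v else 0)" for m by (simp add: cy_unit)
  have "sw2 A (\<lambda>b1 b2. cunt A b1 *s b2) v = v"
    using counit_left[OF coalgA klinear_id] by simp
  then have "cunt A v *s \<one>\<^sub>A = 0"
    by (simp add: sw2_def assms klinear_plus[OF tlift_linear[OF klinear_id]] tlift_tens lin)
  then have "cy 0 v = 0" using unitA_nonzero by (simp add: cy_0)
  moreover have "cy (Suc m) v = 0" if "m \<noteq> 0" "Suc m < p" for m
    using cy_dy[of m v] d[of m] that of_nat_nonzero[of "Suc m"] by auto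
  ultimately show "cy n v = cy n (cy 1 v *s y)" if "n < p" for n
    using that by (cases n) (auto simp: cy_y)
qed

text \<open>A group-like element is an eigenvector of \<open>d/dy\<close>. Since that operator is nilpotent, the
  eigenvalue is \<open>0\<close>, and the element is a constant.\<close>

lemma grouplike_A:
  assumes "cmul A u = u \<otimes>\<^sub>k u" "cunt A u = 1"
  shows "u = \<one>\<^sub>A"
proof -
  have d: "dy u = cy 1 u *s u" by (simp add: dy_def assms tlift_tens lin)
  have rec: "cy 1 u * cy m u = (if Suc m < p then of_nat (Suc m) * cy (Suc m) u else 0)" if "m < p" for m
    using cy_dy[OF that, of u] d by simp
  have u0: "cy 0 u = 1" using assms by (simp add: cy_0)
  have eig: "cy 1 u = 0"
  proof (rule ccontr)
    assume n: "cy 1 u \<noteq> 0"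
    have "cy m u \<noteq> 0" if "m < p" for m
      using that
    proof (induction m)
      case (Suc m)
      then show ?case using rec[of m] n by auto
    qed (simp add: u0)
    then show False using rec[of "p - 1"] n p3 by force
  qed
  have s: "cy (Suc m) u = 0" if "Suc m < p" for m
    using rec[of m] that of_nat_nonzero[of "Suc m"] by (auto simp: eig[simplified])
  show ?thesis
  proof (rule A_eqI)
    show "cy n u = cy n \<one>\<^sub>A" if "n < p" for n
      using that s u0 by (cases n) (auto simp: cy_unit)
  qed
qed

section \<open>Classification of the crossed systems\<close>

text \<open>Equations in \<open>H \<otimes> V\<close> are compared coefficient by coefficient in the basis of \<open>H\<close>.\<close>

definition contract :: "('k ^ 'h \<Rightarrow> 'k) \<Rightarrow> 'k ^ ('h \<times> 'n::finite) \<Rightarrow> 'k ^ 'n" where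
  "contract s T = tlift (\<lambda>h b. s h *s b) T"

lemma contract_simps:
  assumes "kfunctional s"
  shows "contract s (S + T) = contract s S + contract s T" "contract s (- S) = - contract s S" "contract s (S - T) = contract s S - contract s T"
    "contract s (h \<otimes>\<^sub>k b) = s h *s b" "contract s 0 = 0"
proof -
  have l: "klinear (contract s)" unfolding contract_def[abs_def] by (intro lin)
  have "kfunctional (\<lambda>h. s h)" using assms by simp
  then show "contract s (h \<otimes>\<^sub>k b) = s h *s b" 
    by (simp add: contract_def tlift_tens lin)
  show "contract s (S + T) = contract s S + contract s T" "contract s (- S) = - contract s S" "contract s (S - T) = contract s S - contract s T" "contract s 0 = 0"
    by (rule klinear_plus klinear_uminus klinear_minus2 klinear_0; rule l)+
qed

lemmas coord_contract = coord_functional[THEN contract_simps(1)] coord_functional[THEN contract_simps(2)]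
  coord_functional[THEN contract_simps(3)] coord_functional[THEN contract_simps(4)]
  coord_functional[THEN contract_simps(5)]

definition projA :: "'k ^ ('a \<times> 'h) \<Rightarrow> 'k ^ 'a" where
  "projA T = tlift (\<lambda>b h. \<epsilon> h *s b) T"

definition projH :: "'k ^ ('a \<times> 'h) \<Rightarrow> 'k ^ 'h" where
  "projH T = tlift (\<lambda>b h. cunt A b *s h) T"

lemma proj_linear [lin]: "klinear F \<Longrightarrow> klinear (\<lambda>v. projA (F v))" "klinear F \<Longrightarrow> klinear (\<lambda>v. projH (F v))"
  unfolding projA_def projH_def by (intro lin; assumption)+

lemma proj_tens [simp]: "projA (b \<otimes>\<^sub>k h) = \<epsilon> h *s b" "projH (b \<otimes>\<^sub>k h) = cunt A b *s h"
  by (simp_all add: projA_def projH_def tlift_tens lin)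

lemma proj_sw2: "projA (sw2 C \<phi> b) = sw2 C (\<lambda>v w. projA (\<phi> v w)) b"
  "projH (sw2 C \<phi> b) = sw2 C (\<lambda>v w. projH (\<phi> v w)) b"
  by (simp_all add: klinear_sw2_commute[of projA] klinear_sw2_commute[of projH] lin)

lemma cunt_proj: "cunt A (projA T) = tensor_cunt A H T" "\<epsilon> (projH T) = tensor_cunt A H T"
  by (rule tensor_ext_functional[of "\<lambda>T. cunt A (projA T)"] tensor_ext_functional[of "\<lambda>T. \<epsilon> (projH T)"];
      (intro lin)?; simp add: tensor_cunt_tens[OF coalgA coalgH])+

lemma counit_sumA: "klinear \<phi> \<Longrightarrow> sw2 A (\<lambda>b1 b2. cunt A b1 *s \<phi> b2) b = \<phi> b"
  "klinear \<phi> \<Longrightarrow> sw2 A (\<lambda>b1 b2. cunt A b2 *s \<phi> b1) b = \<phi> b"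
  by (rule counit_left[OF coalgA] counit_right[OF coalgA]; assumption)+

lemma counit_sumH: "klinear \<phi> \<Longrightarrow> sw2 H (\<lambda>b1 b2. \<epsilon> b1 *s \<phi> b2) h = \<phi> h"
  "klinear \<phi> \<Longrightarrow> sw2 H (\<lambda>b1 b2. \<epsilon> b2 *s \<phi> b1) h = \<phi> h"
  by (rule counit_left[OF coalgH] counit_right[OF coalgH]; assumption)+

text \<open>
  Contracting the comultiplication of \<open>A \<otimes> H\<close> with two counits either recovers the element, possibly
  with its factors exchanged, or projects it to one of the two coalgebras.
\<close>

lemma tlift_cmul_proj:
  "tlift (\<lambda>u v. projH u \<otimes>\<^sub>k projA v) (tensor_cmul A H T) = tlift (\<lambda>b h. h \<otimes>\<^sub>k b) T"
  "tlift (\<lambda>u v. projA u \<otimes>\<^sub>k projH v) (tensor_cmul A H T) = T"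
  "tlift (\<lambda>u v. projA u \<otimes>\<^sub>k projA v) (tensor_cmul A H T) = cmul A (projA T)"
  "tlift (\<lambda>u v. projH u \<otimes>\<^sub>k projH v) (tensor_cmul A H T) = cmul H (projH T)"
proof -
  have s: "sw2 D (\<lambda>v w. v \<otimes>\<^sub>k w) d = cmul D d" for D :: "('k, 'n::finite) bialg" and d
    unfolding sw2_def using tensor_expansion by metis
  note r = tensor_cmul_tens[OF coalgA coalgH] tlift_sw2 tlift_tens lin sw2_scale_fun counit_sumA counit_sumH s
     vec.scale_scale[symmetric]
  show "tlift (\<lambda>u v. projH u \<otimes>\<^sub>k projA v) (tensor_cmul A H T) = tlift (\<lambda>b h. h \<otimes>\<^sub>k b) T"
    by (rule tensor_ext[of "\<lambda>T. tlift (\<lambda>u v. projH u \<otimes>\<^sub>k projA v) (tensor_cmul A H T)"], (intro lin)+)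
      (simp add: r del: vec.scale_scale)
  show "tlift (\<lambda>u v. projA u \<otimes>\<^sub>k projH v) (tensor_cmul A H T) = T"
    by (rule tensor_ext[of "\<lambda>T. tlift (\<lambda>u v. projA u \<otimes>\<^sub>k projH v) (tensor_cmul A H T)" "\<lambda>T. T"], (intro lin)+)
      (simp add: r del: vec.scale_scale)
  show "tlift (\<lambda>u v. projA u \<otimes>\<^sub>k projA v) (tensor_cmul A H T) = cmul A (projA T)"
    by (rule tensor_ext[of "\<lambda>T. tlift (\<lambda>u v. projA u \<otimes>\<^sub>k projA v) (tensor_cmul A H T)"], (intro lin)+)
      (simp add: r del: vec.scale_scale)
  show "tlift (\<lambda>u v. projH u \<otimes>\<^sub>k projH v) (tensor_cmul A H T) = cmul H (projH T)"
    by (rule tensor_ext[of "\<lambda>T. tlift (\<lambda>u v. projH u \<otimes>\<^sub>k projH v) (tensor_cmul A H T)"], (intro lin)+)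
      (simp add: r del: vec.scale_scale)
qed

text \<open>
  Everything follows from the Hopf algebra axioms of the crossed product: the unit normalizes the
  cocycle, comultiplicativity gives cocentrality and makes \<open>f(x, x)\<close> primitive, and associativity gives
  the values at \<open>(gx, x)\<close>, \<open>(x, gx)\<close> and \<open>(gx, gx)\<close>.
\<close>

lemma crossed_system_classification:
  assumes "(t, f) \<in> CS A H"
  shows "t = act" "\<exists>a. f = cocycle a"
proof -
  define C where "C = crossed_product A H t f"
  have wa: "weak_action A H t" and bf: "kbilinear f" and hC: "hopf_algebra C"
    using assms by (auto simp: CS_def C_def)
  have bt: "kbilinear t" and t_unit: "t h \<one>\<^sub>A = \<epsilon> h *s \<one>\<^sub>A" and t_one: "t \<one>\<^sub>H b = b" for h b
    using wa by (auto simp: weak_action_def)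
  note [lin] = kbilinear_left[OF bt] kbilinear_right[OF bt] kbilinear_left[OF bf] kbilinear_right[OF bf]
  have sel: "mul C = crossed_mul A H t f" "unt C = \<one>\<^sub>A \<otimes>\<^sub>k \<one>\<^sub>H" "cmul C = tensor_cmul A H" "cunt C = tensor_cunt A H"
    by (simp_all add: C_def crossed_product_def)
  have bC: "bialgebra C" using hC by (simp add: hopf_algebra_def)
  then have algC: "algebra_axioms C" and assocC: "a \<cdot>\<^bsub>C\<^esub> b \<cdot>\<^bsub>C\<^esub> c = a \<cdot>\<^bsub>C\<^esub> (b \<cdot>\<^bsub>C\<^esub> c)"
    and cmulC: "cmul C (a \<cdot>\<^bsub>C\<^esub> b) = tensor_mul C C (cmul C a) (cmul C b)"
    and cuntC: "cunt C (a \<cdot>\<^bsub>C\<^esub> b) = cunt C a * cunt C b" for a b c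
    by (auto simp: bialgebra_def algebra_axioms_def)
  note mulC = crossed_mul_tens[OF bt bf, folded sel(1)]
  note [lin] = alg_mul_left[OF algC] alg_mul_right[OF algC]
  let ?i = "\<lambda>h. \<one>\<^sub>A \<otimes>\<^sub>k h" and ?j = "\<lambda>b. b \<otimes>\<^sub>k \<one>\<^sub>H"
  note ss = sw2_scale_fun counit_sumH lin vec.scale_scale[symmetric]

  \<comment> \<open>The cocycle is normalized because \<open>1 \<otimes> 1\<close> is the unit.\<close>
  have hk: "?i h \<cdot>\<^bsub>C\<^esub> ?i k = sw2 H (\<lambda>h1 h2. sw2 H (\<lambda>k1 k2. f h1 k1 \<otimes>\<^sub>k (h2 \<cdot>\<^sub>H k2)) k) h" for h k
    by (simp add: mulC t_unit ss del: vec.scale_scale)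
  have f1: "f \<one>\<^sub>H k = \<epsilon> k *s \<one>\<^sub>A" for k
  proof -
    have "projA (?i \<one>\<^sub>H \<cdot>\<^bsub>C\<^esub> ?i k) = projA (?i k)"
      using algebra_mul_simps(11)[OF algC, of "?i k"] by (simp add: sel(2))
    then show ?thesis by (simp add: hk sw2H lin proj_sw2 counit_sumH)
  qed
  have f2: "f h \<one>\<^sub>H = \<epsilon> h *s \<one>\<^sub>A" for h
  proof -
    have "projA (?i h \<cdot>\<^bsub>C\<^esub> ?i \<one>\<^sub>H) = projA (?i h)"
      using algebra_mul_simps(12)[OF algC, of "?i h"] by (simp add: sel(2))
    then show ?thesis by (simp add: hk sw2H lin proj_sw2 counit_sumH)
  qed
  have hc: "?i h \<cdot>\<^bsub>C\<^esub> ?j c = sw2 H (\<lambda>h1 h2. t h1 c \<otimes>\<^sub>k h2) h" for h c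
    by (simp add: mulC f2 sw2H ss del: vec.scale_scale)
  have A_hk: "projA (?i h \<cdot>\<^bsub>C\<^esub> ?i k) = f h k" for h k
    by (simp add: hk proj_sw2 ss del: vec.scale_scale)
  have A_hc: "projA (?i h \<cdot>\<^bsub>C\<^esub> ?j c) = t h c" for h c
    by (simp add: hc proj_sw2 ss)
  have cunt_f: "cunt A (f h k) = \<epsilon> h * \<epsilon> k" for h k
    using cunt_proj(1)[of "?i h \<cdot>\<^bsub>C\<^esub> ?i k", folded sel(4)]
    by (simp add: A_hk cuntC) (simp add: sel tensor_cunt_tens[OF coalgA coalgH])
  have cunt_t: "cunt A (t h c) = \<epsilon> h * cunt A c" for h c
    using cunt_proj(1)[of "?i h \<cdot>\<^bsub>C\<^esub> ?j c", folded sel(4)]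
    by (simp add: A_hc cuntC) (simp add: sel tensor_cunt_tens[OF coalgA coalgH])
  have H_hk: "projH (?i h \<cdot>\<^bsub>C\<^esub> ?i k) = h \<cdot>\<^sub>H k" for h k
    by (simp add: hk proj_sw2 ss cunt_f klinear_sw2_commute[of "mul H h" H, symmetric]
        klinear_sw2_commute[of "\<lambda>h. h \<cdot>\<^sub>H k" H, symmetric] del: vec.scale_scale)
  have H_hc: "projH (?i h \<cdot>\<^bsub>C\<^esub> ?j c) = cunt A c *s h" for h c
    by (simp add: hc proj_sw2 ss cunt_t mult.commute[of _ "cunt A c"] del: vec.scale_scale)

  \<comment> \<open>Comultiplicativity, contracted with the counits, gives the two cocentrality conditions
    and shows that the cocycle is a coalgebra map.\<close>
  have cmul_i: "cmul C (?i h) = sw2 H (\<lambda>h1 h2. ?i h1 \<otimes>\<^sub>k ?i h2) h" for h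
    by (simp add: sel tensor_cmul_tens[OF coalgA coalgH]) (simp add: sw2_def tlift_tens lin)
  have cmul_j: "cmul C (?j c) = sw2 A (\<lambda>b1 b2. ?j b1 \<otimes>\<^sub>k ?j b2) c" for c
    by (simp add: sel tensor_cmul_tens[OF coalgA coalgH] sw2H lin)
  have cocentral_t: "sw2 H (\<lambda>h1 h2. h2 \<otimes>\<^sub>k t h1 c) h = sw2 H (\<lambda>h1 h2. h1 \<otimes>\<^sub>k t h2 c) h" for h c
  proof -
    have "sw2 H (\<lambda>h1 h2. h2 \<otimes>\<^sub>k t h1 c) h = tlift (\<lambda>b h. h \<otimes>\<^sub>k b) (?i h \<cdot>\<^bsub>C\<^esub> ?j c)"
      by (simp add: hc tlift_sw2 tlift_tens lin)
    also have "\<dots> = tlift (\<lambda>u v. projH u \<otimes>\<^sub>k projA v) (cmul C (?i h \<cdot>\<^bsub>C\<^esub> ?j c))"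
      by (simp add: sel tlift_cmul_proj)
    also have "\<dots> = sw2 H (\<lambda>h1 h2. sw2 A (\<lambda>b1 b2. cunt A b1 *s (h1 \<otimes>\<^sub>k t h2 b2)) c) h"
      by (simp add: cmulC cmul_i cmul_j klinear_sw2_commute[of "\<lambda>S. tensor_mul C C S T" for T]
          klinear_sw2_commute[of "tensor_mul C C T" for T] tlift_sw2 tlift_tens lin
          tensor_mul_tens[OF algC algC] H_hc A_hc) (rule sw2_swap)
    also have "\<dots> = sw2 H (\<lambda>h1 h2. h1 \<otimes>\<^sub>k t h2 c) h"
      by (simp add: counit_sumA lin)
    finally show ?thesis .
  qed
  have proj_hk: "tlift \<phi> (cmul C (?i h \<cdot>\<^bsub>C\<^esub> ?i k)) = sw2 H (\<lambda>h1 h2. sw2 H (\<lambda>k1 k2. \<phi> (?i h1 \<cdot>\<^bsub>C\<^esub> ?i k1) (?i h2 \<cdot>\<^bsub>C\<^esub> ?i k2)) k) h"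
    if "kbilinear \<phi>" for \<phi> :: "_ \<Rightarrow> _ \<Rightarrow> 'k ^ 'm::finite" and h k
    by (simp add: cmulC cmul_i klinear_sw2_commute[of "\<lambda>S. tensor_mul C C S T" for T]
          klinear_sw2_commute[of "tensor_mul C C T" for T] tlift_sw2 tlift_tens lin
          tensor_mul_tens[OF algC algC] that) (rule sw2_swap)
  have cocentral_f: "sw2 H (\<lambda>h1 h2. sw2 H (\<lambda>k1 k2. (h2 \<cdot>\<^sub>H k2) \<otimes>\<^sub>k f h1 k1) k) h
      = sw2 H (\<lambda>h1 h2. sw2 H (\<lambda>k1 k2. (h1 \<cdot>\<^sub>H k1) \<otimes>\<^sub>k f h2 k2) k) h" for h k
  proof -
    have "sw2 H (\<lambda>h1 h2. sw2 H (\<lambda>k1 k2. (h2 \<cdot>\<^sub>H k2) \<otimes>\<^sub>k f h1 k1) k) h = tlift (\<lambda>b h. h \<otimes>\<^sub>k b) (?i h \<cdot>\<^bsub>C\<^esub> ?i k)"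
      by (simp add: hk tlift_sw2 tlift_tens lin)
    also have "\<dots> = tlift (\<lambda>u v. projH u \<otimes>\<^sub>k projA v) (cmul C (?i h \<cdot>\<^bsub>C\<^esub> ?i k))"
      by (simp add: sel tlift_cmul_proj)
    finally show ?thesis by (simp add: proj_hk lin H_hk A_hk)
  qed
  have cmul_f: "cmul A (f h k) = sw2 H (\<lambda>h1 h2. sw2 H (\<lambda>k1 k2. f h1 k1 \<otimes>\<^sub>k f h2 k2) k) h" for h k
  proof -
    have "cmul A (f h k) = tlift (\<lambda>u v. projA u \<otimes>\<^sub>k projA v) (cmul C (?i h \<cdot>\<^bsub>C\<^esub> ?i k))"
      by (simp add: sel(3) tlift_cmul_proj A_hk)
    then show ?thesis by (simp add: proj_hk lin A_hk)
  qed

  \<comment> \<open>Since \<open>\<Delta> x\<close> and \<open>\<Delta>(gx)\<close> are not symmetric, cocentrality forces the action to be trivial.\<close>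
  have tx: "t x c = 0" "t g c = c" for c
    using arg_cong[OF cocentral_t[of c x], of "contract c1"] arg_cong[OF cocentral_t[of c x], of "contract cx"]
    by (simp_all add: sw2H lin t_one coord_contract)
  have tw: "t w c = 0" for c
    using arg_cong[OF cocentral_t[of c w], of "contract c1"]
    by (simp add: sw2H lin t_one tx coord_contract)
  have t_act: "t h c = act h c" for h c
    by (rule H_ext[of "\<lambda>h. t h c" "\<lambda>h. act h c"], (intro lin)+) (simp_all add: act_def t_one tx tw)
  then show "t = act" by blast

  \<comment> \<open>Comparing coefficients in the cocentrality condition gives the values at the pairs with \<open>g\<close>.\<close>
  have fgx: "f g g = \<one>\<^sub>A" "f g x = 0"
    using arg_cong[OF cocentral_f[of x g], of "contract cw"] arg_cong[OF cocentral_f[of x g], of "contract cg"]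
    by (simp_all add: sw2H lin f1 f2 coord_contract)
  have fxg: "f x g = 0"
    using arg_cong[OF cocentral_f[of g x], of "contract cg"]
    by (simp add: sw2H lin f1 f2 coord_contract)
  have fgw: "f g w = 0"
    using arg_cong[OF cocentral_f[of w g], of "contract cg"]
    by (simp add: sw2H lin f1 f2 coord_contract)
  have fwg: "f w g = 0"
    using arg_cong[OF cocentral_f[of g w], of "contract c1"]
    by (simp add: sw2H lin f1 f2 coord_contract)
  define v where "v = f x x"
  note fs = f1 f2 fgx fxg fgw fwg tx tw t_one v_def[symmetric]
  have "cmul A v = v \<otimes>\<^sub>k \<one>\<^sub>A + \<one>\<^sub>A \<otimes>\<^sub>k v"
    unfolding v_def cmul_f by (simp add: sw2H lin fs)
  then have v: "v = cy 1 v *s y" by (rule primitive_A)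
  note ms = mulC sw2H lin fs
  \<comment> \<open>Since \<open>1 # gx = GX\<close>, associativity expresses the remaining values through \<open>X\<^sup>2 = f(x, x) # 1\<close>.\<close>
  have GX: "?i g \<cdot>\<^bsub>C\<^esub> ?i x = ?i w" and XG: "?i x \<cdot>\<^bsub>C\<^esub> ?i g = - ?i w" and XX: "?i x \<cdot>\<^bsub>C\<^esub> ?i x = ?j v"
    by (simp_all add: ms)
  have fwx: "f w x = v"
  proof -
    have "projA (?i w \<cdot>\<^bsub>C\<^esub> ?i x) = projA (?i g \<cdot>\<^bsub>C\<^esub> ?j v)"
      using assocC[of "?i g" "?i x" "?i x"] by (simp only: GX XX)
    then show ?thesis by (simp add: A_hk A_hc tx)
  qed
  have xw: "?i x \<cdot>\<^bsub>C\<^esub> ?i w = - (v \<otimes>\<^sub>k g)"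
  proof -
    have "?i x \<cdot>\<^bsub>C\<^esub> ?i w = - (?i w \<cdot>\<^bsub>C\<^esub> ?i x)"
      using assocC[of "?i x" "?i g" "?i x"] by (simp add: GX XG algebra_mul_simps[OF algC])
    also have "?i w \<cdot>\<^bsub>C\<^esub> ?i x = v \<otimes>\<^sub>k g" by (simp add: ms fwx)
    finally show ?thesis .
  qed
  have fxw: "f x w = - v" using A_hk[of x w] by (simp add: xw klinear_uminus lin)
  have fww: "f w w = - v"
  proof -
    have "?i w \<cdot>\<^bsub>C\<^esub> ?i w = ?i g \<cdot>\<^bsub>C\<^esub> (- (v \<otimes>\<^sub>k g))"
      using assocC[of "?i g" "?i x" "?i w"] by (simp add: GX xw)
    also have "\<dots> = - ?j v" by (simp add: algebra_mul_simps[OF algC]) (simp add: ms)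
    finally show ?thesis using A_hk[of w w] by (simp add: klinear_uminus lin)
  qed
  have "f h k = cocycle (cy 1 v) h k" for h k
    by (rule H_ext2[of f "cocycle (cy 1 v)"], (intro lin)+)
      (use v in \<open>auto simp: fs fwx fxw fww cocycle_def sig_def simp del: One_nat_def\<close>)
  then show "\<exists>a. f = cocycle a" by blast
qed

lemma CS_eq: "CS A H = range (\<lambda>a. (act, cocycle a))"
  using crossed_system_classification B_in_CS by force

lemma cocycle_inj: "cocycle a = cocycle b \<Longrightarrow> a = b"
proof -
  assume "cocycle a = cocycle b"
  then have "cy 1 (cocycle a x x) = cy 1 (cocycle b x x)" by simp
  then show "a = b" by (simp add: cocycle_def sig_def cy_y cy_unit del: One_nat_def)
qed

end

section \<open>Isomorphisms of Hopf algebras\<close>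

lemma coalgebra_map_tlift: "coalgebra_map B C F \<Longrightarrow> cmul C (F b) = tlift (\<lambda>v w. F v \<otimes>\<^sub>k F w) (cmul B b)"
  by (auto simp: coalgebra_map_def sw2_def)

lemma hopf_iso_comp:
  assumes "hopf_iso B C F" "hopf_iso C D G"
  shows "hopf_iso B D (G \<circ> F)"
proof -
  have l: "klinear F" "klinear G"
    using assms by (auto simp: hopf_iso_def hopf_hom_def coalgebra_map_def)
  note [lin] = klinear_compose[OF l(1)] klinear_compose[OF l(2)]
  have F: "cmul C (F b) = sw2 B (\<lambda>v w. F v \<otimes>\<^sub>k F w) b" for b
    using assms by (auto simp: hopf_iso_def hopf_hom_def coalgebra_map_def)
  have G: "cmul D (G b) = tlift (\<lambda>v w. G v \<otimes>\<^sub>k G w) (cmul C b)" for b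
    using assms coalgebra_map_tlift by (auto simp: hopf_iso_def hopf_hom_def)
  have "cmul D (G (F b)) = sw2 B (\<lambda>v w. G (F v) \<otimes>\<^sub>k G (F w)) b" for b
    by (simp add: G F tlift_sw2 tlift_tens lin)
  moreover have "klinear (G \<circ> F)" using klinear_compose[OF l(2,1)] by (simp add: o_def)
  moreover have "bij (G \<circ> F)" using assms by (auto simp: hopf_iso_def intro: bij_comp)
  ultimately show ?thesis
    using assms by (auto simp: hopf_iso_def hopf_hom_def coalgebra_map_def)
qed

text \<open>
  The inverse respects the comultiplication because \<open>\<Delta>(F b) = (F \<otimes> F)(\<Delta> b)\<close> can be solved for \<open>\<Delta> b\<close>.
\<close>

lemma hopf_iso_inv:
  assumes "hopf_iso B C F"
  shows "hopf_iso C B (inv_into UNIV F)"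
proof -
  have l: "klinear F" and b: "bij F"
    using assms by (auto simp: hopf_iso_def hopf_hom_def coalgebra_map_def)
  have i: "inv_into UNIV F (F v) = v" "F (inv_into UNIV F w) = w" for v w
    using b by (auto simp: bij_is_inj bij_is_surj surj_f_inv_f)
  have e: "cunt C (F u) = cunt B u" and m: "F (u \<cdot>\<^bsub>B\<^esub> v) = F u \<cdot>\<^bsub>C\<^esub> F v" "F (unt B) = unt C" for u v
    using assms by (auto simp: hopf_iso_def hopf_hom_def coalgebra_map_def)
  have li: "klinear (inv_into UNIV F)"
    unfolding klinear_iff
  proof (intro conjI allI)
    fix u v c
    show "inv_into UNIV F (u + v) = inv_into UNIV F u + inv_into UNIV F v"
      using klinear_plus[OF l, of "inv_into UNIV F u" "inv_into UNIV F v"] i by metis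
    show "inv_into UNIV F (c *s v) = c *s inv_into UNIV F v"
      using klinear_smult[OF l, of c "inv_into UNIV F v"] i by metis
  qed
  note [lin] = klinear_compose[OF l] klinear_compose[OF li]
  have "cmul B (inv_into UNIV F c) = sw2 C (\<lambda>v w. inv_into UNIV F v \<otimes>\<^sub>k inv_into UNIV F w) c" for c
  proof -
    have "sw2 C (\<lambda>v w. inv_into UNIV F v \<otimes>\<^sub>k inv_into UNIV F w) (F (inv_into UNIV F c))
        = tlift (\<lambda>v w. inv_into UNIV F v \<otimes>\<^sub>k inv_into UNIV F w) (sw2 B (\<lambda>v w. F v \<otimes>\<^sub>k F w) (inv_into UNIV F c))"
      using assms unfolding sw2_def[of C] by (auto simp: hopf_iso_def hopf_hom_def coalgebra_map_def)
    also have "\<dots> = sw2 B (\<lambda>v w. v \<otimes>\<^sub>k w) (inv_into UNIV F c)"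
      by (simp add: tlift_sw2 tlift_tens lin i)
    also have "\<dots> = cmul B (inv_into UNIV F c)"
      unfolding sw2_def using tensor_expansion by metis
    finally show ?thesis by (simp add: i)
  qed
  moreover have "cunt B (inv_into UNIV F c) = cunt C c" for c
    using e[of "inv_into UNIV F c"] by (simp add: i)
  moreover have "inv_into UNIV F (c \<cdot>\<^bsub>C\<^esub> d) = inv_into UNIV F c \<cdot>\<^bsub>B\<^esub> inv_into UNIV F d" for c d
    using m(1)[of "inv_into UNIV F c" "inv_into UNIV F d"] i(1)[of "inv_into UNIV F c \<cdot>\<^bsub>B\<^esub> inv_into UNIV F d"]
    by (simp add: i(2))
  moreover have "inv_into UNIV F (unt C) = unt B"
    using i(1)[of "unt B"] by (simp add: m)
  ultimately show ?thesis
    using li b by (auto simp: hopf_iso_def hopf_hom_def coalgebra_map_def bij_imp_bij_inv)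
qed

lemma hopf_isomorphic_sym: "B \<cong>\<^sub>H C \<Longrightarrow> C \<cong>\<^sub>H B"
  unfolding hopf_isomorphic_def using hopf_iso_inv by blast

lemma hopf_isomorphic_trans: "B \<cong>\<^sub>H C \<Longrightarrow> C \<cong>\<^sub>H D \<Longrightarrow> B \<cong>\<^sub>H D"
  unfolding hopf_isomorphic_def using hopf_iso_comp by blast

lemma Aut_Hopf_cong:
  assumes "B \<cong>\<^sub>H C"
  shows "Aut_Hopf B \<cong> Aut_Hopf C"
proof -
  obtain \<Psi> where \<Psi>: "hopf_iso B C \<Psi>" using assms by (auto simp: hopf_isomorphic_def)
  note \<Psi>' = hopf_iso_inv[OF \<Psi>]
  have b: "bij \<Psi>" using \<Psi> by (simp add: hopf_iso_def)
  have i: "inv_into UNIV \<Psi> (\<Psi> v) = v" "\<Psi> (inv_into UNIV \<Psi> v') = v'" for v v'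
    using b by (auto simp: bij_is_inj bij_is_surj surj_f_inv_f)
  let ?h = "\<lambda>F. \<Psi> \<circ> F \<circ> inv_into UNIV \<Psi>"
  have "?h \<in> hom (Aut_Hopf B) (Aut_Hopf C)"
    by (rule homI) (auto simp: Aut_Hopf_def fun_eq_iff i intro: hopf_iso_comp \<Psi> \<Psi>')
  moreover have "bij_betw ?h (carrier (Aut_Hopf B)) (carrier (Aut_Hopf C))"
    by (rule bij_betw_byWitness[where f' = "\<lambda>F. inv_into UNIV \<Psi> \<circ> F \<circ> \<Psi>"])
      (auto simp: Aut_Hopf_def fun_eq_iff i intro: hopf_iso_comp \<Psi> \<Psi>')
  ultimately show ?thesis by (auto simp: is_iso_def iso_def)
qed

section \<open>Isomorphisms between the crossed products\<close>

context truncated_sweedler begin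

text \<open>
  The endomorphisms of \<open>A\<close> and \<open>H\<close> given by the degree in \<open>y\<close> and in \<open>x\<close>: they multiply \<open>y\<close> by \<open>\<beta>\<close>, and
  \<open>x\<close> by \<open>\<alpha>\<close>.
\<close>

definition rescale_A :: "'k \<Rightarrow> 'k ^ 'a \<Rightarrow> 'k ^ 'a" where
  "rescale_A \<beta> b = (\<Sum>n<p. (\<beta> ^ n * cy n b) *s ypow n)"

definition rescale_H :: "'k \<Rightarrow> 'k ^ 'h \<Rightarrow> 'k ^ 'h" where
  "rescale_H \<alpha> h = c1 h *s \<one>\<^sub>H + cg h *s g + (\<alpha> * cx h) *s x + (\<alpha> * cw h) *s w"

lemma rescale_A_linear [lin]: "klinear F \<Longrightarrow> klinear (\<lambda>v. rescale_A \<beta> (F v))"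
  unfolding rescale_A_def by (intro lin)

lemma rescale_H_linear [lin]: "klinear F \<Longrightarrow> klinear (\<lambda>v. rescale_H \<alpha> (F v))"
  unfolding rescale_H_def by (intro lin; assumption)

lemma rescale_A_ypow: "rescale_A \<beta> (ypow n) = \<beta> ^ n *s ypow n"
proof (cases "n < p")
  case True
  have "rescale_A \<beta> (ypow n) = (\<Sum>m<p. if m = n then \<beta> ^ m *s ypow m else 0)"
    unfolding rescale_A_def using True by (intro sum.cong refl) (simp add: cy_ypow)
  then show ?thesis using True by (simp add: sum.delta)
next
  case False
  then show ?thesis by (simp add: ypow_ge klinear_0 lin)
qed

lemma rescale_A_y: "rescale_A \<beta> y = \<beta> *s y" and rescale_A_unit: "rescale_A \<beta> \<one>\<^sub>A = \<one>\<^sub>A"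
  using rescale_A_ypow[of \<beta> 1] rescale_A_ypow[of \<beta> 0] by (simp_all add: ypow_1 ypow_0 del: One_nat_def)

lemma rescale_A_mul: "rescale_A \<beta> (b \<cdot>\<^sub>A c) = rescale_A \<beta> b \<cdot>\<^sub>A rescale_A \<beta> c"
proof -
  have *: "rescale_A \<beta> (ypow m \<cdot>\<^sub>A c) = rescale_A \<beta> (ypow m) \<cdot>\<^sub>A rescale_A \<beta> c" for m
    by (rule A_ext[of "\<lambda>c. rescale_A \<beta> (ypow m \<cdot>\<^sub>A c)" "\<lambda>c. rescale_A \<beta> (ypow m) \<cdot>\<^sub>A rescale_A \<beta> c"], (intro lin)+)
      (simp add: rescale_A_ypow ypow_add power_add mult.commute)
  show ?thesis
    by (rule A_ext[of "\<lambda>b. rescale_A \<beta> (b \<cdot>\<^sub>A c)" "\<lambda>b. rescale_A \<beta> b \<cdot>\<^sub>A rescale_A \<beta> c"], (intro lin)+) (rule *)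
qed

lemma rescale_A_cmul: "cmul A (rescale_A \<beta> b) = tlift (\<lambda>b c. rescale_A \<beta> b \<otimes>\<^sub>k rescale_A \<beta> c) (cmul A b)"
proof (rule A_ext[of "\<lambda>b. cmul A (rescale_A \<beta> b)"])
  let ?\<Phi> = "tlift (\<lambda>b c. rescale_A \<beta> b \<otimes>\<^sub>k rescale_A \<beta> c)"
  have *: "?\<Phi> (tensor_mul A A (y \<otimes>\<^sub>k \<one>\<^sub>A + \<one>\<^sub>A \<otimes>\<^sub>k y) T) = \<beta> *s tensor_mul A A (y \<otimes>\<^sub>k \<one>\<^sub>A + \<one>\<^sub>A \<otimes>\<^sub>k y) (?\<Phi> T)" for T
    by (rule tensor_ext[of "\<lambda>T. ?\<Phi> (tensor_mul A A (y \<otimes>\<^sub>k \<one>\<^sub>A + \<one>\<^sub>A \<otimes>\<^sub>k y) T)"], (intro lin)+)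
      (simp add: tensor_mul_simps tensor_mul_tens algA tlift_tens lin klinear_plus[OF tlift_linear[OF klinear_id]]
         rescale_A_mul rescale_A_y rescale_A_unit vec.scale_right_distrib)
  show "cmul A (rescale_A \<beta> (ypow n)) = ?\<Phi> (cmul A (ypow n))" for n
  proof (induction n)
    case 0
    show ?case by (simp add: ypow_0 rescale_A_unit tlift_tens lin)
  next
    case (Suc n)
    have "\<beta> ^ n *s cmul A (ypow n) = ?\<Phi> (cmul A (ypow n))" using Suc by (simp add: rescale_A_ypow)
    then have "?\<Phi> (cmul A (ypow (Suc n))) = \<beta> *s tensor_mul A A (cmul A y) (\<beta> ^ n *s cmul A (ypow n))"
      by (simp add: ypow_Suc cmulA_mul cmul_y *)
    also have "\<dots> = cmul A (rescale_A \<beta> (ypow (Suc n)))"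
      by (simp add: rescale_A_ypow tensor_mul_simps) (simp add: ypow_Suc cmulA_mul)
    finally show ?case ..
  qed
qed (intro lin)+

lemma rescale_A_cunt: "cunt A (rescale_A \<beta> b) = cunt A b"
  by (rule A_ext_functional[of "\<lambda>b. cunt A (rescale_A \<beta> b)"], (intro lin)+)
    (simp add: rescale_A_ypow, case_tac n, auto simp: ypow_0 ypow_Suc)

lemma rescale_H_basis [simp]: "rescale_H \<alpha> \<one>\<^sub>H = \<one>\<^sub>H" "rescale_H \<alpha> g = g" "rescale_H \<alpha> x = \<alpha> *s x" "rescale_H \<alpha> w = \<alpha> *s w"
  by (simp_all add: rescale_H_def)

lemma rescale_H_coords: "c1 (rescale_H \<alpha> h) = c1 h" "cg (rescale_H \<alpha> h) = cg h" "cx (rescale_H \<alpha> h) = \<alpha> * cx h" "cw (rescale_H \<alpha> h) = \<alpha> * cw h"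
  by (simp_all add: rescale_H_def)

lemma rescale_H_mul: "rescale_H \<alpha> (h \<cdot>\<^sub>H k) = rescale_H \<alpha> h \<cdot>\<^sub>H rescale_H \<alpha> k"
  by (rule H_ext2[of "\<lambda>h k. rescale_H \<alpha> (h \<cdot>\<^sub>H k)"], (intro lin)+)
     (auto simp: klinear_uminus lin klinear_0)

text \<open>
  The operation \<open>\<diamondop>\<close> is the coefficient of \<open>x\<^sup>2\<close>, so it lowers the degree in \<open>x\<close> by two.
\<close>

lemma rescale_H_circ: "rescale_H \<alpha> h \<diamondop> rescale_H \<alpha> k = \<alpha>\<^sup>2 *s rescale_H \<alpha> (h \<diamondop> k)"
  by (rule coord_eqI) (simp_all add: rescale_H_coords circ_def algebra_simps power2_eq_square)

lemma rescale_H_cmul: "cmul H (rescale_H \<alpha> h) = tlift (\<lambda>h k. rescale_H \<alpha> h \<otimes>\<^sub>k rescale_H \<alpha> k) (cmul H h)"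
  by (rule H_ext[of "\<lambda>h. cmul H (rescale_H \<alpha> h)"], (intro lin)+)
    (simp_all add: cmulH_table tlift_tens lin klinear_plus[OF tlift_linear[OF klinear_id]] vec.scale_right_distrib)

lemma rescale_H_cunt: "\<epsilon> (rescale_H \<alpha> h) = \<epsilon> h"
  by (rule H_ext_functional[of "\<lambda>h. \<epsilon> (rescale_H \<alpha> h)"], (intro lin)+) simp_all

definition rescale :: "'k \<Rightarrow> 'k \<Rightarrow> 'k ^ ('a \<times> 'h) \<Rightarrow> 'k ^ ('a \<times> 'h)" where
  "rescale \<beta> \<alpha> = tlift (\<lambda>b h. rescale_A \<beta> b \<otimes>\<^sub>k rescale_H \<alpha> h)"

lemma rescale_linear [lin]: "klinear F \<Longrightarrow> klinear (\<lambda>v. rescale \<beta> \<alpha> (F v))"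
  unfolding rescale_def by (intro lin)

lemma rescale_tens: "rescale \<beta> \<alpha> (b \<otimes>\<^sub>k h) = rescale_A \<beta> b \<otimes>\<^sub>k rescale_H \<alpha> h"
  by (simp add: rescale_def tlift_tens lin)

lemma rescale_comp: "rescale \<beta> \<alpha> \<circ> rescale \<beta>' \<alpha>' = rescale (\<beta> * \<beta>') (\<alpha> * \<alpha>')"
proof
  fix T
  have p: "rescale_A \<beta> (rescale_A \<beta>' b) = rescale_A (\<beta> * \<beta>') b" for b
    by (rule A_ext[of "\<lambda>b. rescale_A \<beta> (rescale_A \<beta>' b)"], (intro lin)+)
      (simp add: rescale_A_ypow klinear_smult[OF rescale_A_linear[OF klinear_id]] power_mult_distrib mult.commute)
  have q: "rescale_H \<alpha> (rescale_H \<alpha>' h) = rescale_H (\<alpha> * \<alpha>') h" for h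
    by (rule coord_eqI) (simp_all add: rescale_H_coords)
  have "rescale \<beta> \<alpha> (rescale \<beta>' \<alpha>' T) = rescale (\<beta> * \<beta>') (\<alpha> * \<alpha>') T"
    by (rule tensor_ext[of "\<lambda>T. rescale \<beta> \<alpha> (rescale \<beta>' \<alpha>' T)"], (intro lin)+) (simp add: rescale_tens p q)
  then show "(rescale \<beta> \<alpha> \<circ> rescale \<beta>' \<alpha>') T = rescale (\<beta> * \<beta>') (\<alpha> * \<alpha>') T" by simp
qed

lemma rescale_rescale: "rescale \<beta> \<alpha> (rescale \<beta>' \<alpha>' T) = rescale (\<beta> * \<beta>') (\<alpha> * \<alpha>') T"
  by (simp flip: rescale_comp)

lemma rescale_1_1: "rescale 1 1 = id"
proof
  fix T
  have p: "rescale_A 1 b = b" for b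
    by (rule A_ext[of "\<lambda>b. rescale_A 1 b"], (intro lin)+) (simp add: rescale_A_ypow)
  have q: "rescale_H 1 h = h" for h
    by (rule coord_eqI) (simp_all add: rescale_H_coords)
  show "rescale 1 1 T = id T"
    by (rule tensor_ext[of "rescale 1 1" id]) (auto simp: rescale_tens p q id_def intro!: lin)
qed

lemma rescale_hopf_iso:
  assumes "\<beta> \<noteq> 0" "\<alpha> \<noteq> 0" "\<beta> * a = a' * \<alpha>\<^sup>2"
  shows "hopf_iso (B a) (B a') (rescale \<beta> \<alpha>)"
proof -
  have "rescale (inverse \<beta>) (inverse \<alpha>) \<circ> rescale \<beta> \<alpha> = id" "rescale \<beta> \<alpha> \<circ> rescale (inverse \<beta>) (inverse \<alpha>) = id"
    using assms by (simp_all add: rescale_comp rescale_1_1)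
  then have "bij (rescale \<beta> \<alpha>)" by (rule o_bij)
  moreover have "rescale \<beta> \<alpha> (S \<cdot>\<^bsub>B a\<^esub> T) = rescale \<beta> \<alpha> S \<cdot>\<^bsub>B a'\<^esub> rescale \<beta> \<alpha> T" for S T
    by (rule tensor_ext2[of "\<lambda>S T. rescale \<beta> \<alpha> (S \<cdot>\<^bsub>B a\<^esub> T)"], (intro lin)+)
      (simp add: mulB rescale_tens rescale_A_mul rescale_H_mul rescale_A_y rescale_H_circ klinear_plus[OF rescale_linear[OF klinear_id]]
        klinear_smult[OF rescale_linear[OF klinear_id]] assms(3)[symmetric] mult.commute)
  moreover have "cmul (B a') (rescale \<beta> \<alpha> T) = sw2 (B a) (\<lambda>u v. rescale \<beta> \<alpha> u \<otimes>\<^sub>k rescale \<beta> \<alpha> v) T" for T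
  proof -
    have *: "shuffle (tlift (\<lambda>b c. rescale_A \<beta> b \<otimes>\<^sub>k rescale_A \<beta> c) S) (tlift (\<lambda>h k. rescale_H \<alpha> h \<otimes>\<^sub>k rescale_H \<alpha> k) P)
       = tlift (\<lambda>u v. rescale \<beta> \<alpha> u \<otimes>\<^sub>k rescale \<beta> \<alpha> v) (shuffle S P)" for S P
      by (rule tensor_ext[of "\<lambda>S. shuffle (tlift (\<lambda>b c. rescale_A \<beta> b \<otimes>\<^sub>k rescale_A \<beta> c) S) (tlift (\<lambda>h k. rescale_H \<alpha> h \<otimes>\<^sub>k rescale_H \<alpha> k) P)"],
          (intro lin)+, rule tensor_ext[of "\<lambda>P. shuffle (tlift (\<lambda>b c. rescale_A \<beta> b \<otimes>\<^sub>k rescale_A \<beta> c) S) (tlift (\<lambda>h k. rescale_H \<alpha> h \<otimes>\<^sub>k rescale_H \<alpha> k) P)" for S],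
          (intro lin)+) (simp add: tlift_tens lin shuffle_simps rescale_tens)
    show ?thesis unfolding sw2_def B_sel
      by (rule tensor_ext[of "\<lambda>T. tensor_cmul A H (rescale \<beta> \<alpha> T)"], (intro lin)+)
        (simp add: rescale_tens tensor_cmul_shuffle rescale_A_cmul rescale_H_cmul *)
  qed
  moreover have "cunt (B a') (rescale \<beta> \<alpha> T) = cunt (B a) T" for T
    unfolding B_sel
    by (rule tensor_ext_functional[of "\<lambda>T. tensor_cunt A H (rescale \<beta> \<alpha> T)"], (intro lin)+)
      (simp add: rescale_tens tensor_cunt_tens[OF coalgA coalgH] rescale_A_cunt rescale_H_cunt)
  ultimately show ?thesis
    unfolding hopf_iso_def hopf_hom_def coalgebra_map_def
    using rescale_linear[OF klinear_id, of \<beta> \<alpha>] by (simp add: B_sel(2) rescale_tens rescale_A_unit)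
qed

lemma cmulH_expansion:
  "cmul H h = c1 h *s (\<one>\<^sub>H \<otimes>\<^sub>k \<one>\<^sub>H) + cg h *s (g \<otimes>\<^sub>k g) + cx h *s (x \<otimes>\<^sub>k \<one>\<^sub>H + g \<otimes>\<^sub>k x) + cw h *s (w \<otimes>\<^sub>k g + \<one>\<^sub>H \<otimes>\<^sub>k w)"
  by (rule H_ext[of "cmul H"], (intro lin)+) (simp_all add: cmulH_table)

lemma contract_scale: "kfunctional s \<Longrightarrow> contract s (r *s T) = r *s contract s T"
  using klinear_smult[OF tlift_linear[OF klinear_id]] by (simp add: contract_def)

text \<open>
  These four contractions are the rows of the comultiplication in the basis \<open>1\<close>, \<open>g\<close>, \<open>x\<close>, \<open>gx\<close>.
  Comparing them with the contractions of \<open>h \<otimes> h\<close>, \<open>h \<otimes> 1 + 1 \<otimes> h\<close> or \<open>h \<otimes> 1 + g \<otimes> h\<close> determines the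
  group-like, primitive and skew primitive elements of \<open>H\<close>.
\<close>

lemma contract_cmulH:
  "contract c1 (cmul H h) = c1 h *s \<one>\<^sub>H + cw h *s w" "contract cg (cmul H h) = cg h *s g + cx h *s x"
  "contract cx (cmul H h) = cx h *s \<one>\<^sub>H" "contract cw (cmul H h) = cw h *s g"
  by (simp_all add: cmulH_expansion coord_contract coord_functional[THEN contract_scale] algebra_simps)

lemma H_basis_distinct: "g \<noteq> \<one>\<^sub>H" using coord_val(1,5) by force

lemma grouplike_H:
  assumes "cmul H h = h \<otimes>\<^sub>k h" "\<epsilon> h = 1"
  shows "h = \<one>\<^sub>H \<or> h = g"
proof -
  have c: "c1 h *s \<one>\<^sub>H + cw h *s w = c1 h *s h" "cg h *s g + cx h *s x = cg h *s h"
    "cx h *s h = cx h *s \<one>\<^sub>H" "cw h *s h = cw h *s g"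
    using contract_cmulH[of h] by (simp_all add: assms coord_contract)
  have x: "cx h = 0" using arg_cong[OF c(3), of cx] by simp
  have w: "cw h = 0" using arg_cong[OF c(4), of cw] by simp
  have "c1 h = 0 \<or> h = \<one>\<^sub>H" "cg h = 0 \<or> h = g"
    using c x w by (auto simp: vec.scale_cancel_left)
  moreover have "c1 h \<noteq> 0 \<or> cg h \<noteq> 0"
    using h_expansion[of h] x w assms(2) by auto
  ultimately show ?thesis by blast
qed

lemma primitive_H:
  assumes "cmul H h = h \<otimes>\<^sub>k \<one>\<^sub>H + \<one>\<^sub>H \<otimes>\<^sub>k h"
  shows "h = 0"
proof -
  have "cw h *s \<one>\<^sub>H = cw h *s g" "c1 h *s \<one>\<^sub>H + cw h *s w = c1 h *s \<one>\<^sub>H + h"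
    using contract_cmulH[of h] by (simp_all add: assms coord_contract)
  then show ?thesis using arg_cong[of "cw h *s \<one>\<^sub>H" "cw h *s g" cg] by simp
qed

lemma skew_primitive_H:
  assumes "cmul H h = h \<otimes>\<^sub>k \<one>\<^sub>H + g \<otimes>\<^sub>k h"
  shows "h = cg h *s (g - \<one>\<^sub>H) + cx h *s x"
proof -
  have "cg h *s g + cx h *s x = cg h *s \<one>\<^sub>H + h"
    using contract_cmulH[of h] by (simp add: assms coord_contract)
  then show ?thesis by (simp add: vec.scale_right_diff_distrib algebra_simps)
qed

abbreviation "X \<equiv> \<one>\<^sub>A \<otimes>\<^sub>k x"
abbreviation "G \<equiv> \<one>\<^sub>A \<otimes>\<^sub>k g"
abbreviation "Y \<equiv> y \<otimes>\<^sub>k \<one>\<^sub>H"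

lemma B_relations:
  "G \<cdot>\<^bsub>B a\<^esub> G = \<one>\<^sub>A \<otimes>\<^sub>k \<one>\<^sub>H" "X \<cdot>\<^bsub>B a\<^esub> G = - (G \<cdot>\<^bsub>B a\<^esub> X)" "X \<cdot>\<^bsub>B a\<^esub> X = a *s Y"
  "G \<cdot>\<^bsub>B a\<^esub> X = \<one>\<^sub>A \<otimes>\<^sub>k w" "(b \<otimes>\<^sub>k \<one>\<^sub>H) \<cdot>\<^bsub>B a\<^esub> (c \<otimes>\<^sub>k h) = (b \<cdot>\<^sub>A c) \<otimes>\<^sub>k h"
  by (simp_all add: mulB circ_def)

lemma B_cmul_generators:
  "cmul (B a) G = G \<otimes>\<^sub>k G" "cmul (B a) X = X \<otimes>\<^sub>k unt (B a) + G \<otimes>\<^sub>k X"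
  "cmul (B a) Y = Y \<otimes>\<^sub>k unt (B a) + unt (B a) \<otimes>\<^sub>k Y"
  by (simp_all add: B_sel tensor_cmul_shuffle cmulH_table cmul_y shuffle_simps)

text \<open>
  Contracting \<open>\<Delta> u = u \<otimes> 1 + (1 \<otimes> h) \<otimes> u\<close> with the counits of the two inner factors gives \<open>u\<close> on the left
  and splits the right-hand side into a part from \<open>A\<close>, which is primitive, and a part from \<open>H\<close>.
\<close>

lemma skew_primitive_tensor:
  assumes "tensor_cmul A H u = u \<otimes>\<^sub>k (\<one>\<^sub>A \<otimes>\<^sub>k \<one>\<^sub>H) + (\<one>\<^sub>A \<otimes>\<^sub>k h) \<otimes>\<^sub>k u" "\<epsilon> h = 1"
  shows "u = (cy 1 (projA u) *s y) \<otimes>\<^sub>k \<one>\<^sub>H + \<one>\<^sub>A \<otimes>\<^sub>k projH u"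
    "cmul H (projH u) = projH u \<otimes>\<^sub>k \<one>\<^sub>H + h \<otimes>\<^sub>k projH u"
proof -
  note tl = klinear_plus[OF tlift_linear[OF klinear_id]] tlift_tens lin assms
  have "cmul A (projA u) = projA u \<otimes>\<^sub>k \<one>\<^sub>A + \<one>\<^sub>A \<otimes>\<^sub>k projA u"
    using tlift_cmul_proj(3)[of u] by (simp add: tl)
  note pA = primitive_A[OF this]
  show "cmul H (projH u) = projH u \<otimes>\<^sub>k \<one>\<^sub>H + h \<otimes>\<^sub>k projH u"
    using tlift_cmul_proj(4)[of u] by (simp add: tl)
  have "u = projA u \<otimes>\<^sub>k \<one>\<^sub>H + \<one>\<^sub>A \<otimes>\<^sub>k projH u"
    using tlift_cmul_proj(2)[of u] by (simp add: tl)
  then show "u = (cy 1 (projA u) *s y) \<otimes>\<^sub>k \<one>\<^sub>H + \<one>\<^sub>A \<otimes>\<^sub>k projH u" using pA by simp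
qed

lemma two_nonzero: "(2 :: 'k) \<noteq> 0"
  using of_nat_nonzero[of 2] p3 by simp

text \<open>
  The image of \<open>G\<close> is group-like, that of \<open>Y\<close> primitive and that of \<open>X\<close> skew primitive. These
  elements are known, and the relations between \<open>G\<close>, \<open>X\<close> and \<open>Y\<close> restrict them further.
\<close>

lemma hopf_iso_classification:
  assumes F: "hopf_iso (B a) (B a') F"
  obtains \<beta> \<alpha> where "\<beta> \<noteq> 0" "\<alpha> \<noteq> 0" "\<beta> * a = a' * \<alpha>\<^sup>2" "F = rescale \<beta> \<alpha>"
proof -
  have l: "klinear F" and Fm: "F (S \<cdot>\<^bsub>B a\<^esub> T) = F S \<cdot>\<^bsub>B a'\<^esub> F T" and F1: "F (\<one>\<^sub>A \<otimes>\<^sub>k \<one>\<^sub>H) = \<one>\<^sub>A \<otimes>\<^sub>k \<one>\<^sub>H"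
    and Fc: "tensor_cmul A H (F S) = tlift (\<lambda>u v. F u \<otimes>\<^sub>k F v) (tensor_cmul A H S)"
    and Fe: "tensor_cunt A H (F S) = tensor_cunt A H S"
    and inj: "inj F" for S T
    using F by (auto simp: hopf_iso_def hopf_hom_def coalgebra_map_def B_sel sw2_def bij_is_inj)
  note [lin] = klinear_compose[OF l]
  note ls = klinear_smult[OF l] klinear_plus[OF l] klinear_uminus[OF l]
  note tl = klinear_plus[OF tlift_linear[OF klinear_id]] tlift_tens lin
  note ten = B_cmul_generators[unfolded B_sel]
  note mB = algebra_mul_simps[OF B_algebra]

  have "tensor_cmul A H (F G) = F G \<otimes>\<^sub>k F G" by (simp add: Fc ten tl)
  then have "F G = projA (F G) \<otimes>\<^sub>k projH (F G)"
    "cmul A (projA (F G)) = projA (F G) \<otimes>\<^sub>k projA (F G)"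
    "cmul H (projH (F G)) = projH (F G) \<otimes>\<^sub>k projH (F G)"
    using tlift_cmul_proj(2,3,4)[of "F G"] by (simp_all add: tl)
  moreover have "tensor_cunt A H (F G) = 1" by (simp add: Fe tensor_cunt_tens[OF coalgA coalgH])
  ultimately have "F G = \<one>\<^sub>A \<otimes>\<^sub>k \<one>\<^sub>H \<or> F G = G"
    using grouplike_A[of "projA (F G)"] grouplike_H[of "projH (F G)"] by (auto simp: cunt_proj)
  moreover have "F G \<noteq> \<one>\<^sub>A \<otimes>\<^sub>k \<one>\<^sub>H"
  proof
    assume "F G = \<one>\<^sub>A \<otimes>\<^sub>k \<one>\<^sub>H"
    then have "G = \<one>\<^sub>A \<otimes>\<^sub>k \<one>\<^sub>H" using F1 inj by (metis injD)
    then have "projH G = projH (\<one>\<^sub>A \<otimes>\<^sub>k \<one>\<^sub>H)" by simp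
    then show False using H_basis_distinct by simp
  qed
  ultimately have FG: "F G = G" by blast

  define \<beta> where "\<beta> = cy 1 (projA (F Y))"
  have "tensor_cmul A H (F Y) = F Y \<otimes>\<^sub>k (\<one>\<^sub>A \<otimes>\<^sub>k \<one>\<^sub>H) + (\<one>\<^sub>A \<otimes>\<^sub>k \<one>\<^sub>H) \<otimes>\<^sub>k F Y"
    by (simp add: Fc ten tl F1)
  note sY = skew_primitive_tensor[OF this]
  have FY: "F Y = \<beta> *s Y"
    using sY(1) primitive_H[OF sY(2)] by (simp add: \<beta>_def)

  define \<alpha> where "\<alpha> = cx (projH (F X))"
  define b where "b = cy 1 (projA (F X))"
  define c where "c = cg (projH (F X))"
  have "tensor_cmul A H (F X) = F X \<otimes>\<^sub>k (\<one>\<^sub>A \<otimes>\<^sub>k \<one>\<^sub>H) + G \<otimes>\<^sub>k F X"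
    by (simp add: Fc ten tl F1 FG)
  note sX = skew_primitive_tensor[OF this]
  have "F X = b *s Y + \<one>\<^sub>A \<otimes>\<^sub>k projH (F X)"
    using sX(1) by (simp add: b_def)
  also have "projH (F X) = c *s (g - \<one>\<^sub>H) + \<alpha> *s x"
    using skew_primitive_H[OF sX(2)] by (simp add: c_def \<alpha>_def)
  finally have FX: "F X = b *s Y + \<one>\<^sub>A \<otimes>\<^sub>k (c *s (g - \<one>\<^sub>H) + \<alpha> *s x)" .
  \<comment> \<open>The relation \<open>XG = -GX\<close> removes the multiples of \<open>Y\<close> and of \<open>1 \<otimes> (g - 1)\<close>, which do not
    anticommute with \<open>G\<close>; this uses that \<open>2\<close> is invertible.\<close>
  have "F X \<cdot>\<^bsub>B a'\<^esub> G + G \<cdot>\<^bsub>B a'\<^esub> F X = F (X \<cdot>\<^bsub>B a\<^esub> G) + F (G \<cdot>\<^bsub>B a\<^esub> X)"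
    by (simp only: Fm FG)
  also have "\<dots> = 0" by (simp only: B_relations(2) ls) simp
  finally have "F X \<cdot>\<^bsub>B a'\<^esub> G + G \<cdot>\<^bsub>B a'\<^esub> F X = 0" .
  then have z: "(2 * b) *s (y \<otimes>\<^sub>k g) + (2 * c) *s (\<one>\<^sub>A \<otimes>\<^sub>k (\<one>\<^sub>H - g)) = 0"
    by (simp add: FX mB) (simp add: mulB circ_def vec_eq_iff algebra_simps)
  have "cy 1 (projA ((2 * b) *s (y \<otimes>\<^sub>k g) + (2 * c) *s (\<one>\<^sub>A \<otimes>\<^sub>k (\<one>\<^sub>H - g)))) = 0"
    unfolding z by (simp add: klinear_0 lin)
  then have b: "b = 0" using two_nonzero
    by (simp add: klinear_plus klinear_smult klinear_minus2 lin cy_y del: One_nat_def)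
  have "c1 (projH ((2 * b) *s (y \<otimes>\<^sub>k g) + (2 * c) *s (\<one>\<^sub>A \<otimes>\<^sub>k (\<one>\<^sub>H - g)))) = 0"
    unfolding z by (simp add: klinear_0 lin)
  then have c: "c = 0" using two_nonzero by (simp add: klinear_plus klinear_smult klinear_minus2 lin)
  have FX: "F X = \<alpha> *s X" using FX b c by simp

  have nz: "X \<noteq> 0" "Y \<noteq> 0"
  proof -
    have "cx (projH X) \<noteq> 0" "cy 1 (projA Y) \<noteq> 0" by (simp_all add: cy_y del: One_nat_def)
    then show "X \<noteq> 0" "Y \<noteq> 0" by (auto simp: klinear_0 lin simp del: proj_tens)
  qed
  have n0: "F S \<noteq> 0" if "S \<noteq> 0" for S
    using that inj klinear_0[OF l] by (metis injD)
  have "\<alpha> \<noteq> 0" "\<beta> \<noteq> 0" using n0[OF nz(1)] n0[OF nz(2)] FX FY by auto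
  moreover have "\<beta> * a = a' * \<alpha>\<^sup>2"
  proof -
    have "F (X \<cdot>\<^bsub>B a\<^esub> X) = (\<beta> * a) *s Y" by (simp add: B_relations ls FY mult.commute)
    moreover have "F (X \<cdot>\<^bsub>B a\<^esub> X) = (a' * \<alpha>\<^sup>2) *s Y"
      by (simp only: Fm FX) (simp add: mB B_relations power2_eq_square mult.commute mult.left_commute)
    ultimately show ?thesis using nz(2) by (simp add: vec.scale_cancel_right)
  qed
  moreover have "F = rescale \<beta> \<alpha>"
  proof
    fix T
    have Fh: "F (\<one>\<^sub>A \<otimes>\<^sub>k h) = \<one>\<^sub>A \<otimes>\<^sub>k rescale_H \<alpha> h" for h
    proof (rule H_ext[of "\<lambda>h. F (\<one>\<^sub>A \<otimes>\<^sub>k h)"])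
      have "F (G \<cdot>\<^bsub>B a\<^esub> X) = G \<cdot>\<^bsub>B a'\<^esub> (\<alpha> *s X)" by (simp only: Fm FG FX)
      then show "F (\<one>\<^sub>A \<otimes>\<^sub>k w) = \<one>\<^sub>A \<otimes>\<^sub>k rescale_H \<alpha> w" by (simp add: B_relations mB)
    qed ((intro lin)+, simp_all add: F1 FG FX)
    have Fb: "F (b \<otimes>\<^sub>k \<one>\<^sub>H) = rescale_A \<beta> b \<otimes>\<^sub>k \<one>\<^sub>H" for b
    proof (rule A_ext[of "\<lambda>b. F (b \<otimes>\<^sub>k \<one>\<^sub>H)"])
      show "F (ypow n \<otimes>\<^sub>k \<one>\<^sub>H) = rescale_A \<beta> (ypow n) \<otimes>\<^sub>k \<one>\<^sub>H" for n
      proof (induction n)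
        case (Suc n)
        have "F (ypow (Suc n) \<otimes>\<^sub>k \<one>\<^sub>H) = F Y \<cdot>\<^bsub>B a'\<^esub> F (ypow n \<otimes>\<^sub>k \<one>\<^sub>H)"
          using Fm[of Y "ypow n \<otimes>\<^sub>k \<one>\<^sub>H"] by (simp add: B_relations ypow_Suc)
        also have "\<dots> = rescale_A \<beta> (ypow (Suc n)) \<otimes>\<^sub>k \<one>\<^sub>H"
          by (simp add: Suc FY mB B_relations ypow_Suc rescale_A_mul rescale_A_y)
        finally show ?case .
      qed (simp add: ypow_0 rescale_A_unit F1)
    qed (intro lin)+
    show "F T = rescale \<beta> \<alpha> T"
    proof (rule tensor_ext[OF l])
      fix b h
      have "F (b \<otimes>\<^sub>k h) = F ((b \<otimes>\<^sub>k \<one>\<^sub>H) \<cdot>\<^bsub>B a\<^esub> (\<one>\<^sub>A \<otimes>\<^sub>k h))" by (simp add: B_relations)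
      also have "\<dots> = rescale_A \<beta> b \<otimes>\<^sub>k rescale_H \<alpha> h" unfolding Fm Fh Fb by (simp add: B_relations)
      finally show "F (b \<otimes>\<^sub>k h) = rescale \<beta> \<alpha> (b \<otimes>\<^sub>k h)" by (simp add: rescale_tens)
    qed (intro lin)
  qed
  ultimately show thesis using that by blast
qed

lemma B_0: "B 0 = tensor_bialg A H"
proof -
  have "mul (B 0) S T = tensor_mul A H S T" for S T
    by (rule tensor_ext2[of "mul (B 0)"], (intro lin)+) (simp add: mulB tensor_mul_tens algA algH)
  then have "mul (B 0) = tensor_mul A H" by blast
  then show ?thesis by (simp add: B_def crossed_product_def tensor_bialg_def)
qed

lemma B_isomorphic:
  assumes "a \<noteq> 0" shows "B a \<cong>\<^sub>H B 1"
  using rescale_hopf_iso[of "inverse a" 1 a 1] assms by (auto simp: hopf_isomorphic_def)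

lemma B_0_not_isomorphic: "\<not> B 0 \<cong>\<^sub>H B 1"
  unfolding hopf_isomorphic_def by (auto elim!: hopf_iso_classification)

lemma rescale_params: "cy 1 (projA (rescale \<beta> \<alpha> Y)) = \<beta>" "cx (projH (rescale \<beta> \<alpha> X)) = \<alpha>"
  by (simp_all add: rescale_tens rescale_A_y rescale_A_unit cy_y proj_linear[OF klinear_id, THEN klinear_smult] del: One_nat_def)

text \<open>
  With \<open>a = a' = 0\<close> the condition \<open>\<beta>a = a'\<alpha>\<^sup>2\<close> is void.
\<close>

lemma Aut_B_0: "Aut_Hopf (B 0) \<cong> (units_group :: 'k monoid) \<times>\<times> (units_group :: 'k monoid)"
proof -
  have car: "carrier (Aut_Hopf (B 0)) = {rescale \<beta> \<alpha> | \<beta> \<alpha>. \<beta> \<noteq> 0 \<and> \<alpha> \<noteq> 0}"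
    by (auto simp: Aut_Hopf_def elim!: hopf_iso_classification intro!: rescale_hopf_iso)
  let ?h = "\<lambda>F. (cy 1 (projA (F Y)), cx (projH (F X)))"
  have "?h \<in> hom (Aut_Hopf (B 0)) ((units_group :: 'k monoid) \<times>\<times> (units_group :: 'k monoid))"
    by (rule homI, unfold car) (auto simp: rescale_params units_group_def DirProd_def Aut_Hopf_def rescale_rescale simp del: One_nat_def)
  moreover have "bij_betw ?h (carrier (Aut_Hopf (B 0))) (carrier ((units_group :: 'k monoid) \<times>\<times> (units_group :: 'k monoid)))"
    unfolding car
    by (rule bij_betw_byWitness[where f' = "\<lambda>(\<beta>, \<alpha>). rescale \<beta> \<alpha>"])
      (auto simp: rescale_params units_group_def simp del: One_nat_def)
  ultimately show ?thesis by (auto simp: is_iso_def iso_def)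
qed

text \<open>
  With \<open>a = a' = 1\<close> the condition reads \<open>\<beta> = \<alpha>\<^sup>2\<close>.
\<close>

lemma Aut_B_1: "Aut_Hopf (B 1) \<cong> (units_group :: 'k monoid)"
proof -
  have car: "carrier (Aut_Hopf (B 1)) = {rescale (\<alpha>\<^sup>2) \<alpha> | \<alpha>. \<alpha> \<noteq> 0}"
    by (auto simp: Aut_Hopf_def elim!: hopf_iso_classification intro!: rescale_hopf_iso)
  let ?h = "\<lambda>F. cx (projH (F X))"
  have "?h \<in> hom (Aut_Hopf (B 1)) (units_group :: 'k monoid)"
    by (rule homI, unfold car) (auto simp: rescale_params units_group_def Aut_Hopf_def rescale_rescale)
  moreover have "bij_betw ?h (carrier (Aut_Hopf (B 1))) (carrier (units_group :: 'k monoid))"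
    unfolding car
    by (rule bij_betw_byWitness[where f' = "\<lambda>\<alpha>. rescale (\<alpha>\<^sup>2) \<alpha>"]) (auto simp: rescale_params units_group_def)
  ultimately show ?thesis by (auto simp: is_iso_def iso_def)
qed

end

section \<open>Presentations\<close>

abbreviation free_mul :: "('x list \<Rightarrow>\<^sub>0 'k::field) \<Rightarrow> ('x list \<Rightarrow>\<^sub>0 'k) \<Rightarrow> ('x list \<Rightarrow>\<^sub>0 'k)" (infixl "\<star>" 70)
  where "P \<star> Q \<equiv> P \<otimes>\<^bsub>free_algebra\<^esub> Q"

lemma free_mul_def: "P \<star> Q = (\<Sum>u\<in>Poly_Mapping.keys P. \<Sum>v\<in>Poly_Mapping.keys Q.
       Poly_Mapping.single (u @ v) (Poly_Mapping.lookup P u * Poly_Mapping.lookup Q v))"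
  by (simp add: free_algebra_def)

lemma free_algebra_sel:
  "carrier free_algebra = UNIV" "\<one>\<^bsub>free_algebra\<^esub> = word []" "\<zero>\<^bsub>free_algebra\<^esub> = 0"
  "P \<oplus>\<^bsub>free_algebra\<^esub> Q = P + Q"
  by (simp_all add: free_algebra_def)

lemma free_add_induct [case_names zero add]:
  assumes "\<Phi> 0" "\<And>w c Q. \<Phi> Q \<Longrightarrow> \<Phi> (Q + Poly_Mapping.single w c)"
  shows "\<Phi> (P :: 'w \<Rightarrow>\<^sub>0 'k::field)"
proof (induction P rule: update_induct)
  case (update f a b)
  have "Poly_Mapping.update a b f = f + Poly_Mapping.single a b"
    using update(1) by (intro poly_mapping_eqI) (auto simp: lookup_update lookup_add lookup_single in_keys_iff when_def)
  then show ?case using assms(2)[OF update(3)] by simp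
qed (rule assms(1))

text \<open>
  The operations of the free algebra and evaluation are additive in each argument, so that their laws
  are checked on multiples of words.
\<close>

lemma free_additive_ext:
  fixes F :: "('w \<Rightarrow>\<^sub>0 'k::field) \<Rightarrow> 'z::ab_group_add"
  assumes "\<And>P Q. F (P + Q) = F P + F Q" "\<And>P Q. G (P + Q) = G P + G Q"
    and "\<And>w c. F (Poly_Mapping.single w c) = G (Poly_Mapping.single w c)"
  shows "F P = G P"
proof (induction P rule: free_add_induct)
  case zero
  show ?case using assms(1)[of 0 0] assms(2)[of 0 0] by simp
qed (simp add: assms)

lemma free_mul_add_left: "(P + P') \<star> Q = P \<star> Q + P' \<star> Q"
  unfolding free_mul_def
  by (rule setsum_keys_plus_distrib[where f = "\<lambda>u a. \<Sum>v\<in>Poly_Mapping.keys Q.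
       Poly_Mapping.single (u @ v) (a * Poly_Mapping.lookup Q v)"])
    (simp_all add: sum.distrib[symmetric] single_add[symmetric] distrib_right)

lemma free_mul_add_right: "P \<star> (Q + Q') = P \<star> Q + P \<star> Q'"
  unfolding free_mul_def sum.distrib[symmetric]
  by (intro sum.cong refl setsum_keys_plus_distrib[where f = "\<lambda>v b. Poly_Mapping.single (u @ v) (c * b)" for u c])
    (simp_all add: single_add[symmetric] distrib_left)

lemma free_mul_single:
  "Poly_Mapping.single u a \<star> Poly_Mapping.single v b = Poly_Mapping.single (u @ v) (a * b)"
  by (simp add: free_mul_def)

lemma free_mul_diff: "P \<star> (Q - Q') = P \<star> Q - P \<star> Q'"
  using free_mul_add_right[of P "Q - Q'" Q'] by simp

lemma free_mul_one: "word [] \<star> P = P" "P \<star> word [] = P"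
proof -
  show "word [] \<star> P = P"
    by (rule free_additive_ext[of "(\<star>) (word [])" "\<lambda>P. P"]) (auto simp: free_mul_add_right free_mul_single word_def)
  show "P \<star> word [] = P"
    by (rule free_additive_ext[of "\<lambda>P. P \<star> word []" "\<lambda>P. P"]) (auto simp: free_mul_add_left free_mul_single word_def)
qed

lemma free_mul_assoc: "P \<star> Q \<star> S = P \<star> (Q \<star> S)"
proof (rule free_additive_ext[of "\<lambda>P. P \<star> Q \<star> S" "\<lambda>P. P \<star> (Q \<star> S)"])
  fix u a
  show "Poly_Mapping.single u a \<star> Q \<star> S = Poly_Mapping.single u a \<star> (Q \<star> S)"
  proof (rule free_additive_ext[of "\<lambda>Q. Poly_Mapping.single u a \<star> Q \<star> S" "\<lambda>Q. Poly_Mapping.single u a \<star> (Q \<star> S)"])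
    fix v b
    show "Poly_Mapping.single u a \<star> Poly_Mapping.single v b \<star> S = Poly_Mapping.single u a \<star> (Poly_Mapping.single v b \<star> S)"
      by (rule free_additive_ext[of "\<lambda>S. Poly_Mapping.single u a \<star> Poly_Mapping.single v b \<star> S"
            "\<lambda>S. Poly_Mapping.single u a \<star> (Poly_Mapping.single v b \<star> S)"])
        (simp_all add: free_mul_add_right free_mul_single mult.assoc)
  qed (simp_all add: free_mul_add_left free_mul_add_right)
qed (simp_all add: free_mul_add_left)

lemma free_algebra_ring: "ring free_algebra"
proof (rule ringI)
  show "abelian_group free_algebra"
  proof (rule abelian_groupI)
    fix P show "\<exists>Q\<in>carrier free_algebra. Q \<oplus>\<^bsub>free_algebra\<^esub> P = \<zero>\<^bsub>free_algebra\<^esub>"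
      by (rule bexI[of _ "- P"]) (simp_all add: free_algebra_sel)
  qed (simp_all add: free_algebra_sel add_ac)
  show "monoid free_algebra"
    by (rule monoidI) (simp_all add: free_algebra_sel free_mul_assoc free_mul_one)
qed (simp_all add: free_algebra_sel free_mul_add_left free_mul_add_right)

lemma eval_free_add: "eval_free B \<rho> (P + Q) = eval_free B \<rho> P + eval_free B \<rho> Q"
  unfolding eval_free_def
  by (rule setsum_keys_plus_distrib[where f = "\<lambda>w c. c *s foldr (\<lambda>x b. \<rho> x \<cdot>\<^bsub>B\<^esub> b) w (unt B)"])
    (simp_all add: vec.scale_left_distrib)

lemma eval_free_single: "eval_free B \<rho> (Poly_Mapping.single w c) = c *s foldr (\<lambda>x b. \<rho> x \<cdot>\<^bsub>B\<^esub> b) w (unt B)"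
  by (simp add: eval_free_def)

lemma eval_free_zero: "eval_free B \<rho> 0 = 0"
  by (simp add: eval_free_def)

lemma eval_free_diff: "eval_free B \<rho> (P - Q) = eval_free B \<rho> P - eval_free B \<rho> Q"
  using eval_free_add[of B \<rho> "P - Q" Q] by simp

lemma eval_free_sum: "eval_free B \<rho> (\<Sum>i\<in>I. P i) = (\<Sum>i\<in>I. eval_free B \<rho> (P i))"
  by (induction I rule: infinite_finite_induct) (simp_all add: eval_free_zero eval_free_add)

lemma foldr_mul_append:
  assumes "algebra_axioms B"
  shows "foldr (\<lambda>x b. \<rho> x \<cdot>\<^bsub>B\<^esub> b) (u @ v) (unt B)
    = foldr (\<lambda>x b. \<rho> x \<cdot>\<^bsub>B\<^esub> b) u (unt B) \<cdot>\<^bsub>B\<^esub> foldr (\<lambda>x b. \<rho> x \<cdot>\<^bsub>B\<^esub> b) v (unt B)"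
proof -
  have "a \<cdot>\<^bsub>B\<^esub> b \<cdot>\<^bsub>B\<^esub> c = a \<cdot>\<^bsub>B\<^esub> (b \<cdot>\<^bsub>B\<^esub> c)" for a b c using assms by (auto simp: algebra_axioms_def)
  then show ?thesis by (induction u) (simp_all add: algebra_mul_simps[OF assms])
qed

lemma eval_free_mul:
  assumes B: "algebra_axioms B"
  shows "eval_free B \<rho> (P \<star> Q) = eval_free B \<rho> P \<cdot>\<^bsub>B\<^esub> eval_free B \<rho> Q"
proof (rule free_additive_ext[of "\<lambda>P. eval_free B \<rho> (P \<star> Q)" "\<lambda>P. eval_free B \<rho> P \<cdot>\<^bsub>B\<^esub> eval_free B \<rho> Q"])
  note s = eval_free_add eval_free_single free_mul_add_left free_mul_add_right free_mul_single
    algebra_mul_simps[OF B] foldr_mul_append[OF B]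
  fix u a
  show "eval_free B \<rho> (Poly_Mapping.single u a \<star> Q) = eval_free B \<rho> (Poly_Mapping.single u a) \<cdot>\<^bsub>B\<^esub> eval_free B \<rho> Q"
    by (rule free_additive_ext[of "\<lambda>Q. eval_free B \<rho> (Poly_Mapping.single u a \<star> Q)"
          "\<lambda>Q. eval_free B \<rho> (Poly_Mapping.single u a) \<cdot>\<^bsub>B\<^esub> eval_free B \<rho> Q"])
      (simp_all add: s mult.commute del: foldr_append)
qed (simp_all add: free_mul_add_left eval_free_add algebra_mul_simps[OF B])

lemma eval_free_kernel_ideal:
  fixes B :: "('k::field, 'i::finite) bialg" and \<rho> :: "'x \<Rightarrow> 'k ^ 'i"
  assumes "algebra_axioms B"
  shows "ideal {P. eval_free B \<rho> P = 0} free_algebra"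
proof (rule idealI[OF free_algebra_ring])
  interpret ring "free_algebra :: ('x list \<Rightarrow>\<^sub>0 'k) ring" by (rule free_algebra_ring)
  show "subgroup {P. eval_free B \<rho> P = 0} (add_monoid free_algebra)"
  proof (rule add.subgroupI)
    fix P assume P: "P \<in> {P. eval_free B \<rho> P = 0}"
    have "\<ominus>\<^bsub>free_algebra\<^esub> P = - P"
      using add.inv_equality[of "- P" P] by (simp add: free_algebra_sel a_inv_def)
    then show "\<ominus>\<^bsub>free_algebra\<^esub> P \<in> {P. eval_free B \<rho> P = 0}"
      using P eval_free_diff[of B \<rho> 0 P] by (simp add: eval_free_zero)
  next
    have "0 \<in> {P. eval_free B \<rho> P = 0}" by (simp add: eval_free_zero)
    then show "{P. eval_free B \<rho> P = 0} \<noteq> {}" by blast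
  qed (auto simp: free_algebra_sel eval_free_add)
qed (auto simp: eval_free_mul[OF assms] algebra_mul_simps[OF assms])

lemma presented_relations:
  assumes "presented_by B \<rho> R" "P \<in> R"
  shows "eval_free B \<rho> P = 0"
proof -
  have "P \<in> genideal free_algebra R" using assms(2) by (auto simp: genideal_def)
  then show ?thesis using assms(1) by (auto simp: presented_by_def)
qed

text \<open>
  Words reduce to normal forms modulo the relations. If the normal forms stay linearly independent
  in \<open>B\<close>, then nothing else becomes zero, so the relations present \<open>B\<close>.
\<close>

lemma presented_byI:
  fixes B :: "('k::field, 'i::finite) bialg" and R :: "('x list \<Rightarrow>\<^sub>0 'k) set"
  assumes B: "algebra_axioms B" and R: "\<And>P. P \<in> R \<Longrightarrow> eval_free B \<rho> P = 0" and "finite J"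
    and nf: "\<And>w. \<exists>i\<in>J. \<exists>c. word w - Poly_Mapping.single (nf i) c \<in> genideal free_algebra R"
    and indep: "\<And>d. (\<Sum>i\<in>J. d i *s eval_free B \<rho> (word (nf i))) = 0 \<Longrightarrow> \<forall>i\<in>J. d i = 0"
    and surj: "surj (eval_free B \<rho>)"
  shows "presented_by B \<rho> R"
proof -
  define I where "I = genideal free_algebra R"
  interpret ring "free_algebra :: ('x list \<Rightarrow>\<^sub>0 'k) ring" by (rule free_algebra_ring)
  have "ideal I free_algebra" unfolding I_def by (rule genideal_ideal) (simp add: free_algebra_sel)
  then interpret I: ideal I "free_algebra :: ('x list \<Rightarrow>\<^sub>0 'k) ring" .
  have I0: "0 \<in> I" using I.zero_closed by (simp add: free_algebra_sel)
  have Iadd: "P + Q \<in> I" if "P \<in> I" "Q \<in> I" for P Q using I.a_closed[OF that] by (simp add: free_algebra_sel)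
  have Imul: "S \<star> P \<in> I" if "P \<in> I" for P S using I.I_l_closed[OF that] by (simp add: free_algebra_sel)
  have sub: "I \<subseteq> {P. eval_free B \<rho> P = 0}"
    unfolding I_def genideal_def using eval_free_kernel_ideal[OF B] R by blast
  have reduce: "\<exists>d. P - (\<Sum>i\<in>J. Poly_Mapping.single (nf i) (d i)) \<in> I" for P
  proof (induction P rule: free_add_induct)
    case zero
    show ?case by (rule exI[of _ "\<lambda>i. 0"]) (simp add: I0)
  next
    case (add w c Q)
    then obtain d where d: "Q - (\<Sum>i\<in>J. Poly_Mapping.single (nf i) (d i)) \<in> I" by blast
    obtain j c' where j: "j \<in> J" "word w - Poly_Mapping.single (nf j) c' \<in> I"
      using nf[of w] by (auto simp: I_def)
    \<comment> \<open>The reduced form of the new word is absorbed into the coefficient of the normal form \<open>j\<close>.\<close>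
    let ?d = "\<lambda>i. d i + (if i = j then c * c' else 0)"
    have "(\<Sum>i\<in>J. Poly_Mapping.single (nf i) (?d i))
        = (\<Sum>i\<in>J. Poly_Mapping.single (nf i) (d i) + (if i = j then Poly_Mapping.single (nf j) (c * c') else 0))"
      by (intro sum.cong) (auto simp: single_add)
    also have "\<dots> = (\<Sum>i\<in>J. Poly_Mapping.single (nf i) (d i)) + Poly_Mapping.single (nf j) (c * c')"
      using j(1) \<open>finite J\<close> by (simp add: sum.distrib)
    finally have sum: "(\<Sum>i\<in>J. Poly_Mapping.single (nf i) (?d i)) = \<dots>" .
    have shift: "Poly_Mapping.single [] c \<star> (word w - Poly_Mapping.single (nf j) c')
        = Poly_Mapping.single w c - Poly_Mapping.single (nf j) (c * c')"
      by (simp add: free_mul_diff word_def free_mul_single)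
    have "Q + Poly_Mapping.single w c - (\<Sum>i\<in>J. Poly_Mapping.single (nf i) (?d i))
        = (Q - (\<Sum>i\<in>J. Poly_Mapping.single (nf i) (d i)))
          + Poly_Mapping.single [] c \<star> (word w - Poly_Mapping.single (nf j) c')"
      unfolding sum shift by simp
    also have "\<dots> \<in> I" by (rule Iadd[OF d Imul[OF j(2)]])
    finally show ?case by (rule exI[of _ ?d])
  qed
  have "P \<in> I" if "eval_free B \<rho> P = 0" for P
  proof -
    obtain d where d: "P - (\<Sum>i\<in>J. Poly_Mapping.single (nf i) (d i)) \<in> I" using reduce by blast
    then have "eval_free B \<rho> (P - (\<Sum>i\<in>J. Poly_Mapping.single (nf i) (d i))) = 0" using sub by blast
    then have "(\<Sum>i\<in>J. d i *s eval_free B \<rho> (word (nf i))) = 0"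
      using that by (simp add: eval_free_diff eval_free_sum eval_free_single word_def)
    then have "\<forall>i\<in>J. d i = 0" by (rule indep)
    then show "P \<in> I" using d by simp
  qed
  then show ?thesis using sub surj unfolding presented_by_def I_def by blast
qed

text \<open>
  The evaluation maps of both algebras have the same kernel, so evaluation in \<open>C\<close> factors through a
  bijection from \<open>B\<close>. The structure maps of the coalgebras are multiplicative, so that comparing them
  on generators suffices.
\<close>

lemma presented_hopf_isomorphic:
  fixes B :: "('k::field, 'i::finite) bialg" and C :: "('k, 'j::finite) bialg"
  assumes B: "bialgebra B" and C: "bialgebra C"
    and pB: "presented_by B \<rho> R" and pC: "presented_by C \<sigma> R"
    and gen_cmul: "\<And>F x. klinear F \<Longrightarrow> F (unt B) = unt C \<Longrightarrow> (\<And>z. F (\<rho> z) = \<sigma> z) \<Longrightarrow>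
      cmul C (\<sigma> x) = tlift (\<lambda>u v. F u \<otimes>\<^sub>k F v) (cmul B (\<rho> x))"
    and gen_cunt: "\<And>x. cunt C (\<sigma> x) = cunt B (\<rho> x)"
  shows "B \<cong>\<^sub>H C"
proof -
  have aB: "algebra_axioms B" and aC: "algebra_axioms C" and cB: "coalgebra_axioms B" and cC: "coalgebra_axioms C"
    and mB: "cmul B (a \<cdot>\<^bsub>B\<^esub> b) = tensor_mul B B (cmul B a) (cmul B b)" "cunt B (a \<cdot>\<^bsub>B\<^esub> b) = cunt B a * cunt B b"
    "cmul B (unt B) = unt B \<otimes>\<^sub>k unt B" "cunt B (unt B) = 1"
    and mC: "cmul C (a' \<cdot>\<^bsub>C\<^esub> b') = tensor_mul C C (cmul C a') (cmul C b')" "cunt C (a' \<cdot>\<^bsub>C\<^esub> b') = cunt C a' * cunt C b'"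
    "cmul C (unt C) = unt C \<otimes>\<^sub>k unt C" "cunt C (unt C) = 1" for a b a' b'
    using B C by (auto simp: bialgebra_def)
  have ker: "eval_free B \<rho> P = 0 \<longleftrightarrow> eval_free C \<sigma> P = 0" for P
    using pB pC unfolding presented_by_def by blast
  have eq: "eval_free B \<rho> P = eval_free B \<rho> Q \<longleftrightarrow> eval_free C \<sigma> P = eval_free C \<sigma> Q" for P Q
    using ker[of "P - Q"] by (simp add: eval_free_diff)
  have sB: "surj (eval_free B \<rho>)" and sC: "surj (eval_free C \<sigma>)"
    using pB pC by (auto simp: presented_by_def)
  define F where "F b = eval_free C \<sigma> (inv_into UNIV (eval_free B \<rho>) b)" for b
  have F: "F (eval_free B \<rho> P) = eval_free C \<sigma> P" for P
    unfolding F_def eq[symmetric] by (rule surj_f_inv_f[OF sB])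
  have obt: "\<exists>P. b = eval_free B \<rho> P" for b using sB by (metis surjD)
  have "bij F"
  proof (rule bijI)
    show "inj F"
    proof (rule injI)
      fix b c assume "F b = F c"
      moreover obtain P Q where "b = eval_free B \<rho> P" "c = eval_free B \<rho> Q" using obt by metis
      ultimately show "b = c" by (simp add: F eq)
    qed
    show "surj F" using sC by (metis F surj_def)
  qed
  have Fm: "F (b \<cdot>\<^bsub>B\<^esub> c) = F b \<cdot>\<^bsub>C\<^esub> F c" for b c
  proof -
    obtain P Q where "b = eval_free B \<rho> P" "c = eval_free B \<rho> Q" using obt by metis
    then show ?thesis using F[of "P \<star> Q"] by (simp add: F eval_free_mul[OF aB] eval_free_mul[OF aC])
  qed
  have l: "klinear F"
    unfolding klinear_iff
  proof (intro conjI allI)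
    fix b c r
    obtain P Q where PQ: "b = eval_free B \<rho> P" "c = eval_free B \<rho> Q" using obt by metis
    then show "F (b + c) = F b + F c" using F[of "P + Q"] by (simp add: F eval_free_add)
    have e: "eval_free D \<tau> (Poly_Mapping.single [] r \<star> Q) = r *s eval_free D \<tau> Q"
      if "algebra_axioms D" for D :: "('k, 'n::finite) bialg" and \<tau>
      by (simp add: eval_free_mul[OF that] eval_free_single algebra_mul_simps[OF that])
    show "F (r *s c) = r *s F c"
      using F[of "Poly_Mapping.single [] r \<star> Q"] PQ
      by (simp add: eval_free_mul[OF aB] eval_free_mul[OF aC] eval_free_single algebra_mul_simps[OF aB]
          algebra_mul_simps[OF aC] F)
  qed
  have F1: "F (unt B) = unt C" using F[of "word []"] by (simp add: word_def eval_free_single)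
  have F\<rho>: "F (\<rho> z) = \<sigma> z" for z
    using F[of "word [z]"] by (simp add: word_def eval_free_single algebra_mul_simps[OF aB] algebra_mul_simps[OF aC])
  let ?FF = "tlift (\<lambda>u v. F u \<otimes>\<^sub>k F v)"
  note [lin] = klinear_compose[OF l] coalg_cmul[OF cB] coalg_cmul[OF cC] coalg_cunt[OF cB] coalg_cunt[OF cC]
  have FFm: "?FF (tensor_mul B B S T) = tensor_mul C C (?FF S) (?FF T)" for S T
    by (rule tensor_ext2[of "\<lambda>S T. ?FF (tensor_mul B B S T)"], (intro lin)+)
      (simp add: tensor_mul_tens aB aC tlift_tens lin Fm)
  have words: "cmul C (F b) = ?FF (cmul B b) \<and> cunt C (F b) = cunt B b"
    if "b = foldr (\<lambda>x b. \<rho> x \<cdot>\<^bsub>B\<^esub> b) w (unt B)" for b w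
    using that
  proof (induction w arbitrary: b)
    case Nil
    then show ?case by (simp add: F1 mB mC tlift_tens lin)
  next
    case (Cons x w)
    let ?b = "foldr (\<lambda>x b. \<rho> x \<cdot>\<^bsub>B\<^esub> b) w (unt B)"
    have "cmul C (\<sigma> x) = ?FF (cmul B (\<rho> x))" by (rule gen_cmul[OF l F1 F\<rho>])
    then show ?case using Cons.IH[OF refl] Cons.prems
      by (simp add: Fm mB mC FFm F\<rho> gen_cunt)
  qed
  have all: "cmul C (F b) = ?FF (cmul B b) \<and> cunt C (F b) = cunt B b" for b
  proof -
    obtain P where P: "b = eval_free B \<rho> P" using obt by blast
    let ?v = "\<lambda>w. foldr (\<lambda>x b. \<rho> x \<cdot>\<^bsub>B\<^esub> b) w (unt B)"
    have lc: "klinear (\<lambda>b. cmul C (F b))" "klinear (\<lambda>b. ?FF (cmul B b))" "kfunctional (\<lambda>b. cunt C (F b))" "kfunctional (cunt B)"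
      by (intro lin)+
    show ?thesis
      unfolding P eval_free_def
      by (simp add: klinear_sum_apply[OF lc(1)] klinear_sum_apply[OF lc(2)] kfunctional_sum_apply[OF lc(3)]
          kfunctional_sum_apply[OF lc(4)] klinear_smult[OF lc(1)] klinear_smult[OF lc(2)]
          kfunctional_smult[OF lc(3)] kfunctional_smult[OF lc(4)] words)
  qed
  have "hopf_iso B C F"
    using l F1 Fm \<open>bij F\<close> all by (simp add: hopf_iso_def hopf_hom_def coalgebra_map_def sw2_def)
  then show ?thesis by (auto simp: hopf_isomorphic_def)
qed

lemma grouplike_cunt:
  assumes "coalgebra_axioms B" "grouplike B u" "u \<noteq> 0"
  shows "cunt B u = 1"
proof -
  note [lin] = coalg_cunt[OF assms(1)]
  have "cunt B u *s u = u"
    using counit_left[OF assms(1) klinear_id, of u] assms(2)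
    by (simp add: sw2_def grouplike_def tlift_tens lin)
  then show ?thesis using assms(3) vec.scale_cancel_right[of "cunt B u" u 1] by simp
qed

lemma skew_primitive_cunt:
  assumes "coalgebra_axioms B" "skew_primitive B u x" "cunt B u = 1" "unt B \<noteq> 0"
  shows "cunt B x = 0"
proof -
  note [lin] = coalg_cunt[OF assms(1)]
  have "cunt B x *s unt B + x = x"
    using counit_left[OF assms(1) klinear_id, of x] assms(2,3)
    by (simp add: sw2_def skew_primitive_def tlift_tens lin klinear_plus[OF tlift_linear[OF klinear_id]])
  then show ?thesis using assms(4) by simp
qed

definition A4p_relations :: "nat \<Rightarrow> (gen list \<Rightarrow>\<^sub>0 'k::field) set" where
  "A4p_relations p = {word (replicate (2 * p) Gx), word [Gg, Gg] - word [], word [Gx, Gg] + word [Gg, Gx]}"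

text \<open>
  The comultiplication is prescribed on the two generators, and the counit law yields their counits.
\<close>

lemma A4p_isomorphic:
  fixes B :: "('k::field, 'i::finite) bialg" and C :: "('k, 'j::finite) bialg"
  assumes "is_A4p p B" "is_A4p p C"
  shows "B \<cong>\<^sub>H C"
proof -
  obtain g x where B: "hopf_algebra B" "presented_by B (case_gen g x) (A4p_relations p)" "grouplike B g" "skew_primitive B g x"
    using assms(1) by (auto simp: is_A4p_def A4p_relations_def)
  obtain g' x' where C: "hopf_algebra C" "presented_by C (case_gen g' x') (A4p_relations p)" "grouplike C g'" "skew_primitive C g' x'"
    using assms(2) by (auto simp: is_A4p_def A4p_relations_def)
  have counits: "cunt D u = 1" "cunt D z = 0"
    if "hopf_algebra D" "presented_by D (case_gen u z) (A4p_relations p)" "grouplike D u" "skew_primitive D u z"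
    for D :: "('k, 'n::finite) bialg" and u z
  proof -
    have ax: "algebra_axioms D" "coalgebra_axioms D" "cunt D (unt D) = 1"
      using that(1) by (auto simp: hopf_algebra_def bialgebra_def)
    have unt: "unt D \<noteq> 0" using ax(3) cmul_simps(10)[OF ax(2)] by auto
    have "eval_free D (case_gen u z) (word [Gg, Gg] - word []) = 0"
      using that(2) by (rule presented_relations) (simp add: A4p_relations_def)
    then have "u \<cdot>\<^bsub>D\<^esub> u = unt D"
      by (simp add: eval_free_diff word_def eval_free_single algebra_mul_simps[OF ax(1)])
    then have "u \<noteq> 0" using unt by (auto simp: algebra_mul_simps[OF ax(1)])
    then show "cunt D u = 1" by (rule grouplike_cunt[OF ax(2) that(3)])
    then show "cunt D z = 0" by (rule skew_primitive_cunt[OF ax(2) that(4) _ unt])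
  qed
  show ?thesis
  proof (rule presented_hopf_isomorphic[OF _ _ B(2) C(2)])
    show "cunt C (case_gen g' x' z) = cunt B (case_gen g x z)" for z
      using counits[OF B] counits[OF C] by (cases z) simp_all
    fix F z
    assume F: "klinear F" "F (unt B) = unt C" "\<And>z. F (case_gen g x z) = case_gen g' x' z"
    note [lin] = klinear_compose[OF F(1)]
    have "F g = g'" "F x = x'" using F(3)[of Gg] F(3)[of Gx] by simp_all
    then show "cmul C (case_gen g' x' z) = tlift (\<lambda>u v. F u \<otimes>\<^sub>k F v) (cmul B (case_gen g x z))"
      using B(3,4) C(3,4) F(2)
      by (cases z) (simp_all add: grouplike_def skew_primitive_def tlift_tens lin
          klinear_plus[OF tlift_linear[OF klinear_id]])
  qed (use B C in \<open>simp_all add: hopf_algebra_def\<close>)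
qed

abbreviation A4p_normal :: "nat \<times> nat \<Rightarrow> gen list" where
  "A4p_normal i \<equiv> replicate (fst i) Gg @ replicate (snd i) Gx"

text \<open>
  Prepending a letter to a normal form \<open>g\<^sup>ix\<^sup>j\<close> gives a multiple of a normal form again, after at most one
  use of \<open>g\<^sup>2 = 1\<close> or \<open>xg = -gx\<close>; if the degree in \<open>x\<close> reaches \<open>2p\<close>, the result is \<open>0\<close>.
\<close>

lemma A4p_reduction:
  fixes p :: nat
  assumes "p > 0"
  shows "\<exists>i\<in>{..<2} \<times> {..<2 * p}. \<exists>c. word w - Poly_Mapping.single (A4p_normal i) c
      \<in> genideal free_algebra (A4p_relations p :: (gen list \<Rightarrow>\<^sub>0 'k::field) set)"
proof -
  let ?F = "free_algebra :: (gen list \<Rightarrow>\<^sub>0 'k) ring"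
  define I where "I = genideal ?F (A4p_relations p)"
  interpret ring ?F by (rule free_algebra_ring)
  have "ideal I ?F" unfolding I_def by (rule genideal_ideal) (simp add: free_algebra_sel)
  then interpret I: ideal I ?F .
  have Iadd: "P + Q \<in> I" if "P \<in> I" "Q \<in> I" for P Q using I.a_closed[OF that] by (simp add: free_algebra_sel)
  have Imul: "S \<star> P \<in> I" "P \<star> S \<in> I" if "P \<in> I" for P S
    using I.I_l_closed[OF that] I.I_r_closed[OF that] by (simp_all add: free_algebra_sel)
  have R: "P \<in> I" if "P \<in> A4p_relations p" for P
    using that unfolding I_def genideal_def by blast
  have step: "word (z # w) - Q \<in> I" if "word w - P \<in> I" "word [z] \<star> P - Q \<in> I" for z :: gen and w P Q
  proof -
    have e: "word (z # w) - Q = word [z] \<star> (word w - P) + (word [z] \<star> P - Q)"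
      by (simp add: free_mul_diff) (simp add: word_def free_mul_single)
    show ?thesis unfolding e by (rule Iadd[OF Imul(1)[OF that(1)] that(2)])
  qed
  have goal: "\<exists>i\<in>{..<2} \<times> {..<2 * p}. \<exists>c. word w - Poly_Mapping.single (A4p_normal i) c \<in> I"
    if "word w - Poly_Mapping.single (A4p_normal (i, j)) c \<in> I" "i < 2" "j < 2 * p" for w i j c
    using that by (intro bexI[of _ "(i, j)"] exI[of _ c]) auto
  have zero: "\<exists>i\<in>{..<2} \<times> {..<2 * p}. \<exists>c. word w - Poly_Mapping.single (A4p_normal i) c \<in> I"
    if "word w \<in> I" for w
    by (rule goal[of w 0 0 0]) (use that assms in auto)
  have xx: "Poly_Mapping.single (replicate (2 * p) Gx) c \<in> I" for c
    using Imul(1)[OF R[of "word (replicate (2 * p) Gx)"], of "Poly_Mapping.single [] c"]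
    by (simp add: A4p_relations_def word_def free_mul_single)
  have gxx: "Poly_Mapping.single (Gg # replicate (2 * p) Gx) c \<in> I" for c
    using Imul(1)[OF xx[of c], of "word [Gg]"] by (simp add: word_def free_mul_single)
  have "\<exists>i\<in>{..<2} \<times> {..<2 * p}. \<exists>c. word w - Poly_Mapping.single (A4p_normal i) c \<in> I"
  proof (induction w)
    case Nil
    show ?case by (rule goal[of "[]" 0 0 1]) (use assms I.zero_closed in \<open>auto simp: word_def free_algebra_sel\<close>)
  next
    case (Cons z w)
    then obtain i j c where ij: "i < 2" "j < 2 * p" and w: "word w - Poly_Mapping.single (A4p_normal (i, j)) c \<in> I"
      by auto
    have i: "i = 0 \<or> i = 1" using ij by auto
    note st = step[OF w]
    show ?case
    proof (cases z)
      case Gg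
      show ?thesis
      proof (cases "i = 0")
        case True
        have "word [Gg] \<star> Poly_Mapping.single (A4p_normal (i, j)) c - Poly_Mapping.single (A4p_normal (1, j)) c \<in> I"
          using True I.zero_closed by (simp add: word_def free_mul_single free_algebra_sel)
        from st[OF this] show ?thesis unfolding Gg by (rule goal) (use ij in auto)
      next
        case False
        have "(word [Gg, Gg] - word []) \<star> Poly_Mapping.single (replicate j Gx) c \<in> I"
          by (intro Imul R) (simp add: A4p_relations_def)
        moreover have "(word [Gg, Gg] - word []) \<star> Poly_Mapping.single (replicate j Gx) c
          = Poly_Mapping.single (Gg # Gg # replicate j Gx) c - Poly_Mapping.single (replicate j Gx) c"
          using free_mul_add_left[of "word [Gg, Gg] - word []" "word []" "Poly_Mapping.single (replicate j Gx) c"]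
          by (simp add: word_def free_mul_single)
        ultimately have "word [Gg] \<star> Poly_Mapping.single (A4p_normal (i, j)) c - Poly_Mapping.single (A4p_normal (0, j)) c \<in> I"
          using i False by (simp add: word_def free_mul_single)
        from st[OF this] show ?thesis unfolding Gg by (rule goal) (use ij in auto)
      qed
    next
      case Gx
      show ?thesis
      proof (cases "i = 0")
        case True
        show ?thesis
        proof (cases "Suc j < 2 * p")
          case j: True
          have "word [Gx] \<star> Poly_Mapping.single (A4p_normal (i, j)) c - Poly_Mapping.single (A4p_normal (0, Suc j)) c \<in> I"
            using True I.zero_closed by (simp add: word_def free_mul_single free_algebra_sel)
          from st[OF this] show ?thesis unfolding Gx by (rule goal) (use j in auto)
        next
          case False
          then have j: "2 * p = Suc j" using ij by simp
          have "word [Gx] \<star> Poly_Mapping.single (A4p_normal (i, j)) c - 0 \<in> I"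
            using True xx[of c] unfolding j by (simp add: word_def free_mul_single)
          from st[OF this] show ?thesis unfolding Gx by (intro zero) simp
        qed
      next
        case False
        then have i: "i = 1" using i by simp
        have m: "(word [Gx, Gg] + word [Gg, Gx]) \<star> Poly_Mapping.single (replicate j Gx) c \<in> I"
          by (intro Imul R) (simp add: A4p_relations_def)
        have e: "(word [Gx, Gg] + word [Gg, Gx]) \<star> Poly_Mapping.single (replicate j Gx) c
          = word [Gx] \<star> Poly_Mapping.single (A4p_normal (i, j)) c + Poly_Mapping.single (Gg # replicate (Suc j) Gx) c"
          by (simp add: i word_def free_mul_single free_mul_add_left)
        show ?thesis
        proof (cases "Suc j < 2 * p")
          case True
          have "word [Gx] \<star> Poly_Mapping.single (A4p_normal (i, j)) c - Poly_Mapping.single (A4p_normal (1, Suc j)) (- c) \<in> I"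
            using m unfolding e by (simp add: single_uminus)
          from st[OF this] show ?thesis unfolding Gx by (rule goal) (use True in auto)
        next
          case False
          then have j: "2 * p = Suc j" using ij by simp
          have "Poly_Mapping.single (Gg # replicate (Suc j) Gx) (- c) \<in> I" using gxx[of "- c"] unfolding j .
          from Iadd[OF m this] have "word [Gx] \<star> Poly_Mapping.single (A4p_normal (i, j)) c - 0 \<in> I"
            unfolding e by (simp add: single_uminus)
          from st[OF this] show ?thesis unfolding Gx by (intro zero) simp
        qed
      qed
    qed
  qed
  then show ?thesis by (simp only: I_def)
qed

context truncated_sweedler begin

abbreviation "eval_GX \<equiv> eval_free (B 1) (case_gen G X)"

abbreviation normal_H :: "nat \<times> nat \<Rightarrow> 'k ^ 'h" where
  "normal_H i \<equiv> if fst i = 0 then if even (snd i) then \<one>\<^sub>H else x else if even (snd i) then g else w"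

text \<open>
  In \<open>B 1\<close> the powers of \<open>X\<close> are \<open>X\<^sup>2\<^sup>m = y\<^sup>m \<otimes> 1\<close> and \<open>X\<^sup>2\<^sup>m\<^sup>+\<^sup>1 = y\<^sup>m \<otimes> x\<close>, so the normal forms run through
  the tensor product basis.
\<close>

lemma eval_normal: "fst i < 2 \<Longrightarrow> eval_GX (word (A4p_normal i)) = ypow (snd i div 2) \<otimes>\<^sub>k normal_H i"
proof -
  have X: "(mul (B 1) X ^^ j) (unt (B 1))
      = ypow (j div 2) \<otimes>\<^sub>k (if even j then \<one>\<^sub>H else x)" for j
  proof (induction j)
    case (Suc j)
    then show ?case
      by (cases "even j") (auto simp: mulB circ_def ypow_Suc commA elim!: oddE)
  qed (simp add: B_sel(2) ypow_0)
  assume "fst i < 2"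
  then have "fst i = 0 \<or> fst i = 1" by auto
  then show ?thesis
    by (auto simp: word_def eval_free_single X mulB circ_def)
qed

lemma eval_surj: "surj eval_GX"
proof -
  let ?R = "range eval_GX"
  have add: "u + v \<in> ?R" if uv: "u \<in> ?R" "v \<in> ?R" for u v
  proof -
    obtain P Q where "u = eval_GX P" "v = eval_GX Q" using uv by blast
    then have "u + v = eval_GX (P + Q)" by (simp add: eval_free_add)
    then show ?thesis by (rule range_eqI)
  qed
  have zero: "0 \<in> ?R" by (rule range_eqI[where x = 0]) (simp add: eval_free_zero)
  have mul: "u \<cdot>\<^bsub>B 1\<^esub> v \<in> ?R" if uv: "u \<in> ?R" "v \<in> ?R" for u v
  proof -
    obtain P Q where "u = eval_GX P" "v = eval_GX Q" using uv by blast
    then have "u \<cdot>\<^bsub>B 1\<^esub> v = eval_GX (P \<star> Q)" by (simp add: eval_free_mul[OF B_algebra])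
    then show ?thesis by (rule range_eqI)
  qed
  have scale: "r *s u \<in> ?R" if "u \<in> ?R" for r u
  proof -
    have "r *s unt (B 1) \<in> ?R"
      by (rule range_eqI[where x = "Poly_Mapping.single [] r"]) (simp add: eval_free_single)
    from mul[OF this that] show ?thesis by (simp only: algebra_mul_simps[OF B_algebra])
  qed
  have sum: "(\<Sum>i\<in>N. u i) \<in> ?R" if "\<And>i. i \<in> N \<Longrightarrow> u i \<in> ?R" for u and N :: "'n set"
    using that
  proof (induction N rule: infinite_finite_induct)
    case (insert i N)
    then show ?case by (simp add: add)
  qed (simp_all add: zero)
  have nf: "ypow (j div 2) \<otimes>\<^sub>k normal_H (i, j) \<in> ?R" if "i < 2" for i j
    by (rule range_eqI[where x = "word (A4p_normal (i, j))"]) (use eval_normal[of "(i, j)"] that in simp)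
  have b: "b \<otimes>\<^sub>k \<one>\<^sub>H \<in> ?R" for b
  proof -
    have "(\<Sum>n<p. cy n b *s (ypow n \<otimes>\<^sub>k \<one>\<^sub>H)) \<in> ?R"
      using nf[of 0 "2 * n" for n] by (intro sum scale) simp
    also have "(\<Sum>n<p. cy n b *s (ypow n \<otimes>\<^sub>k \<one>\<^sub>H)) = b \<otimes>\<^sub>k \<one>\<^sub>H"
      by (subst (2) y_expansion) (simp add: tens_sum_left)
    finally show ?thesis .
  qed
  have h: "\<one>\<^sub>A \<otimes>\<^sub>k h \<in> ?R" for h
  proof -
    have "c1 h *s (\<one>\<^sub>A \<otimes>\<^sub>k \<one>\<^sub>H) + cg h *s (\<one>\<^sub>A \<otimes>\<^sub>k g) + cx h *s (\<one>\<^sub>A \<otimes>\<^sub>k x) + cw h *s (\<one>\<^sub>A \<otimes>\<^sub>k w) \<in> ?R"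
      using nf[of 0 0] nf[of 0 1] nf[of 1 0] nf[of 1 1] by (intro add scale) (simp_all add: ypow_0)
    also have "c1 h *s (\<one>\<^sub>A \<otimes>\<^sub>k \<one>\<^sub>H) + cg h *s (\<one>\<^sub>A \<otimes>\<^sub>k g) + cx h *s (\<one>\<^sub>A \<otimes>\<^sub>k x) + cw h *s (\<one>\<^sub>A \<otimes>\<^sub>k w) = \<one>\<^sub>A \<otimes>\<^sub>k h"
      by (subst (5) h_expansion) simp
    finally show ?thesis .
  qed
  have "b \<otimes>\<^sub>k h \<in> ?R" for b h
    using mul[OF b[of b] h[of h]] by (simp add: B_relations)
  then have "tlift (\<otimes>\<^sub>k) T \<in> ?R" for T :: "'k ^ ('a \<times> 'h)"
    unfolding tlift_def case_prod_unfold by (intro sum scale)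
  then have "T \<in> ?R" for T by (subst tensor_expansion)
  then show ?thesis by blast
qed

text \<open>
  The normal forms are linearly independent since the coordinate functionals of the tensor product
  basis separate them.
\<close>

lemma B_1_A4p:
  assumes "CARD('a) = p" "CARD('h) = 4"
  shows "is_A4p p (B 1)"
proof -
  have "presented_by (B 1) (case_gen G X) (A4p_relations p)"
  proof (rule presented_byI[OF B_algebra _ _ A4p_reduction _ eval_surj])
    fix P :: "gen list \<Rightarrow>\<^sub>0 'k" assume "P \<in> A4p_relations p"
    moreover have "eval_GX (word (replicate (2 * p) Gx)) = 0"
      using eval_normal[of "(0, 2 * p)"] by (simp add: ypow_p)
    moreover have "eval_GX (word [Gg, Gg] - word []) = 0" "eval_GX (word [Gx, Gg] + word [Gg, Gx]) = 0"
      using B_relations(1,2)[of 1]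
      by (simp_all add: word_def eval_free_diff eval_free_add eval_free_single algebra_mul_simps[OF B_algebra])
        (simp add: B_sel)
    ultimately show "eval_GX P = 0" by (auto simp: A4p_relations_def)
  next
    fix d :: "nat \<times> nat \<Rightarrow> 'k"
    assume d: "(\<Sum>i\<in>{..<2} \<times> {..<2 * p}. d i *s eval_GX (word (A4p_normal i))) = 0"
    show "\<forall>i\<in>{..<2} \<times> {..<2 * p}. d i = 0"
    proof
      fix i :: "nat \<times> nat" assume i: "i \<in> {..<2} \<times> {..<2 * p}"
      define s where "s = (if fst i = 0 then if even (snd i) then c1 else cx else if even (snd i) then cg else cw)"
      have [lin]: "klinear F \<Longrightarrow> kfunctional (\<lambda>v. s (F v))" for F :: "'k ^ 'n::finite \<Rightarrow> _"
        by (auto simp: s_def intro: lin)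
      \<comment> \<open>\<open>\<kappa>\<close> is the coefficient of the basis element that the normal form \<open>i\<close> evaluates to.\<close>
      define \<kappa> where "\<kappa> T = cy (snd i div 2) (tlift (\<lambda>b h. s h *s b) T)" for T
      have l: "kfunctional \<kappa>" unfolding \<kappa>_def[abs_def] by (intro lin)
      have "\<kappa> (eval_GX (word (A4p_normal j))) = (if j = i then 1 else 0)" if j: "j \<in> {..<2} \<times> {..<2 * p}" for j
      proof -
        have "s (normal_H j) = (if fst i = fst j \<and> even (snd i) = even (snd j) then 1 else 0)"
          using i j by (auto simp: s_def less_2_cases_iff)
        moreover have "snd j div 2 < p" using j by auto
        moreover have "j = i \<longleftrightarrow> snd i div 2 = snd j div 2 \<and> fst i = fst j \<and> even (snd i) = even (snd j)"
          by (cases i; cases j) (auto, metis dvd_div_mult_self odd_two_times_div_two_succ mult.commute)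
        moreover have "fst j < 2" using j by auto
        ultimately show ?thesis
          by (simp add: \<kappa>_def eval_normal tlift_tens lin cy_ypow)
      qed
      then have "\<kappa> (\<Sum>j\<in>{..<2} \<times> {..<2 * p}. d j *s eval_GX (word (A4p_normal j))) = (\<Sum>j\<in>{..<2} \<times> {..<2 * p}. if j = i then d j else 0)"
        unfolding kfunctional_sum_apply[OF l] kfunctional_smult[OF l] by (intro sum.cong) auto
      also have "\<dots> = d i" using i by (simp add: sum.delta')
      finally show "d i = 0" using kfunctional_0[OF l] by (simp add: d)
    qed
  qed (use p3 in auto)
  moreover have "vec.dim (UNIV :: ('k ^ ('a \<times> 'h)) set) = 4 * p"
    unfolding vec_dim_card by (simp add: assms)
  ultimately show ?thesis
    using B_hopf[of 1] B_cmul_generators[of 1]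
    unfolding is_A4p_def A4p_relations_def grouplike_def skew_primitive_def by blast
qed

section \<open>The second cohomology set\<close>

text \<open>
  Cocentrality compares the two orders of \<open>\<Delta> x = x \<otimes> 1 + g \<otimes> x\<close>: the coefficient of \<open>x\<close> gives
  \<open>r(g) = r(1)\<close>, and the coefficient of \<open>1\<close> gives \<open>r(x) = 0\<close>. The same argument applies to \<open>gx\<close>.
\<close>

lemma unitary_cocentral_trivial:
  assumes "unitary_cocentral H A r"
  shows "r h = \<epsilon> h *s \<one>\<^sub>A"
proof -
  have l: "klinear r" and r1: "r \<one>\<^sub>H = \<one>\<^sub>A"
    and c: "sw2 H (\<lambda>h1 h2. r h1 \<otimes>\<^sub>k h2) h = sw2 H (\<lambda>h1 h2. r h2 \<otimes>\<^sub>k h1) h" for h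
    using assms by (auto simp: unitary_cocentral_def coalgebra_map_def)
  note [lin] = klinear_compose[OF l]
  let ?c = "\<lambda>s. tlift (\<lambda>b h. s h *s b)"
  note s = sw2H lin r1 tlift_tens klinear_plus[OF tlift_linear[OF klinear_id]]
  have x: "r x = 0" "r g = \<one>\<^sub>A"
    using arg_cong[OF c[of x], of "?c c1"] arg_cong[OF c[of x], of "?c cx"] by (simp_all add: s)
  have w: "r w = 0"
    using arg_cong[OF c[of w], of "?c cg"] by (simp add: s)
  show ?thesis by (rule H_ext[of r], (intro lin)+) (simp_all add: r1 x w)
qed

lemma counit_unitary_cocentral: "unitary_cocentral H A (\<lambda>h. \<epsilon> h *s \<one>\<^sub>A)"
proof -
  have c: "cmul A (\<epsilon> h *s \<one>\<^sub>A) = sw2 H (\<lambda>h1 h2. (\<epsilon> h1 *s \<one>\<^sub>A) \<otimes>\<^sub>k (\<epsilon> h2 *s \<one>\<^sub>A)) h" for h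
    by (rule H_ext[of "\<lambda>h. cmul A (\<epsilon> h *s \<one>\<^sub>A)"], (intro lin)+) (simp_all add: sw2H lin)
  have s: "sw2 H (\<lambda>h1 h2. (\<epsilon> h1 *s \<one>\<^sub>A) \<otimes>\<^sub>k h2) h = sw2 H (\<lambda>h1 h2. (\<epsilon> h2 *s \<one>\<^sub>A) \<otimes>\<^sub>k h1) h" for h
    by (rule H_ext[of "sw2 H (\<lambda>h1 h2. (\<epsilon> h1 *s \<one>\<^sub>A) \<otimes>\<^sub>k h2)"], (intro lin)+) (simp_all add: sw2H lin)
  have l: "klinear (\<lambda>h. \<epsilon> h *s \<one>\<^sub>A)" by (intro lin)
  show ?thesis
    unfolding unitary_cocentral_def coalgebra_map_def
    by (intro conjI allI l c s) simp_all
qed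

lemma antipode_scalar: "antipode A (r *s \<one>\<^sub>A) = r *s \<one>\<^sub>A"
proof -
  obtain S where S: "is_antipode A S" using A by (auto simp: hopf_algebra_def)
  then have "antipode A = S"
    unfolding antipode_def using antipode_unique[OF algA coalgA] by blast
  moreover have l: "klinear S" and "sw2 A (\<lambda>b1 b2. S b1 \<cdot>\<^sub>A b2) \<one>\<^sub>A = cunt A \<one>\<^sub>A *s \<one>\<^sub>A"
    using S by (auto simp: is_antipode_def)
  then have "S \<one>\<^sub>A = \<one>\<^sub>A" using klinear_compose[OF l, THEN alg_mul_left[OF algA]]
    by (simp add: sw2_def tlift_tens lin)
  ultimately show ?thesis by (simp add: klinear_smult[OF l])
qed

lemma trivial_gauge:
  "sw4 H (\<lambda>h1 h2 h3 h4. sw3 H (\<lambda>g1 g2 g3. (\<epsilon> h1 *s \<one>\<^sub>A) \<cdot>\<^sub>A act h2 (\<epsilon> g1 *s \<one>\<^sub>A) \<cdot>\<^sub>A cocycle a h3 g2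
      \<cdot>\<^sub>A antipode A (\<epsilon> (h4 \<cdot>\<^sub>H g3) *s \<one>\<^sub>A)) k) h = cocycle a h k"
  "sw3 H (\<lambda>h1 h2 h3. (\<epsilon> h1 *s \<one>\<^sub>A) \<cdot>\<^sub>A act h2 b \<cdot>\<^sub>A antipode A (\<epsilon> h3 *s \<one>\<^sub>A)) h = act h b"
proof -
  show "sw4 H (\<lambda>h1 h2 h3 h4. sw3 H (\<lambda>g1 g2 g3. (\<epsilon> h1 *s \<one>\<^sub>A) \<cdot>\<^sub>A act h2 (\<epsilon> g1 *s \<one>\<^sub>A) \<cdot>\<^sub>A cocycle a h3 g2
      \<cdot>\<^sub>A antipode A (\<epsilon> (h4 \<cdot>\<^sub>H g3) *s \<one>\<^sub>A)) k) h = cocycle a h k"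
    unfolding sw3_def sw4_def antipode_scalar act_def cuntH_mul
    by (rule H_ext2[of "\<lambda>h k. sw2 H (\<lambda>h1 r. sw2 H (\<lambda>b1 r. sw2 H (\<lambda>b2 b3. sw2 H (\<lambda>b1a r. sw2 H
         (\<lambda>b2a b3a. (\<epsilon> h1 *s \<one>\<^sub>A) \<cdot>\<^sub>A (\<epsilon> b1 *s (\<epsilon> b1a *s \<one>\<^sub>A)) \<cdot>\<^sub>A cocycle a b2 b2a
          \<cdot>\<^sub>A ((\<epsilon> b3 * \<epsilon> b3a) *s \<one>\<^sub>A)) r) k) r) r) h" "cocycle a"], (intro lin)+)
      (auto simp: sw2H lin)
  show "sw3 H (\<lambda>h1 h2 h3. (\<epsilon> h1 *s \<one>\<^sub>A) \<cdot>\<^sub>A act h2 b \<cdot>\<^sub>A antipode A (\<epsilon> h3 *s \<one>\<^sub>A)) h = act h b"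
    unfolding sw3_def antipode_scalar act_def
    by (rule H_ext[of "sw2 H (\<lambda>b1 r. sw2 H (\<lambda>b2 b3. (\<epsilon> b1 *s \<one>\<^sub>A) \<cdot>\<^sub>A (\<epsilon> b2 *s b) \<cdot>\<^sub>A (\<epsilon> b3 *s \<one>\<^sub>A)) r)"],
         (intro lin)+) (simp_all add: sw2H lin)
qed

lemma CS_rel_eq: "CS_rel A H = Id_on (CS A H)"
proof (intro equalityI subsetI)
  fix z assume "z \<in> CS_rel A H"
  then obtain t f t' f' r where z: "z = ((t, f), (t', f'))" and CS: "(t, f) \<in> CS A H" "(t', f') \<in> CS A H"
    and r: "unitary_cocentral H A r"
    and f': "\<And>h g. f' h g = sw4 H (\<lambda>h1 h2 h3 h4. sw3 H (\<lambda>g1 g2 g3.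
            r h1 \<cdot>\<^sub>A t h2 (r g1) \<cdot>\<^sub>A f h3 g2 \<cdot>\<^sub>A antipode A (r (h4 \<cdot>\<^sub>H g3))) g) h"
    by (auto simp: CS_rel_def)
  have "t = act" "t' = act" using CS by (auto simp: CS_eq)
  moreover obtain a where a: "f = cocycle a" using CS by (auto simp: CS_eq)
  moreover have "f' h k = f h k" for h k
    unfolding f' unitary_cocentral_trivial[OF r] a \<open>t = act\<close> by (rule trivial_gauge)
  then have "f' = f" by blast
  ultimately show "z \<in> Id_on (CS A H)" using z CS by auto
next
  fix z assume "z \<in> Id_on (CS A H)"
  then obtain a where z: "z = ((act, cocycle a), (act, cocycle a))" by (auto simp: CS_eq)
  show "z \<in> CS_rel A H"
    unfolding z CS_rel_def using counit_unitary_cocentral B_in_CS[of a] trivial_gauge by (auto intro!: exI[of _ "\<lambda>h. \<epsilon> h *s \<one>\<^sub>A"])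
qed

lemma H2_bij: "\<exists>\<Phi>. bij_betw \<Phi> (H2 H A) (UNIV :: 'k set)"
proof -
  have "H2 H A = range (\<lambda>a. {(act, cocycle a)})"
    unfolding H2_def CS_rel_eq quotient_def by (auto simp: CS_eq)
  then have "bij_betw (\<lambda>a. {(act, cocycle a)}) UNIV (H2 H A)"
    by (auto simp: bij_betw_def inj_on_def dest: cocycle_inj)
  then show ?thesis using bij_betw_inv_into by blast
qed

end

section \<open>Coordinates from the definitions of the two Hopf algebras\<close>

lemma basis_coordinates:
  fixes e :: "'n \<Rightarrow> 'k::field ^ 'i::finite"
  assumes "finite I" "inj_on e I" "vec.independent (e ` I)" "vec.span (e ` I) = UNIV"
  shows "\<exists>c. (\<forall>i. kfunctional (c i)) \<and> (\<forall>v. v = (\<Sum>i\<in>I. c i v *s e i)) \<and>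
    (\<forall>i. \<forall>j\<in>I. c i (e j) = (if i = j then 1 else 0))"
proof -
  define c where "c i v = (if i \<in> I then vec.representation (e ` I) v (e i) else 0)" for i v
  have "kfunctional (c i)" for i
    unfolding kfunctional_iff c_def
    by (auto simp: vec.representation_add[OF assms(3)] vec.representation_scale[OF assms(3)] assms(4))
  moreover have "v = (\<Sum>i\<in>I. c i v *s e i)" for v
  proof -
    have "v = (\<Sum>b\<in>e ` I. vec.representation (e ` I) v b *s b)"
      using vec.sum_representation_eq[OF assms(3), of v "e ` I"] assms(1,4) by simp
    then show ?thesis by (simp add: sum.reindex[OF assms(2)] c_def)
  qed
  moreover have "c i (e j) = (if i = j then 1 else 0)" if "j \<in> I" for i j
    using that inj_onD[OF assms(2)] by (auto simp: c_def vec.representation_basis[OF assms(3)])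
  ultimately show ?thesis by blast
qed

text \<open>
  The presentation shows that the powers \<open>y\<^sup>n\<close> with \<open>n < p\<close> span \<open>A\<close>. As \<open>A\<close> has dimension \<open>p\<close>, they
  form a basis.
\<close>

lemma truncated_poly_coordinates:
  fixes A :: "('k::field, 'a::finite) bialg"
  assumes "is_truncated_poly p A"
  obtains y ypow cy where "hopf_algebra A" "primitive A y" "ypow 0 = unt A" "\<And>n. ypow (Suc n) = y \<cdot>\<^bsub>A\<^esub> ypow n"
    "ypow p = 0" "\<And>n. kfunctional (cy n)" "\<And>m n. n < p \<Longrightarrow> cy m (ypow n) = (if m = n then 1 else 0)"
    "\<And>b. b = (\<Sum>n<p. cy n b *s ypow n)" "CARD('a) = p"
proof -
  obtain y where A: "hopf_algebra A" and dim: "vec.dim (UNIV :: ('k ^ 'a) set) = p"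
    and pres: "presented_by A (\<lambda>_::unit. y) {word (replicate p ())}" and y: "primitive A y"
    using assms by (auto simp: is_truncated_poly_def)
  have alg: "algebra_axioms A" using A by (auto simp: hopf_algebra_def bialgebra_def)
  define ypow where "ypow n = (mul A y ^^ n) (unt A)" for n
  have yp: "ypow 0 = unt A" "ypow (Suc n) = y \<cdot>\<^bsub>A\<^esub> ypow n" for n by (simp_all add: ypow_def)
  have word: "foldr (\<lambda>x b. y \<cdot>\<^bsub>A\<^esub> b) u (unt A) = ypow (length u)" for u :: "unit list"
    by (induction u) (simp_all add: yp)
  have p0: "ypow p = 0"
    using presented_relations[OF pres, of "word (replicate p ())"]
    by (simp add: word_def eval_free_single ypow_def)
  have ge: "ypow n = 0" if "n \<ge> p" for n
    using that p0 by (induction n rule: dec_induct) (simp_all add: yp algebra_mul_simps[OF alg])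
  have "b \<in> vec.span (ypow ` {..<p})" for b
  proof -
    have "ypow n \<in> vec.span (ypow ` {..<p})" for n
      by (cases "n < p") (auto simp: ge vec.span_zero intro: vec.span_base)
    moreover obtain P where "b = eval_free A (\<lambda>_::unit. y) P"
      using pres by (auto simp: presented_by_def surj_def)
    ultimately show ?thesis
      unfolding eval_free_def word by (auto intro!: vec.span_sum vec.span_scale)
  qed
  then have span: "vec.span (ypow ` {..<p}) = UNIV" by blast
  have "p \<le> card (ypow ` {..<p})"
    using vec.dim_le_card[of UNIV "ypow ` {..<p}", unfolded dim] span by simp
  then have card: "card (ypow ` {..<p}) = p" using card_image_le[of "{..<p}" ypow] by simp
  have inj: "inj_on ypow {..<p}" by (rule eq_card_imp_inj_on) (simp_all add: card)
  have ind: "vec.independent (ypow ` {..<p})"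
    by (rule vec.card_le_dim_spanning[of _ UNIV]) (simp_all add: span card dim del: vec.dim_UNIV)
  obtain cy where cy: "\<And>i. kfunctional (cy i)" "\<And>v. v = (\<Sum>i\<in>{..<p}. cy i v *s ypow i)"
    "\<And>i j. j \<in> {..<p} \<Longrightarrow> cy i (ypow j) = (if i = j then 1 else 0)"
    using basis_coordinates[OF finite_lessThan inj ind span] by blast
  show thesis
    by (rule that[of y ypow cy]) (use A y yp p0 cy dim[unfolded vec_dim_card] in auto)
qed

lemma Sweedler_coordinates:
  fixes H :: "('k::field, 'h::finite) bialg"
  assumes "is_Sweedler H"
  obtains g x w c1 cg cx cw where "hopf_algebra H" "g \<cdot>\<^bsub>H\<^esub> g = unt H" "x \<cdot>\<^bsub>H\<^esub> x = 0" "g \<cdot>\<^bsub>H\<^esub> x = w"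
    "x \<cdot>\<^bsub>H\<^esub> g = - w" "grouplike H g" "skew_primitive H g x"
    "kfunctional c1" "kfunctional cg" "kfunctional cx" "kfunctional cw"
    "c1 (unt H) = 1" "cg (unt H) = 0" "cx (unt H) = 0" "cw (unt H) = 0"
    "c1 g = 0" "cg g = 1" "cx g = 0" "cw g = 0"
    "c1 x = 0" "cg x = 0" "cx x = 1" "cw x = 0"
    "c1 w = 0" "cg w = 0" "cx w = 0" "cw w = 1"
    "\<And>h. h = c1 h *s unt H + cg h *s g + cx h *s x + cw h *s w" "CARD('h) = 4"
proof -
  obtain g x where H: "hopf_algebra H" and dist: "distinct [unt H, g, x, g \<cdot>\<^bsub>H\<^esub> x]"
    and ind: "vec.independent {unt H, g, x, g \<cdot>\<^bsub>H\<^esub> x}" and span: "vec.span {unt H, g, x, g \<cdot>\<^bsub>H\<^esub> x} = UNIV"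
    and rel: "g \<cdot>\<^bsub>H\<^esub> g = unt H" "x \<cdot>\<^bsub>H\<^esub> x = 0" "x \<cdot>\<^bsub>H\<^esub> g = - (g \<cdot>\<^bsub>H\<^esub> x)"
    and gx: "grouplike H g" "skew_primitive H g x"
    using assms unfolding is_Sweedler_def by blast
  let ?l = "[unt H, g, x, g \<cdot>\<^bsub>H\<^esub> x]"
  have img: "nth ?l ` {..<4} = {unt H, g, x, g \<cdot>\<^bsub>H\<^esub> x}"
    by (auto simp: eval_nat_numeral lessThan_Suc)
  have inj: "inj_on (nth ?l) {..<4}"
    using dist by (intro inj_on_nth) auto
  obtain c where c: "\<And>i. kfunctional (c i)" "\<And>v. v = (\<Sum>i\<in>{..<4}. c i v *s ?l ! i)"
    "\<And>i j. j \<in> {..<4} \<Longrightarrow> c i (?l ! j) = (if i = j then 1 else 0)"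
    using basis_coordinates[OF finite_lessThan inj, unfolded img, OF ind span] by blast
  have v: "c i (unt H) = (if i = 0 then 1 else 0)" "c i g = (if i = 1 then 1 else 0)"
    "c i x = (if i = 2 then 1 else 0)" "c i (g \<cdot>\<^bsub>H\<^esub> x) = (if i = 3 then 1 else 0)" for i
    using c(3)[of 0 i] c(3)[of 1 i] c(3)[of 2 i] c(3)[of 3 i] by auto
  have card: "CARD('h) = 4"
    using vec.dim_span_eq_card_independent[OF ind] dist unfolding span vec_dim_card by auto
  show thesis
  proof (rule that[of g x "g \<cdot>\<^bsub>H\<^esub> x" "c 0" "c 1" "c 2" "c 3"])
    show "h = c 0 h *s unt H + c 1 h *s g + c 2 h *s x + c 3 h *s (g \<cdot>\<^bsub>H\<^esub> x)" for h
      using c(2)[of h] by (simp add: eval_nat_numeral lessThan_Suc add_ac)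
  qed (use H rel gx c(1) v card in auto)
qed

theorem proposition4p5:
  fixes A :: "('k::field, 'a::finite) bialg" and H4 :: "('k, 'h::finite) bialg" and p :: nat
  assumes "CHAR('k) = p" and "p \<ge> 3"
    and "is_truncated_poly p A" and "is_Sweedler H4"
  shows
    "(\<exists>A4p :: ('k, 'a \<times> 'h) bialg. is_A4p p A4p) \<and>
     (\<forall>A4p :: ('k, 'a \<times> 'h) bialg. is_A4p p A4p \<longrightarrow>
        (\<forall>(t, f)\<in>CS A H4. crossed_product A H4 t f \<cong>\<^sub>H tensor_bialg A H4 \<or>
                           crossed_product A H4 t f \<cong>\<^sub>H A4p) \<and>
        (\<exists>(t, f)\<in>CS A H4. crossed_product A H4 t f \<cong>\<^sub>H tensor_bialg A H4) \<and>
        (\<exists>(t, f)\<in>CS A H4. crossed_product A H4 t f \<cong>\<^sub>H A4p) \<and>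
        \<not> tensor_bialg A H4 \<cong>\<^sub>H A4p \<and>
        Aut_Hopf A4p \<cong> (units_group :: 'k monoid)) \<and>
     Aut_Hopf (tensor_bialg A H4) \<cong>
       (units_group :: 'k monoid) \<times>\<times> (units_group :: 'k monoid) \<and>
     (\<exists>\<Phi>. bij_betw \<Phi> (H2 H4 A) (UNIV :: 'k set))"
proof -
  obtain y ypow cy where A: "hopf_algebra A" "primitive A y" "ypow 0 = unt A" "\<And>n. ypow (Suc n) = y \<cdot>\<^bsub>A\<^esub> ypow n"
    "ypow p = 0" "\<And>n. kfunctional (cy n)" "\<And>m n. n < p \<Longrightarrow> cy m (ypow n) = (if m = n then 1 else 0)"
    "\<And>b. b = (\<Sum>n<p. cy n b *s ypow n)" and card_A: "CARD('a) = p"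
    by (rule truncated_poly_coordinates[OF assms(3)]) blast
  obtain g x w c1 cg cx cw where H: "hopf_algebra H4" "g \<cdot>\<^bsub>H4\<^esub> g = unt H4" "x \<cdot>\<^bsub>H4\<^esub> x = 0" "g \<cdot>\<^bsub>H4\<^esub> x = w"
    "x \<cdot>\<^bsub>H4\<^esub> g = - w" "grouplike H4 g" "skew_primitive H4 g x"
    "kfunctional c1" "kfunctional cg" "kfunctional cx" "kfunctional cw"
    "c1 (unt H4) = 1" "cg (unt H4) = 0" "cx (unt H4) = 0" "cw (unt H4) = 0"
    "c1 g = 0" "cg g = 1" "cx g = 0" "cw g = 0"
    "c1 x = 0" "cg x = 0" "cx x = 1" "cw x = 0"
    "c1 w = 0" "cg w = 0" "cx w = 0" "cw w = 1"
    "\<And>h. h = c1 h *s unt H4 + cg h *s g + cx h *s x + cw h *s w" and card_H: "CARD('h) = 4"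
    by (rule Sweedler_coordinates[OF assms(4)]) blast
  interpret truncated_sweedler A H4 p y g x w ypow cy c1 cg cx cw
    by (rule truncated_sweedler.intro) (assumption | rule assms(1,2) A H)+
  have A4p: "is_A4p p (B 1)" using card_A card_H by (rule B_1_A4p)
  have refl: "B a \<cong>\<^sub>H B a" for a
    unfolding hopf_isomorphic_def using rescale_hopf_iso[of 1 1 a a] by auto
  have main: "(\<forall>(t, f)\<in>CS A H4. crossed_product A H4 t f \<cong>\<^sub>H tensor_bialg A H4 \<or> crossed_product A H4 t f \<cong>\<^sub>H C) \<and>
      (\<exists>(t, f)\<in>CS A H4. crossed_product A H4 t f \<cong>\<^sub>H tensor_bialg A H4) \<and>
      (\<exists>(t, f)\<in>CS A H4. crossed_product A H4 t f \<cong>\<^sub>H C) \<and>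
      \<not> tensor_bialg A H4 \<cong>\<^sub>H C \<and> Aut_Hopf C \<cong> (units_group :: 'k monoid)"
    if "is_A4p p C" for C :: "('k, 'a \<times> 'h) bialg"
  proof (intro conjI)
    have C: "B 1 \<cong>\<^sub>H C" using A4p that by (rule A4p_isomorphic)
    have "B a \<cong>\<^sub>H B 0 \<or> B a \<cong>\<^sub>H C" for a
      using refl B_isomorphic[of a] C hopf_isomorphic_trans by metis
    then show "\<forall>(t, f)\<in>CS A H4. crossed_product A H4 t f \<cong>\<^sub>H tensor_bialg A H4 \<or> crossed_product A H4 t f \<cong>\<^sub>H C"
      by (auto simp: CS_eq B_def[symmetric] B_0[symmetric])
    show "\<exists>(t, f)\<in>CS A H4. crossed_product A H4 t f \<cong>\<^sub>H tensor_bialg A H4"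
      using B_in_CS[of 0] refl[of 0] by (auto simp: B_0[symmetric] B_def)
    show "\<exists>(t, f)\<in>CS A H4. crossed_product A H4 t f \<cong>\<^sub>H C"
      using B_in_CS[of 1] C by (auto simp: B_def)
    show "\<not> tensor_bialg A H4 \<cong>\<^sub>H C"
      using B_0_not_isomorphic hopf_isomorphic_trans[OF _ hopf_isomorphic_sym[OF C]] by (auto simp: B_0)
    show "Aut_Hopf C \<cong> (units_group :: 'k monoid)"
      using Aut_Hopf_cong[OF hopf_isomorphic_sym[OF C]] Aut_B_1 by (rule iso_trans)
  qed
  show ?thesis
    using A4p main Aut_B_0 H2_bij unfolding B_0 by blast
qed

end
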